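(* Let $n\ge4$. For every iterated sequence $S$ for $\operatorname{Gr}(2,\mathbb C^n)$ we have $\operatorname{in}_{M_S}(I_{2,n})=\operatorname{in}_{C_S}(I_{2,n})$, where $M_S$ is the weighting matrix of $S$ and $C_S$ is the maximal cone of $\operatorname{trop}(\operatorname{Gr}(2,\mathbb C^n))$ corresponding to the tree $T_S$.
   Context: $I_{2,n}\subset\mathbb C[p_{ij}]_{ij}$ (variables $p_{ij}$, $1\le i<j\le n$) is the Plücker ideal generated by $p_{ij}p_{kl}-p_{ik}p_{jl}+p_{il}p_{jk}$, $i<j<k<l$. For $1\le i<k\le n$ write $(i,k)$ for the positive root $\epsilon_i-\epsilon_k$ of $\mathfrak{sl}_n$, of height $k-i$; $f_{(i,k)}$ is the elementary matrix with $f_{(i,k)}e_i=e_k$, $f_{(i,k)}e_l=0$ for $l\neq i$. An iterated sequence is $S=((i_n,n),(j_n,n),\dots,(i_3,3),(j_3,3))=(\beta_1,\dots,\beta_d)$, $d=2(n-2)$, with $i_k\neq j_k$ in $\{1,\dots,k-1\}$ for all $3\le k\le n$. Let $\Psi(m)=\sum m_i\operatorname{ht}(\beta_i)$ on $\mathbb Z^d$; $m\prec_\Psi m'$ iff $\Psi(m)<\Psi(m')$, or $\Psi(m)=\Psi(m')$ and $m>_{lex}m'$. Let $P_{ij}\in\mathbb C[x_1,\dots,x_d]$ be the coefficient of $e_i\wedge e_j$ in $\exp(x_1f_{\beta_1})\cdots\exp(x_df_{\beta_d})(e_1\wedge e_2)$, and $\mathfrak v_S(\bar p_{ij})$ the $\prec_\Psi$-minimal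 exponent of a monomial occurring in $P_{ij}$. $M_S\in\mathbb Z^{d\times\binom n2}$ is the matrix with columns $\mathfrak v_S(\bar p_{ij})$. $\operatorname{in}_{M_S}(f)$ is the sum of those terms $a_mp^m$ of $f=\sum a_up^u$ with $M_Sm=\min_{\prec_\Psi}\{M_Su\mid a_u\neq0\}$, and $\operatorname{in}_{M_S}(I)=\langle\operatorname{in}_{M_S}(f)\mid f\in I\rangle$. Tree $T_S$: start with the tree with one internal vertex and leaves $1,2,3$; for $k=4,\dots,n$ replace the edge with leaf $i_k$ by three edges forming a cherry with leaves labelled $i_k$ and $k$. $C_S$ is the maximal cone of $\operatorname{trop}(\operatorname{Gr}(2,\mathbb C^n))$ (the set of $w\in\mathbb R^{\binom n2}$ with $\operatorname{in}_w(I_{2,n})$ monomial-free, as subfan of the Gröbner fan) containing in its relative interior the vector $\mathbf w_{T_S}$ with entries $-\#\{$internal edges on the path from leaf $i$ to leaf $j$ in $T_S\}$ (internal edge: joining two non-leaf vertices); $\operatorname{in}_{C_S}(I_{2,n})=\operatorname{in}_{\mathbf w_{T_S}}(I_{2,n})$, where $\operatorname{in}_w$ takes the terms of minimal $w$-weight. *)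

theory Defs
  imports
    "HOL-Analysis.Function_Topology"
    "HOL-Algebra.QuotRing"
    "HOL-Library.Poly_Mapping"
    "HOL-Library.Groups_Big_Fun"
    "HOL-Library.Fun_Lexorder"
begin

section \<open>Polynomial rings and ideals\<close>

type_synonym 'v cpoly = "('v \<Rightarrow>\<^sub>0 nat) \<Rightarrow>\<^sub>0 complex"

definition monomial :: "('v \<Rightarrow>\<^sub>0 nat) \<Rightarrow> 'v cpoly" where
  "monomial m = Poly_Mapping.single m 1"

definition pvar :: "'v \<Rightarrow> 'v cpoly" where
  "pvar v = monomial (Poly_Mapping.single v 1)"

text \<open>
  The type \<^typ>\<open>'v cpoly\<close> is the polynomial ring in all variables of type \<open>'v\<close>;
  \<open>poly_ring V\<close> is its subring of polynomials in the variables in \<open>V\<close> only.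
\<close>

definition poly_ring :: "'v set \<Rightarrow> 'v cpoly ring" where
  "poly_ring V = \<lparr>carrier = {f. \<forall>m\<in>Poly_Mapping.keys f. Poly_Mapping.keys m \<subseteq> V},
     monoid.mult = (*), one = 1, zero = 0, add = (+)\<rparr>"

lemma poly_ring_add_closed:
  assumes "f \<in> carrier (poly_ring V)" and "g \<in> carrier (poly_ring V)"
  shows "f + g \<in> carrier (poly_ring V)"
  using assms Poly_Mapping.keys_add[of f g] unfolding poly_ring_def by auto

lemma poly_ring_mult_closed:
  assumes "f \<in> carrier (poly_ring V)" and "g \<in> carrier (poly_ring V)"
  shows "f * g \<in> carrier (poly_ring V)"
proof -
  have "Poly_Mapping.keys m \<subseteq> V" if m: "m \<in> Poly_Mapping.keys (f * g)" for m
  proof -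
    obtain a b where ab: "a \<in> Poly_Mapping.keys f" "b \<in> Poly_Mapping.keys g" "m = a + b"
      using m Poly_Mapping.keys_mult[of f g] by blast
    then have "Poly_Mapping.keys a \<subseteq> V" "Poly_Mapping.keys b \<subseteq> V"
      using assms by (simp_all add: poly_ring_def)
    then show ?thesis
      using ab(3) Poly_Mapping.keys_add[of a b] by blast
  qed
  then show ?thesis by (simp add: poly_ring_def)
qed

lemma cring_poly_ring: "cring (poly_ring V)"
proof (rule cringI)
  show "abelian_group (poly_ring V)"
  proof (rule abelian_groupI)
    fix f assume "f \<in> carrier (poly_ring V)"
    then have "- f \<in> carrier (poly_ring V)"
      by (simp add: poly_ring_def in_keys_iff)
    moreover have "- f \<oplus>\<^bsub>poly_ring V\<^esub> f = \<zero>\<^bsub>poly_ring V\<^esub>"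
      by (simp add: poly_ring_def)
    ultimately show "\<exists>g\<in>carrier (poly_ring V). g \<oplus>\<^bsub>poly_ring V\<^esub> f = \<zero>\<^bsub>poly_ring V\<^esub>"
      by blast
  next
    fix f g assume "f \<in> carrier (poly_ring V)" "g \<in> carrier (poly_ring V)"
    then have "f + g \<in> carrier (poly_ring V)" by (rule poly_ring_add_closed)
    then show "f \<oplus>\<^bsub>poly_ring V\<^esub> g \<in> carrier (poly_ring V)"
      by (simp add: poly_ring_def)
  qed (simp_all add: poly_ring_def add.commute add.left_commute)
  show "Group.comm_monoid (poly_ring V)"
  proof (rule comm_monoidI)
    fix f g assume "f \<in> carrier (poly_ring V)" "g \<in> carrier (poly_ring V)"
    then have "f * g \<in> carrier (poly_ring V)" by (rule poly_ring_mult_closed)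
    then show "f \<otimes>\<^bsub>poly_ring V\<^esub> g \<in> carrier (poly_ring V)"
      by (simp add: poly_ring_def)
  qed (simp_all add: poly_ring_def mult.commute mult.left_commute)
qed (simp add: poly_ring_def distrib_right)


section \<open>The Pluecker ideal\<close>

definition plucker_idx :: "nat \<Rightarrow> (nat \<times> nat) set" where
  "plucker_idx n = {(i, j). 1 \<le> i \<and> i < j \<and> j \<le> n}"

definition plucker_ring :: "nat \<Rightarrow> (nat \<times> nat) cpoly ring" where
  "plucker_ring n = poly_ring (plucker_idx n)"

definition plucker_ideal :: "nat \<Rightarrow> (nat \<times> nat) cpoly set" where
  "plucker_ideal n = Idl\<^bsub>plucker_ring n\<^esub>
     {pvar (i, j) * pvar (k, l) - pvar (i, k) * pvar (j, l) + pvar (i, l) * pvar (j, k)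
      | i j k l. 1 \<le> i \<and> i < j \<and> j < k \<and> k < l \<and> l \<le> n}"


section \<open>Iterated sequences and the weighting matrix\<close>

text \<open>The positive root \<open>\<epsilon>\<^sub>i - \<epsilon>\<^sub>k\<close> is the pair \<open>(i, k)\<close>; the root \<open>\<beta>\<^sub>r\<close> of \<open>S\<close> is \<open>S ! (r - 1)\<close>.\<close>

type_synonym root_seq = "(nat \<times> nat) list"

definition iterated_sequence :: "nat \<Rightarrow> root_seq \<Rightarrow> bool" where
  "iterated_sequence n S \<longleftrightarrow> (\<exists>i j.
     (\<forall>k\<in>{3..n}. i k \<in> {1..k - 1} \<and> j k \<in> {1..k - 1} \<and> i k \<noteq> j k) \<and>
     S = concat (map (\<lambda>k. [(i k, k), (j k, k)]) (rev [3..<Suc n])))"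

definition height :: "nat \<times> nat \<Rightarrow> nat" where
  "height \<beta> = snd \<beta> - fst \<beta>"

text \<open>
  A vector of \<open>\<int>\<^sup>d\<close> with \<open>d = length S\<close> is a function \<^typ>\<open>nat \<Rightarrow> int\<close> vanishing outside \<open>{1..d}\<close>;
  on these, \<^const>\<open>less_fun\<close> is the lexicographic order.
\<close>

definition Psi :: "root_seq \<Rightarrow> (nat \<Rightarrow> int) \<Rightarrow> int" where
  "Psi S m = (\<Sum>r=1..length S. m r * int (height (S ! (r - 1))))"

definition prec_Psi :: "root_seq \<Rightarrow> (nat \<Rightarrow> int) \<Rightarrow> (nat \<Rightarrow> int) \<Rightarrow> bool" where
  "prec_Psi S m m' \<longleftrightarrow> Psi S m < Psi S m' \<or> Psi S m = Psi S m' \<and> less_fun m' m"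

definition min_Psi :: "root_seq \<Rightarrow> (nat \<Rightarrow> int) set \<Rightarrow> nat \<Rightarrow> int" where
  "min_Psi S A = (THE a. a \<in> A \<and> (\<forall>b\<in>A. b \<noteq> a \<longrightarrow> prec_Psi S a b))"

text \<open>
  A vector \<open>v\<close> of the free module with basis \<open>e\<^sub>1, e\<^sub>2, \<dots>\<close> over \<open>\<complex>[x]\<close> is its coordinate function;
  \<open>f_root (i, k)\<close> is the linear map with \<open>e\<^sub>i \<mapsto> e\<^sub>k\<close> and \<open>e\<^sub>l \<mapsto> 0\<close> for \<open>l \<noteq> i\<close>.
\<close>

definition unit_vec :: "nat \<Rightarrow> nat \<Rightarrow> nat cpoly" where
  "unit_vec i = (\<lambda>l. if l = i then 1 else 0)"

definition f_root :: "nat \<times> nat \<Rightarrow> (nat \<Rightarrow> nat cpoly) \<Rightarrow> nat \<Rightarrow> nat cpoly" where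
  "f_root \<beta> v = (\<lambda>l. if l = snd \<beta> then v (fst \<beta>) else 0)"

text \<open>
  The exponential series of \<open>t f\<^sub>\<beta>\<close>. As \<open>f\<^sub>\<beta>\<close> is nilpotent, only finitely many terms are nonzero,
  which is what \<^const>\<open>Sum_any\<close> needs.
\<close>

definition exp_root :: "nat \<times> nat \<Rightarrow> nat cpoly \<Rightarrow> (nat \<Rightarrow> nat cpoly) \<Rightarrow> nat \<Rightarrow> nat cpoly" where
  "exp_root \<beta> t v =
     (\<lambda>l. Sum_any (\<lambda>r. Poly_Mapping.single 0 (1 / fact r) * t ^ r * (f_root \<beta> ^^ r) v l))"

definition exp_product :: "root_seq \<Rightarrow> (nat \<Rightarrow> nat cpoly) \<Rightarrow> nat \<Rightarrow> nat cpoly" where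
  "exp_product S v = foldr (\<lambda>r. exp_root (S ! (r - 1)) (pvar r)) [1..<Suc (length S)] v"

text \<open>The coefficient of \<open>e\<^sub>i \<and> e\<^sub>j\<close>, \<open>i < j\<close>, in \<open>v \<and> w\<close>.\<close>

definition wedge :: "(nat \<Rightarrow> nat cpoly) \<Rightarrow> (nat \<Rightarrow> nat cpoly) \<Rightarrow> nat \<times> nat \<Rightarrow> nat cpoly" where
  "wedge v w = (\<lambda>(i, j). v i * w j - v j * w i)"

text \<open>A group element \<open>g\<close> acts on the exterior square by \<open>g (v \<and> w) = g v \<and> g w\<close>.\<close>

definition P_poly :: "root_seq \<Rightarrow> nat \<times> nat \<Rightarrow> nat cpoly" where
  "P_poly S = wedge (exp_product S (unit_vec 1)) (exp_product S (unit_vec 2))"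

definition val_S :: "root_seq \<Rightarrow> nat \<times> nat \<Rightarrow> nat \<Rightarrow> int" where
  "val_S S p = min_Psi S ((\<lambda>m r. int (Poly_Mapping.lookup m r)) ` Poly_Mapping.keys (P_poly S p))"

text \<open>\<open>M_mat S r p\<close> is the entry of \<open>M\<^sub>S\<close> in row \<open>r\<close> and column \<open>p\<close>.\<close>

definition M_mat :: "root_seq \<Rightarrow> nat \<Rightarrow> nat \<times> nat \<Rightarrow> int" where
  "M_mat S r p = val_S S p r"

definition M_mult :: "nat \<Rightarrow> root_seq \<Rightarrow> (nat \<times> nat \<Rightarrow>\<^sub>0 nat) \<Rightarrow> nat \<Rightarrow> int" where
  "M_mult n S m = (\<lambda>r. \<Sum>p\<in>plucker_idx n. M_mat S r p * int (Poly_Mapping.lookup m p))"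


section \<open>Initial ideals\<close>

definition init_form_M :: "nat \<Rightarrow> root_seq \<Rightarrow> (nat \<times> nat) cpoly \<Rightarrow> (nat \<times> nat) cpoly" where
  "init_form_M n S f =
     (\<Sum>m\<in>{m \<in> Poly_Mapping.keys f.
          M_mult n S m = min_Psi S (M_mult n S ` Poly_Mapping.keys f)}.
        Poly_Mapping.single m (Poly_Mapping.lookup f m))"

definition init_ideal_M :: "nat \<Rightarrow> root_seq \<Rightarrow> (nat \<times> nat) cpoly set \<Rightarrow> (nat \<times> nat) cpoly set" where
  "init_ideal_M n S I = Idl\<^bsub>plucker_ring n\<^esub> (init_form_M n S ` I)"

type_synonym weight = "nat \<times> nat \<Rightarrow> real"

definition w_mult :: "nat \<Rightarrow> weight \<Rightarrow> (nat \<times> nat \<Rightarrow>\<^sub>0 nat) \<Rightarrow> real" where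
  "w_mult n w m = (\<Sum>p\<in>plucker_idx n. w p * real (Poly_Mapping.lookup m p))"

definition init_form_w :: "nat \<Rightarrow> weight \<Rightarrow> (nat \<times> nat) cpoly \<Rightarrow> (nat \<times> nat) cpoly" where
  "init_form_w n w f =
     (\<Sum>m\<in>{m \<in> Poly_Mapping.keys f.
          w_mult n w m = Min (w_mult n w ` Poly_Mapping.keys f)}.
        Poly_Mapping.single m (Poly_Mapping.lookup f m))"

definition init_ideal_w :: "nat \<Rightarrow> weight \<Rightarrow> (nat \<times> nat) cpoly set \<Rightarrow> (nat \<times> nat) cpoly set" where
  "init_ideal_w n w I = Idl\<^bsub>plucker_ring n\<^esub> (init_form_w n w ` I)"


section \<open>The tropical Grassmannian as a subfan of the Groebner fan\<close>

text \<open>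
  The space \<open>\<real>\<close> to the power \<open>n choose 2\<close> consists of the functions vanishing outside
  \<^term>\<open>plucker_idx n\<close>, with the topology inherited from the product topology on
  \<^typ>\<open>weight\<close>, which is the Euclidean one.
\<close>

definition weight_space :: "nat \<Rightarrow> weight set" where
  "weight_space n = {w. \<forall>p. p \<notin> plucker_idx n \<longrightarrow> w p = 0}"

definition monomial_free :: "(nat \<times> nat) cpoly set \<Rightarrow> bool" where
  "monomial_free I \<longleftrightarrow> (\<forall>m. monomial m \<notin> I)"

definition trop_Gr :: "nat \<Rightarrow> weight set" where
  "trop_Gr n = {w \<in> weight_space n. monomial_free (init_ideal_w n w (plucker_ideal n))}"

text \<open>
  The cones of the Groebner fan are the closures of the classes of weights with a common
  initial ideal; they cover the whole space, because the Pluecker ideal is homogeneous.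
\<close>

definition groebner_cones :: "nat \<Rightarrow> weight set set" where
  "groebner_cones n =
     {closure {w' \<in> weight_space n.
        init_ideal_w n w' (plucker_ideal n) = init_ideal_w n w (plucker_ideal n)}
      | w. w \<in> weight_space n}"

definition trop_cones :: "nat \<Rightarrow> weight set set" where
  "trop_cones n = {C \<in> groebner_cones n. C \<subseteq> trop_Gr n}"

definition maximal_trop_cone :: "nat \<Rightarrow> weight set \<Rightarrow> bool" where
  "maximal_trop_cone n C \<longleftrightarrow> C \<in> trop_cones n \<and> (\<forall>C'\<in>trop_cones n. C \<subseteq> C' \<longrightarrow> C' = C)"

text \<open>
  The functions \<^typ>\<open>weight\<close> are not of class \<open>euclidean_space\<close>, so the library's \<open>affine hull\<close>
  and \<open>rel_interior\<close> do not apply; the following are their definitions for this type.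
\<close>

definition weight_affine_hull :: "weight set \<Rightarrow> weight set" where
  "weight_affine_hull C =
     {(\<lambda>p. \<Sum>c\<in>F. u c * c p) | F u. finite F \<and> F \<subseteq> C \<and> (\<Sum>c\<in>F. u c) = (1 :: real)}"

definition weight_rel_interior :: "weight set \<Rightarrow> weight set" where
  "weight_rel_interior C =
     {w. \<exists>U. openin (top_of_set (weight_affine_hull C)) U \<and> w \<in> U \<and> U \<subseteq> C}"

text \<open>The initial ideal shared by all weights in the relative interior of a cone.\<close>

definition init_ideal_cone :: "nat \<Rightarrow> weight set \<Rightarrow> (nat \<times> nat) cpoly set \<Rightarrow> (nat \<times> nat) cpoly set" where
  "init_ideal_cone n C I = (THE J. \<forall>w\<in>weight_rel_interior C. init_ideal_w n w I = J)"


section \<open>The tree of an iterated sequence\<close>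

text \<open>A tree is given by its set of edges, each a two-element set of vertices.\<close>

datatype vertex = Leaf nat | Inner nat

definition tripod :: "vertex set set" where
  "tripod = {{Inner 3, Leaf l} | l. l \<in> {1, 2, 3}}"

text \<open>The edge from \<open>v\<close> to leaf \<open>i\<close> is replaced by a new vertex joined to \<open>v\<close>, leaf \<open>i\<close> and leaf \<open>k\<close>.\<close>

definition attach_cherry :: "nat \<Rightarrow> nat \<Rightarrow> vertex set set \<Rightarrow> vertex set set" where
  "attach_cherry i k E =
     {e \<in> E. Leaf i \<notin> e} \<union> {{v, Inner k} | v. {v, Leaf i} \<in> E} \<union>
     {{Inner k, Leaf i}, {Inner k, Leaf k}}"

text \<open>In an iterated sequence, \<open>(i\<^sub>k, k)\<close> is at position \<open>2 (n - k)\<close>, counted from 0.\<close>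

definition tree_of :: "nat \<Rightarrow> root_seq \<Rightarrow> vertex set set" where
  "tree_of n S = fold (\<lambda>k. attach_cherry (fst (S ! (2 * (n - k)))) k) [4..<Suc n] tripod"

definition is_path :: "vertex set set \<Rightarrow> vertex \<Rightarrow> vertex \<Rightarrow> vertex list \<Rightarrow> bool" where
  "is_path E u v ps \<longleftrightarrow> ps \<noteq> [] \<and> hd ps = u \<and> last ps = v \<and> distinct ps \<and>
     (\<forall>r. Suc r < length ps \<longrightarrow> {ps ! r, ps ! Suc r} \<in> E)"

definition internal_edges_on :: "vertex list \<Rightarrow> vertex set set" where
  "internal_edges_on ps = {{ps ! r, ps ! Suc r} | r.
     Suc r < length ps \<and> ps ! r \<in> Inner ` UNIV \<and> ps ! Suc r \<in> Inner ` UNIV}"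

definition tree_weight :: "nat \<Rightarrow> root_seq \<Rightarrow> weight" where
  "tree_weight n S = (\<lambda>(i, j).
     if (i, j) \<in> plucker_idx n
     then - real (card (internal_edges_on (THE ps. is_path (tree_of n S) (Leaf i) (Leaf j) ps)))
     else 0)"

text \<open>The property characterizing the cone \<open>C\<^sub>S\<close>.\<close>

definition is_tree_cone :: "nat \<Rightarrow> root_seq \<Rightarrow> weight set \<Rightarrow> bool" where
  "is_tree_cone n S C \<longleftrightarrow> maximal_trop_cone n C \<and> tree_weight n S \<in> weight_rel_interior C"

end

theory Submission
  imports Defs "HOL-Library.Multiset"
begin

text \<open>
  Let \<open>c\<^sub>1, \<dots>, c\<^sub>n\<close> be the columns of the \<open>2 \<times> n\<close> matrix whose minors are the \<open>P\<^sub>x\<^sub>y\<close>. The exponential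
  product gives \<open>c\<^sub>k = a\<^sub>k c\<^sub>i + b\<^sub>k c\<^sub>j\<close> with \<open>i = i\<^sub>k\<close>, \<open>j = j\<^sub>k\<close> and two fresh variables \<open>a\<^sub>k\<close>, \<open>b\<^sub>k\<close>, hence
  \<open>P\<^sub>x\<^sub>k = a\<^sub>k P\<^sub>x\<^sub>i + b\<^sub>k P\<^sub>x\<^sub>j\<close> for \<open>x < k\<close>. Expanding this recursively and taking the \<open>a\<close>-term whenever it does
  not vanish singles out one monomial \<open>V x y\<close> of each \<open>P\<^sub>x\<^sub>y\<close>. It is the leading monomial for every
  translation-invariant strict order on exponents that puts each \<open>a\<close>-term before the competing
  \<open>b\<close>-term (locale \<open>iterated_order\<close>, lemma \<open>leads_P\<close>).

  The theorem compares two such orders. The order of the weighting matrix is one because all monomials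
  of \<open>P\<^sub>x\<^sub>y\<close> have the same \<open>\<Psi>\<close>-value, so the lexicographic tie-break decides. A weight \<open>u\<close> on pairs of leaves
  is induced by a linear form on exponents, and that form defines such an order, whenever \<open>u\<close> satisfies
  the four-point condition of the tree (\<open>tree_metric\<close>); the negated numbers of internal edges do so.

  For each of these orders the initial ideal is the same toric ideal, the kernel of the monomial map
  that sends \<open>p\<^sub>x\<^sub>y\<close> to the leading term of \<open>s\<^sub>x s\<^sub>y P\<^sub>x\<^sub>y\<close> (theorem \<open>initial_ideal_eq_toric_ideal\<close>); the extra
  variables \<open>s\<^sub>x\<close> record the multidegree. One inclusion reads off the coefficient at the leading exponent
  in \<open>f(s\<^sub>x s\<^sub>y P\<^sub>x\<^sub>y) = 0\<close>, for \<open>f\<close> in the Pluecker ideal. For the other one, the order singles out one of the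
  three pairings of any four leaves as the largest and ties the other two, so that the initial part of
  each Pluecker relation is a binomial that swaps the ends of two edges. These swaps connect every fibre
  of the monomial map (\<open>conn_fibre\<close>): merging leaf \<open>L\<close> into its cherry partner \<open>i\<^sub>L\<close> reduces \<open>L\<close> leaves to
  \<open>L - 1\<close>, swaps lift back along the merging, and swaps also move the marks that tell \<open>L\<close> from \<open>i\<^sub>L\<close>.

  For the cone \<open>C\<close>, the closure of a class of weights with equal initial ideals, the tree weight lies in \<open>C\<close>.
  Weights of the class that are close to it satisfy the strict four-point inequalities, and the four-point
  equations as well because their initial ideals contain no monomial. So the class consists of the
  weights that satisfy the four-point condition, and these also contain the relative interior of \<open>C\<close>:
  moving from the tree weight through a point with a tight inequality leads out of \<open>C\<close>.
\<close>


section \<open>Evaluation of polynomials and leading terms\<close>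

text \<open>Exponents are treated as multisets of variables, so that statements about monomials follow by adding
  one factor at a time.\<close>

definition mset_of :: "('v \<Rightarrow>\<^sub>0 nat) \<Rightarrow> 'v multiset" where
  "mset_of m = Abs_multiset (Poly_Mapping.lookup m)"

definition mexp :: "'v multiset \<Rightarrow> 'v \<Rightarrow>\<^sub>0 nat" where
  "mexp A = (\<Sum>p\<in>#A. Poly_Mapping.single p 1)"

lemma count_mset_of [simp]: "count (mset_of m) p = Poly_Mapping.lookup m p"
proof -
  have "finite {x. 0 < Poly_Mapping.lookup m x}"
    using finite_lookup[of m] by simp
  then show ?thesis by (simp add: mset_of_def)
qed

lemma mset_of_zero [simp]: "mset_of 0 = {#}"
  by (rule multiset_eqI) simp

lemma mset_of_add [simp]: "mset_of (m + m') = mset_of m + mset_of m'"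
  by (rule multiset_eqI) (simp add: lookup_add)

lemma mset_of_single [simp]: "mset_of (Poly_Mapping.single p (Suc 0)) = {#p#}"
  by (rule multiset_eqI) (simp add: lookup_single when_def)

lemma set_mset_of [simp]: "set_mset (mset_of m) = Poly_Mapping.keys m"
  by (auto simp: set_mset_def in_keys_iff)

lemma mexp_empty [simp]: "mexp {#} = 0"
  by (simp add: mexp_def)

lemma mexp_add_mset [simp]: "mexp (add_mset p A) = Poly_Mapping.single p 1 + mexp A"
  by (simp add: mexp_def)

lemma mexp_add: "mexp (A + B) = mexp A + mexp B"
  by (simp add: mexp_def)

lemma mset_of_mexp [simp]: "mset_of (mexp A) = A"
  by (induction A) auto

lemma mexp_mset_of [simp]: "mexp (mset_of m) = m"
proof (rule poly_mapping_eqI)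
  fix p
  have "Poly_Mapping.lookup (mexp (mset_of m)) p = count (mset_of (mexp (mset_of m))) p"
    by (simp only: count_mset_of)
  then show "Poly_Mapping.lookup (mexp (mset_of m)) p = Poly_Mapping.lookup m p" by simp
qed

lemma mexp_eq_iff [simp]: "mexp A = mexp B \<longleftrightarrow> A = B"
  by (metis mset_of_mexp)

definition eval_mon :: "('v \<Rightarrow> 'a::comm_monoid_mult) \<Rightarrow> ('v \<Rightarrow>\<^sub>0 nat) \<Rightarrow> 'a" where
  "eval_mon Q m = (\<Prod>p\<in>#mset_of m. Q p)"

lemma eval_mon_add: "eval_mon Q (m + m') = eval_mon Q m * eval_mon Q m'"
  by (simp add: eval_mon_def)

lemma eval_mon_single [simp]: "eval_mon Q (Poly_Mapping.single p (Suc 0)) = Q p"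
  by (simp add: eval_mon_def)

definition eval_poly :: "('v \<Rightarrow> 'x cpoly) \<Rightarrow> 'v cpoly \<Rightarrow> 'x cpoly" where
  "eval_poly Q f = (\<Sum>m\<in>Poly_Mapping.keys f.
     Poly_Mapping.single 0 (Poly_Mapping.lookup f m) * eval_mon Q m)"

lemma eval_poly_superset:
  assumes "finite X" "Poly_Mapping.keys f \<subseteq> X"
  shows "eval_poly Q f = (\<Sum>m\<in>X. Poly_Mapping.single 0 (Poly_Mapping.lookup f m) * eval_mon Q m)"
  unfolding eval_poly_def using assms
  by (intro sum.mono_neutral_left) (auto simp: in_keys_iff)

lemma eval_poly_zero [simp]: "eval_poly Q 0 = 0"
  by (simp add: eval_poly_def)

lemma eval_poly_single: "eval_poly Q (Poly_Mapping.single m c) = Poly_Mapping.single 0 c * eval_mon Q m"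
  by (subst eval_poly_superset[of "{m}"]) auto

lemma eval_poly_add: "eval_poly Q (f + g) = eval_poly Q f + eval_poly Q g"
proof -
  let ?X = "Poly_Mapping.keys f \<union> Poly_Mapping.keys g"
  have "eval_poly Q h = (\<Sum>m\<in>?X. Poly_Mapping.single 0 (Poly_Mapping.lookup h m) * eval_mon Q m)"
    if "h \<in> {f, g, f + g}" for h
    using that keys_add[of f g] by (intro eval_poly_superset) auto
  then show ?thesis
    by (simp add: lookup_add single_add distrib_right sum.distrib)
qed

lemma eval_poly_sum: "eval_poly Q (\<Sum>a\<in>A. f a) = (\<Sum>a\<in>A. eval_poly Q (f a))"
  by (induction A rule: infinite_finite_induct) (auto simp: eval_poly_add)

lemma poly_mapping_sum_single:
  "f = (\<Sum>m\<in>Poly_Mapping.keys f. Poly_Mapping.single m (Poly_Mapping.lookup f m))"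
  by (rule poly_mapping_eqI) (auto simp: lookup_sum lookup_single when_def in_keys_iff)

lemma eval_poly_mult: "eval_poly Q (f * g) = eval_poly Q f * eval_poly Q g"
proof -
  have "f * g = (\<Sum>m\<in>Poly_Mapping.keys f. \<Sum>m'\<in>Poly_Mapping.keys g.
      Poly_Mapping.single (m + m') (Poly_Mapping.lookup f m * Poly_Mapping.lookup g m'))"
    by (subst (1) poly_mapping_sum_single[of f], subst (1) poly_mapping_sum_single[of g])
      (simp add: sum_product mult_single)
  then have "eval_poly Q (f * g) = (\<Sum>m\<in>Poly_Mapping.keys f. \<Sum>m'\<in>Poly_Mapping.keys g.
      (Poly_Mapping.single 0 (Poly_Mapping.lookup f m) * eval_mon Q m) *
      (Poly_Mapping.single 0 (Poly_Mapping.lookup g m') * eval_mon Q m'))"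
    by (simp add: eval_poly_sum eval_poly_single eval_mon_add mult_ac
        flip: mult_single[of 0 _ 0, simplified])
  then show ?thesis by (simp add: eval_poly_def sum_product)
qed

lemma eval_poly_pvar [simp]: "eval_poly Q (pvar p) = Q p"
  by (simp add: pvar_def monomial_def eval_poly_single)

text \<open>Distinct exponents may be incomparable. So the locale covers the comparison of values of a linear form,
  where exponents may tie, and a comparison that ignores some of the variables.\<close>

locale exponent_order =
  fixes less :: "('x \<Rightarrow>\<^sub>0 nat) \<Rightarrow> ('x \<Rightarrow>\<^sub>0 nat) \<Rightarrow> bool" (infix \<open>\<lhd>\<close> 50)
  assumes less_irrefl: "\<not> u \<lhd> u"
    and less_trans: "u \<lhd> v \<Longrightarrow> v \<lhd> w \<Longrightarrow> u \<lhd> w"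
    and less_add: "u \<lhd> v \<Longrightarrow> u + z \<lhd> v + z"
begin

definition leads :: "('x \<Rightarrow>\<^sub>0 nat) \<Rightarrow> 'x cpoly \<Rightarrow> bool" where
  "leads v F \<longleftrightarrow> (\<forall>u\<in>Poly_Mapping.keys F. u = v \<or> v \<lhd> u)"

lemma less_add_mono: "a = a' \<or> a \<lhd> a' \<Longrightarrow> b \<lhd> b' \<Longrightarrow> a + b \<lhd> a' + b'"
  using less_add[of b b' a] less_add[of a a' b'] less_trans by (auto simp: add.commute)

lemma leads_mult:
  assumes "leads a A" "leads b B"
  shows "leads (a + b) (A * B)"
    and "Poly_Mapping.lookup (A * B) (a + b) = Poly_Mapping.lookup A a * Poly_Mapping.lookup B b"
proof -
  define A' where "A' = A - Poly_Mapping.single a (Poly_Mapping.lookup A a)"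
  define B' where "B' = B - Poly_Mapping.single b (Poly_Mapping.lookup B b)"
  have A': "a \<lhd> u" if "u \<in> Poly_Mapping.keys A'" for u
    using that assms(1)
    by (auto simp: A'_def leads_def in_keys_iff lookup_minus lookup_single when_def split: if_splits)
  have B': "b \<lhd> u" if "u \<in> Poly_Mapping.keys B'" for u
    using that assms(2)
    by (auto simp: B'_def leads_def in_keys_iff lookup_minus lookup_single when_def split: if_splits)
  let ?s = "Poly_Mapping.single (a + b) (Poly_Mapping.lookup A a * Poly_Mapping.lookup B b)"
  have eq: "A * B = ?s + (Poly_Mapping.single a (Poly_Mapping.lookup A a) * B' + A' * B)"
    by (simp add: A'_def B'_def algebra_simps mult_single)
  have gt: "a + b \<lhd> u"
    if "u \<in> Poly_Mapping.keys (Poly_Mapping.single a (Poly_Mapping.lookup A a) * B' + A' * B)" for u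
  proof -
    have "u \<in> Poly_Mapping.keys (Poly_Mapping.single a (Poly_Mapping.lookup A a) * B') \<or>
        u \<in> Poly_Mapping.keys (A' * B)"
      using subsetD[OF keys_add that] by blast
    then consider v where "v \<in> Poly_Mapping.keys B'" "u = a + v"
      | v w where "v \<in> Poly_Mapping.keys A'" "w \<in> Poly_Mapping.keys B" "u = v + w"
      by (auto dest!: subsetD[OF keys_mult] split: if_splits)
    then show ?thesis
    proof cases
      case 1
      then show ?thesis using B' less_add_mono[of a a b v] by auto
    next
      case 2
      then have "a \<lhd> v" "b = w \<or> b \<lhd> w" using A' assms(2) by (auto simp: leads_def)
      then show ?thesis using less_add_mono[of b w a v] 2 by (auto simp: add.commute)
    qed
  qed
  have "u = a + b \<or> a + b \<lhd> u" if "u \<in> Poly_Mapping.keys (A * B)" for u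
    using subsetD[OF keys_add that[unfolded eq]] gt by (auto split: if_splits)
  then show "leads (a + b) (A * B)" by (simp add: leads_def)
  have "a + b \<notin> Poly_Mapping.keys (Poly_Mapping.single a (Poly_Mapping.lookup A a) * B' + A' * B)"
    using gt less_irrefl by blast
  then show "Poly_Mapping.lookup (A * B) (a + b) = Poly_Mapping.lookup A a * Poly_Mapping.lookup B b"
    unfolding eq by (subst lookup_add) (simp add: in_keys_iff)
qed

lemma leads_prod_mset:
  assumes "\<And>p. p \<in># A \<Longrightarrow> leads (v p) (Q p)"
  shows "leads (\<Sum>p\<in>#A. v p) (\<Prod>p\<in>#A. Q p) \<and>
    Poly_Mapping.lookup (\<Prod>p\<in>#A. Q p) (\<Sum>p\<in>#A. v p) = (\<Prod>p\<in>#A. Poly_Mapping.lookup (Q p) (v p))"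
  using assms
proof (induction A)
  case empty
  then show ?case by (simp add: leads_def)
next
  case (add p A)
  then show ?case by (auto simp: leads_mult)
qed

end

definition wt :: "('v \<Rightarrow> 'a::comm_monoid_add) \<Rightarrow> ('v \<Rightarrow>\<^sub>0 nat) \<Rightarrow> 'a" where
  "wt v m = (\<Sum>p\<in>#mset_of m. v p)"

lemma wt_zero [simp]: "wt v 0 = 0"
  by (simp add: wt_def)

lemma wt_add: "wt v (m + m') = wt v m + wt v m'"
  by (simp add: wt_def)

lemma wt_mexp [simp]: "wt v (mexp A) = (\<Sum>p\<in>#A. v p)"
  by (simp add: wt_def)

definition monomial_map :: "('v \<Rightarrow> 'x \<Rightarrow>\<^sub>0 nat) \<Rightarrow> ('v \<Rightarrow> complex) \<Rightarrow> 'v \<Rightarrow> 'x cpoly" where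
  "monomial_map v c p = Poly_Mapping.single (v p) (c p)"

lemma eval_mon_monomial_map:
  "eval_mon (monomial_map v c) m = Poly_Mapping.single (wt v m) (eval_mon c m)"
proof -
  have "(\<Prod>p\<in>#A. monomial_map v c p) = Poly_Mapping.single (\<Sum>p\<in>#A. v p) (\<Prod>p\<in>#A. c p)" for A
    by (induction A) (auto simp: monomial_map_def mult_single)
  then show ?thesis by (simp add: eval_mon_def wt_def)
qed

lemma lookup_eval_monomial_map:
  "Poly_Mapping.lookup (eval_poly (monomial_map v c) f) u =
    (\<Sum>m\<in>{m \<in> Poly_Mapping.keys f. wt v m = u}. Poly_Mapping.lookup f m * eval_mon c m)"
  by (simp add: eval_poly_def eval_mon_monomial_map mult_single lookup_sum lookup_single when_def
      sum.inter_filter)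

definition initial_part :: "(('v \<Rightarrow>\<^sub>0 nat) \<Rightarrow> ('v \<Rightarrow>\<^sub>0 nat) \<Rightarrow> bool) \<Rightarrow> 'v cpoly \<Rightarrow> 'v cpoly" where
  "initial_part lt f = (\<Sum>m\<in>{m \<in> Poly_Mapping.keys f. \<forall>m'\<in>Poly_Mapping.keys f. \<not> lt m' m}.
     Poly_Mapping.single m (Poly_Mapping.lookup f m))"

lemma lookup_initial_part:
  "Poly_Mapping.lookup (initial_part lt f) m =
    (if \<forall>m'\<in>Poly_Mapping.keys f. \<not> lt m' m then Poly_Mapping.lookup f m else 0)"
proof -
  have "Poly_Mapping.lookup (initial_part lt f) m =
      (\<Sum>m'\<in>{m \<in> Poly_Mapping.keys f. \<forall>m'\<in>Poly_Mapping.keys f. \<not> lt m' m}.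
        if m' = m then Poly_Mapping.lookup f m' else 0)"
    by (simp add: initial_part_def lookup_sum lookup_single when_def)
  also have "\<dots> = (if \<forall>m'\<in>Poly_Mapping.keys f. \<not> lt m' m then Poly_Mapping.lookup f m else 0)"
    by (subst sum.delta) (auto simp: in_keys_iff)
  finally show ?thesis .
qed

lemma keys_initial_part:
  "Poly_Mapping.keys (initial_part lt f) =
    {m \<in> Poly_Mapping.keys f. \<forall>m'\<in>Poly_Mapping.keys f. \<not> lt m' m}"
  by (auto simp: in_keys_iff lookup_initial_part split: if_splits)

context exponent_order
begin

text \<open>A non-leading term of a product of the \<open>Q p\<close> lies strictly above the leading exponent of
  the product. At an exponent \<open>u\<close> that lies above no leading exponent of \<open>f\<close>, only
  leading terms contribute.\<close>

lemma lookup_eval_nondominated: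
  assumes lead: "\<And>m p. m \<in> Poly_Mapping.keys f \<Longrightarrow> p \<in> Poly_Mapping.keys m \<Longrightarrow> leads (v p) (Q p)"
    and nondom: "\<And>m. m \<in> Poly_Mapping.keys f \<Longrightarrow> \<not> wt v m \<lhd> u"
  shows "Poly_Mapping.lookup (eval_poly Q f) u =
    (\<Sum>m\<in>{m \<in> Poly_Mapping.keys f. wt v m = u}.
      Poly_Mapping.lookup f m * eval_mon (\<lambda>p. Poly_Mapping.lookup (Q p) (v p)) m)"
proof -
  have coeff: "Poly_Mapping.lookup (Poly_Mapping.single 0 (Poly_Mapping.lookup f m) * eval_mon Q m) u =
      (if wt v m = u then Poly_Mapping.lookup f m *
        eval_mon (\<lambda>p. Poly_Mapping.lookup (Q p) (v p)) m else 0)"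
    if m: "m \<in> Poly_Mapping.keys f" for m
  proof -
    have *: "leads (wt v m) (eval_mon Q m) \<and> Poly_Mapping.lookup (eval_mon Q m) (wt v m) =
        eval_mon (\<lambda>p. Poly_Mapping.lookup (Q p) (v p)) m"
      unfolding eval_mon_def wt_def by (rule leads_prod_mset) (use lead[OF m] in simp)
    have "leads 0 (Poly_Mapping.single 0 (Poly_Mapping.lookup f m))"
      by (simp add: leads_def)
    from leads_mult[OF this conjunct1[OF *]] * nondom[OF m] show ?thesis
      unfolding leads_def
      by (auto simp: not_in_keys_iff_lookup_eq_zero[symmetric] simp del: not_in_keys_iff_lookup_eq_zero)
  qed
  show ?thesis
    unfolding eval_poly_def lookup_sum sum.inter_filter[OF finite_keys]
    by (rule sum.cong[OF refl coeff])
qed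

text \<open>The initial part keeps or drops each fibre of the monomial map as a whole. On a fibre that is kept, the
  sum of the coefficients is a coefficient of \<open>eval_poly Q f\<close>.\<close>

lemma initial_part_in_kernel:
  assumes lead: "\<And>m p. m \<in> Poly_Mapping.keys f \<Longrightarrow> p \<in> Poly_Mapping.keys m \<Longrightarrow> leads (v p) (Q p)"
    and zero: "eval_poly Q f = 0"
  shows "eval_poly (monomial_map v (\<lambda>p. Poly_Mapping.lookup (Q p) (v p)))
    (initial_part (\<lambda>m m'. wt v m \<lhd> wt v m') f) = 0"
proof (rule poly_mapping_eqI)
  fix u
  let ?c = "\<lambda>p. Poly_Mapping.lookup (Q p) (v p)"
  let ?N = "{m \<in> Poly_Mapping.keys f. \<forall>m'\<in>Poly_Mapping.keys f. \<not> wt v m' \<lhd> wt v m}"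
  have eq: "Poly_Mapping.lookup (eval_poly (monomial_map v ?c)
      (initial_part (\<lambda>m m'. wt v m \<lhd> wt v m') f)) u =
    (\<Sum>m\<in>{m \<in> ?N. wt v m = u}. Poly_Mapping.lookup f m * eval_mon ?c m)"
    unfolding lookup_eval_monomial_map keys_initial_part
    by (rule sum.cong) (auto simp: lookup_initial_part)
  show "Poly_Mapping.lookup (eval_poly (monomial_map v ?c)
      (initial_part (\<lambda>m m'. wt v m \<lhd> wt v m') f)) u = Poly_Mapping.lookup 0 u"
  proof (cases "\<exists>m\<in>?N. wt v m = u")
    case False
    then have "{m \<in> ?N. wt v m = u} = {}" by blast
    then show ?thesis unfolding eq by (simp only: sum.empty lookup_zero)
  next
    case True
    then have nondom: "\<And>m. m \<in> Poly_Mapping.keys f \<Longrightarrow> \<not> wt v m \<lhd> u" by auto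
    then have "{m \<in> ?N. wt v m = u} = {m \<in> Poly_Mapping.keys f. wt v m = u}" by auto
    then show ?thesis
      unfolding eq using lookup_eval_nondominated[of f v Q u, OF lead nondom] zero by simp
  qed
qed

end

section \<open>Ideals in the polynomial ring\<close>

lemma poly_ring_simps [simp]:
  "monoid.mult (poly_ring V) = (*)" "one (poly_ring V) = 1" "zero (poly_ring V) = 0" "add (poly_ring V) = (+)"
  by (simp_all add: poly_ring_def)

lemma carrier_poly_ring:
  "f \<in> carrier (poly_ring V) \<longleftrightarrow> (\<forall>m\<in>Poly_Mapping.keys f. Poly_Mapping.keys m \<subseteq> V)"
  by (simp add: poly_ring_def)

lemma single_in_poly_ring:
  "Poly_Mapping.keys m \<subseteq> V \<Longrightarrow> Poly_Mapping.single m c \<in> carrier (poly_ring V)"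
  by (simp add: carrier_poly_ring)

lemma keys_mexp [simp]: "Poly_Mapping.keys (mexp A) = set_mset A"
  using set_mset_of[of "mexp A"] by simp

lemma ring_poly_ring: "ring (poly_ring V)"
  using cring_poly_ring[of V] by (rule cring.axioms)

lemma ideal_poly_ringI:
  assumes sub: "K \<subseteq> carrier (poly_ring V)" and zero: "0 \<in> K"
    and add: "\<And>f g. f \<in> K \<Longrightarrow> g \<in> K \<Longrightarrow> f + g \<in> K"
    and mult: "\<And>f g. f \<in> K \<Longrightarrow> g \<in> carrier (poly_ring V) \<Longrightarrow> g * f \<in> K"
  shows "ideal K (poly_ring V)"
proof -
  interpret R: cring "poly_ring V" by (rule cring_poly_ring)
  have uminus: "- f \<in> K" if "f \<in> K" for f
    using mult[OF that, of "- 1"] by (simp add: carrier_poly_ring)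
  have inv: "inv\<^bsub>add_monoid (poly_ring V)\<^esub> f = - f" if "f \<in> K" for f
  proof -
    have "\<ominus>\<^bsub>poly_ring V\<^esub> f = - f"
      using sub that uminus[OF that] by (intro R.minus_equality) auto
    then show ?thesis by (simp add: a_inv_def)
  qed
  have "subgroup K (add_monoid (poly_ring V))"
    by unfold_locales (use sub zero add uminus inv in auto)
  then show ?thesis
    by (intro idealI ring_poly_ring) (use mult in \<open>auto simp: mult.commute\<close>)
qed

lemma ideal_poly_ringD:
  assumes "ideal K (poly_ring V)"
  shows "K \<subseteq> carrier (poly_ring V)" "0 \<in> K" "f \<in> K \<Longrightarrow> g \<in> K \<Longrightarrow> f + g \<in> K"
    "f \<in> K \<Longrightarrow> g \<in> carrier (poly_ring V) \<Longrightarrow> g * f \<in> K"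
proof -
  interpret ideal K "poly_ring V" by fact
  show "K \<subseteq> carrier (poly_ring V)" by (rule a_subset)
  show "0 \<in> K" using additive_subgroup.zero_closed[OF is_additive_subgroup] by simp
  show "f + g \<in> K" if "f \<in> K" "g \<in> K" using additive_subgroup.a_closed[OF is_additive_subgroup that] by simp
  show "g * f \<in> K" if "f \<in> K" "g \<in> carrier (poly_ring V)" using I_l_closed[OF that] by simp
qed

lemma ideal_poly_ring_sum:
  assumes "ideal K (poly_ring V)" "\<And>a. a \<in> A \<Longrightarrow> f a \<in> K"
  shows "(\<Sum>a\<in>A. f a) \<in> K"
  using assms(2)
  by (induction A rule: infinite_finite_induct) (auto intro: ideal_poly_ringD[OF assms(1)])

lemma ideal_kernel_eval_poly: "ideal {f \<in> carrier (poly_ring V). eval_poly Q f = 0} (poly_ring V)"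
  by (rule ideal_poly_ringI)
    (auto simp: eval_poly_add eval_poly_mult poly_ring_add_closed poly_ring_mult_closed carrier_poly_ring[of 0])

lemma initial_part_closed:
  "f \<in> carrier (poly_ring V) \<Longrightarrow> initial_part lt f \<in> carrier (poly_ring V)"
  by (auto simp: carrier_poly_ring keys_initial_part)

text \<open>Modulo an ideal, a polynomial in the kernel of a monomial map vanishes as soon as the suitably
  normalised monomials of each fibre agree.\<close>

lemma kernel_monomial_map_subset_ideal:
  assumes K: "ideal K (poly_ring V)"
    and c: "\<And>p. p \<in> V \<Longrightarrow> c p \<noteq> 0"
    and fibre: "\<And>m m'. Poly_Mapping.keys m \<subseteq> V \<Longrightarrow> Poly_Mapping.keys m' \<subseteq> V \<Longrightarrow> wt v m = wt v m' \<Longrightarrow>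
      Poly_Mapping.single m (1 / eval_mon c m) - Poly_Mapping.single m' (1 / eval_mon c m') \<in> K"
    and f: "f \<in> carrier (poly_ring V)" "eval_poly (monomial_map v c) f = 0"
  shows "f \<in> K"
proof -
  let ?b = "\<lambda>m. Poly_Mapping.single m (1 / eval_mon c m)"
  define rep where "rep u = (SOME m. m \<in> Poly_Mapping.keys f \<and> wt v m = u)" for u
  have rep: "rep (wt v m) \<in> Poly_Mapping.keys f \<and> wt v (rep (wt v m)) = wt v m"
    if "m \<in> Poly_Mapping.keys f" for m
    unfolding rep_def by (rule someI[of _ m]) (use that in auto)
  have c0: "eval_mon c m \<noteq> 0" if "m \<in> Poly_Mapping.keys f" for m
    using that f(1) c by (force simp: eval_mon_def carrier_poly_ring)
  let ?a = "\<lambda>m. Poly_Mapping.lookup f m * eval_mon c m"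
  have "f = (\<Sum>m\<in>Poly_Mapping.keys f. Poly_Mapping.single 0 (?a m) * ?b m)"
    by (subst poly_mapping_sum_single) (auto intro!: sum.cong simp: mult_single c0)
  also have "\<dots> = (\<Sum>m\<in>Poly_Mapping.keys f. Poly_Mapping.single 0 (?a m) * (?b m - ?b (rep (wt v m)))) +
      (\<Sum>m\<in>Poly_Mapping.keys f. Poly_Mapping.single 0 (?a m) * ?b (rep (wt v m)))"
    by (simp add: sum.distrib[symmetric] algebra_simps)
  also have "(\<Sum>m\<in>Poly_Mapping.keys f. Poly_Mapping.single 0 (?a m) * ?b (rep (wt v m))) =
      (\<Sum>u\<in>wt v ` Poly_Mapping.keys f. \<Sum>m\<in>{m \<in> Poly_Mapping.keys f. wt v m = u}.
        Poly_Mapping.single 0 (?a m) * ?b (rep (wt v m)))"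
    by (rule sum.group[symmetric]) auto
  also have "\<dots> = (\<Sum>u\<in>wt v ` Poly_Mapping.keys f.
      Poly_Mapping.single 0 (\<Sum>m\<in>{m \<in> Poly_Mapping.keys f. wt v m = u}. ?a m) * ?b (rep u))"
  proof -
    have single_sum: "Poly_Mapping.single 0 (\<Sum>m\<in>A. g m) = (\<Sum>m\<in>A. Poly_Mapping.single 0 (g m))"
      for g :: "_ \<Rightarrow> complex" and A
      by (induction A rule: infinite_finite_induct) (auto simp: single_add)
    show ?thesis by (auto intro!: sum.cong simp: single_sum sum_distrib_right)
  qed
  also have "\<dots> = 0"
    using f(2) lookup_eval_monomial_map[of v c f] by (auto intro!: sum.neutral)
  finally have "f = (\<Sum>m\<in>Poly_Mapping.keys f. Poly_Mapping.single 0 (?a m) * (?b m - ?b (rep (wt v m))))"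
    by simp
  moreover have "Poly_Mapping.single 0 (?a m) * (?b m - ?b (rep (wt v m))) \<in> K"
    if m: "m \<in> Poly_Mapping.keys f" for m
  proof -
    have "Poly_Mapping.keys m \<subseteq> V" "Poly_Mapping.keys (rep (wt v m)) \<subseteq> V"
      using m rep[OF m] f(1) unfolding carrier_poly_ring by blast+
    moreover have "wt v m = wt v (rep (wt v m))" using rep[OF m] by simp
    ultimately have "?b m - ?b (rep (wt v m)) \<in> K" by (rule fibre)
    then show ?thesis
      by (rule ideal_poly_ringD(4)[OF K]) (simp add: single_in_poly_ring)
  qed
  then have "(\<Sum>m\<in>Poly_Mapping.keys f. Poly_Mapping.single 0 (?a m) * (?b m - ?b (rep (wt v m)))) \<in> K"
    by (rule ideal_poly_ring_sum[OF K])
  ultimately show ?thesis by simp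
qed

section \<open>The Pluecker coordinates of an iterated sequence\<close>

definition edge :: "nat \<Rightarrow> nat \<Rightarrow> nat \<times> nat" where
  "edge x y = (min x y, max x y)"

lemma edge_commute: "edge x y = edge y x"
  by (simp add: edge_def min.commute max.commute)

lemma edge_less [simp]: "x < y \<Longrightarrow> edge x y = (x, y)"
  by (simp add: edge_def)

lemma edge_greater [simp]: "y < x \<Longrightarrow> edge x y = (y, x)"
  by (simp add: edge_def)

lemma edge_eq_iff: "edge x y = edge z w \<longleftrightarrow> x = z \<and> y = w \<or> x = w \<and> y = z"
  by (auto simp: edge_def min_def max_def split: if_splits)

lemma edge_in_plucker_idx: "edge x y \<in> plucker_idx L \<longleftrightarrow> x \<noteq> y \<and> x \<in> {1..L} \<and> y \<in> {1..L}"
  by (auto simp: edge_def plucker_idx_def min_def max_def)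

lemma finite_plucker_idx [simp]: "finite (plucker_idx n)"
  by (rule finite_subset[of _ "{1..n} \<times> {1..n}"]) (auto simp: plucker_idx_def)

text \<open>The operator \<open>f\<^sub>\<beta>\<close> squares to zero, because its image is spanned by
  \<open>e\<^sub>k\<close> with \<open>k \<noteq> i\<close>.\<close>

lemma exp_root_eq:
  assumes "fst \<beta> \<noteq> snd \<beta>"
  shows "exp_root \<beta> t v l = v l + (if l = snd \<beta> then t * v (fst \<beta>) else 0)"
proof -
  have sq: "f_root \<beta> (f_root \<beta> u) = (\<lambda>l. 0)" for u
    using assms by (auto simp: f_root_def fun_eq_iff)
  have zero: "f_root \<beta> (\<lambda>l. 0) = (\<lambda>l. 0)"
    by (auto simp: f_root_def fun_eq_iff)
  have pow: "(f_root \<beta> ^^ r) v = (\<lambda>l. 0)" if "r \<ge> 2" for r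
    using that by (induction r rule: dec_induct) (auto simp: numeral_2_eq_2 sq zero)
  have "{r. Poly_Mapping.single 0 (1 / fact r) * t ^ r * (f_root \<beta> ^^ r) v l \<noteq> 0} \<subseteq> {0, 1}"
  proof
    fix r
    assume "r \<in> {r. Poly_Mapping.single 0 (1 / fact r) * t ^ r * (f_root \<beta> ^^ r) v l \<noteq> 0}"
    then have "\<not> r \<ge> 2" using pow[of r] by auto
    then show "r \<in> {0, 1}" by auto
  qed
  then have "exp_root \<beta> t v l =
      (\<Sum>r\<in>{0, 1}. Poly_Mapping.single 0 (1 / fact r) * t ^ r * (f_root \<beta> ^^ r) v l)"
    unfolding exp_root_def by (intro Sum_any.expand_superset) auto
  then show ?thesis by (simp add: f_root_def)
qed

locale iterated =
  fixes n :: nat and ii jj :: "nat \<Rightarrow> nat"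
  assumes n_ge: "3 \<le> n"
    and roots: "\<And>k. 3 \<le> k \<Longrightarrow> k \<le> n \<Longrightarrow>
      1 \<le> ii k \<and> ii k < k \<and> 1 \<le> jj k \<and> jj k < k \<and> ii k \<noteq> jj k"
begin

definition S :: root_seq where
  "S = concat (map (\<lambda>k. [(ii k, k), (jj k, k)]) (rev [3..<Suc n]))"

text \<open>The variables \<open>a k\<close> and \<open>b k\<close> belong to the two roots of level
  \<open>k\<close>, at their positions in \<open>S\<close>. A smaller number means an earlier place in the
  lexicographic order, so higher levels come first. The variables \<open>s k\<close> do not occur in the
  exponentials.\<close>

definition a :: "nat \<Rightarrow> nat" where "a k = 2 * (n - k) + 1"
definition b :: "nat \<Rightarrow> nat" where "b k = 2 * (n - k) + 2"
definition s :: "nat \<Rightarrow> nat" where "s k = 2 * n + k"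

lemma S_aux:
  "length (concat (map (\<lambda>k. [(ii k, k), (jj k, k)]) (rev [m..<Suc n]))) = 2 * (Suc n - m)"
  "m \<le> k \<Longrightarrow> k \<le> n \<Longrightarrow>
    concat (map (\<lambda>k. [(ii k, k), (jj k, k)]) (rev [m..<Suc n])) ! (2 * (n - k)) = (ii k, k) \<and>
    concat (map (\<lambda>k. [(ii k, k), (jj k, k)]) (rev [m..<Suc n])) ! (2 * (n - k) + 1) = (jj k, k)"
proof -
  let ?C = "\<lambda>m. concat (map (\<lambda>k. [(ii k, k), (jj k, k)]) (rev [m..<Suc n]))"
  have "length (concat (map (\<lambda>k. [(ii k, k), (jj k, k)]) xs)) = 2 * length xs" for xs
    by (induction xs) auto
  then have len: "length (?C m) = 2 * (Suc n - m)" for m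
    by (simp del: upt_Suc)
  then show "length (?C m) = 2 * (Suc n - m)" .
  show "?C m ! (2 * (n - k)) = (ii k, k) \<and> ?C m ! (2 * (n - k) + 1) = (jj k, k)"
    if "m \<le> k" "k \<le> n"
    using that(1)
  proof (induction m rule: inc_induct)
    case base
    have "?C k = ?C (Suc k) @ [(ii k, k), (jj k, k)]"
      using that(2) by (simp add: upt_conv_Cons del: upt_Suc)
    then show ?case using len[of "Suc k"] by (simp add: nth_append del: upt_Suc)
  next
    case (step m)
    have "?C m = ?C (Suc m) @ [(ii m, m), (jj m, m)]"
      using that(2) step(2) by (simp add: upt_conv_Cons del: upt_Suc)
    moreover have "2 * (n - k) + 1 < length (?C (Suc m))"
      using len[of "Suc m"] step(2) that(2) by simp
    ultimately show ?case using step(3) by (simp add: nth_append del: upt_Suc)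
  qed
qed

lemma length_S: "length S = 2 * (n - 2)"
  unfolding S_def S_aux(1) by simp

lemma nth_S:
  assumes "3 \<le> k" "k \<le> n"
  shows "S ! (a k - 1) = (ii k, k)" "S ! (b k - 1) = (jj k, k)"
  using S_aux(2)[of 3 k] assms by (simp_all add: S_def a_def b_def)

subsection \<open>Columns\<close>

text \<open>The factors of level \<open>k\<close> change coordinate \<open>k\<close> only, reading coordinates
  below \<open>k\<close>. The levels act in increasing order, so those coordinates are already final.\<close>

lemma exp_product_eq:
  assumes "1 \<le> l" "l \<le> n"
  shows "exp_product S v l = (if l \<le> 2 then v l else
    v l + pvar (a l) * exp_product S v (ii l) + pvar (b l) * exp_product S v (jj l))"
proof -
  define E where "E r = exp_root (S ! (r - 1)) (pvar r)" for r
  define u where "u k = foldr E [2 * (n - k) + 1..<Suc (length S)] v" for k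
  have u2: "u 2 = v" by (simp add: u_def length_S)
  have step: "u k = E (a k) (E (b k) (u (k - 1)))" if "3 \<le> k" "k \<le> n" for k
  proof -
    have "[2 * (n - k) + 1..<Suc (length S)] =
        a k # b k # [2 * (n - (k - 1)) + 1..<Suc (length S)]"
    proof -
      have "2 * (n - (k - 1)) = 2 * (n - k) + 2" "2 * (n - k) + 2 \<le> 2 * (n - 2)"
        using that by auto
      then show ?thesis
        by (simp add: upt_conv_Cons length_S a_def b_def del: upt_Suc)
    qed
    then show ?thesis by (simp add: u_def)
  qed
  have coord: "u k m = u (k - 1) m + (if m = k
      then pvar (a k) * u (k - 1) (ii k) + pvar (b k) * u (k - 1) (jj k) else 0)"
    if "3 \<le> k" "k \<le> n" for k m
    using roots[OF that] step[OF that] nth_S[OF that] by (simp add: E_def exp_root_eq)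
  have const: "u k m = u k' m" if "2 \<le> k'" "k' \<le> k" "k \<le> n" "m \<le> k'" for k k' m
    using that(2,3)
  proof (induction k rule: dec_induct)
    case (step k)
    then show ?case using coord[of "Suc k" m] that(1,4) by simp
  qed simp
  have above: "u k m = v m" if "2 \<le> k" "k \<le> n" "k < m" for k m
    using that
  proof (induction k rule: dec_induct)
    case base
    show ?case by (simp add: u2)
  next
    case (step k)
    then show ?case using coord[of "Suc k" m] by simp
  qed
  have un: "exp_product S v = u n"
    by (simp add: exp_product_def u_def E_def[abs_def])
  show ?thesis
  proof (cases "l \<le> 2")
    case True
    then show ?thesis using const[of 2 n l] n_ge by (simp add: un u2)
  next
    case False
    then have l: "3 \<le> l" "l \<le> n" using assms by auto
    have "u n l = u l l" using const[of l n l] l by simp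
    also have "\<dots> = v l + pvar (a l) * u (l - 1) (ii l) + pvar (b l) * u (l - 1) (jj l)"
      using coord[OF l, of l] above[of "l - 1" l] l by (simp add: add.assoc)
    also have "u (l - 1) (ii l) = u n (ii l)"
      using const[of "l - 1" n "ii l"] roots[OF l] l by auto
    also have "u (l - 1) (jj l) = u n (jj l)"
      using const[of "l - 1" n "jj l"] roots[OF l] l by auto
    finally show ?thesis using False by (simp add: un)
  qed
qed

definition P :: "nat \<Rightarrow> nat \<Rightarrow> nat cpoly" where
  "P x y = P_poly S (x, y)"

lemma P_eq: "P x y = exp_product S (unit_vec 1) x * exp_product S (unit_vec 2) y -
    exp_product S (unit_vec 1) y * exp_product S (unit_vec 2) x"
  by (simp add: P_def P_poly_def wedge_def mult.commute)

lemma P_swap: "P y x = - P x y"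
  by (simp add: P_eq)

lemma P_self [simp]: "P x x = 0"
  by (simp add: P_eq)

lemma P_1_2: "P 1 2 = 1"
  using exp_product_eq[of 1] exp_product_eq[of 2] n_ge by (simp add: P_eq unit_vec_def)

lemma P_rec:
  assumes "3 \<le> l" "l \<le> n"
  shows "P k l = pvar (a l) * P k (ii l) + pvar (b l) * P k (jj l)"
  using assms by (simp add: P_eq exp_product_eq[of l] unit_vec_def algebra_simps)

subsection \<open>Leading exponents\<close>

text \<open>The exponent of the term of \<open>P x y\<close> that is reached by taking the \<open>a\<close>-term in
  \<open>P_rec\<close> unless its minor is zero, which happens for \<open>x = ii y\<close> only.\<close>

function V :: "nat \<Rightarrow> nat \<Rightarrow> nat \<Rightarrow>\<^sub>0 nat" where
  "V x y = (if y < x then V y x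
    else if x < y \<and> 3 \<le> y \<and> y \<le> n then
      if x = ii y then Poly_Mapping.single (b y) 1 + V (ii y) (jj y)
      else Poly_Mapping.single (a y) 1 + V x (ii y)
    else 0)"
  by auto
termination
proof (relation "measures [\<lambda>(x, y). x + y, \<lambda>(x, y). if y < x then 1 else 0]")
qed (use roots in auto)

declare V.simps [simp del]

lemma V_commute: "V x y = V y x"
  using V.simps[of x y] V.simps[of y x] by (cases x y rule: linorder_cases) auto

lemma V_a: "3 \<le> l \<Longrightarrow> l \<le> n \<Longrightarrow> k < l \<Longrightarrow> k \<noteq> ii l \<Longrightarrow>
    V k l = Poly_Mapping.single (a l) 1 + V k (ii l)"
  by (subst V.simps) simp

lemma V_b: "3 \<le> l \<Longrightarrow> l \<le> n \<Longrightarrow> V (ii l) l = Poly_Mapping.single (b l) 1 + V (ii l) (jj l)"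
  using roots[of l] by (subst V.simps) simp

lemma V_base: "x \<le> 2 \<Longrightarrow> y \<le> 2 \<Longrightarrow> V x y = 0"
  by (subst V.simps, subst V.simps) simp

lemma V_induct [consumes 3, case_names swap base both left]:
  assumes xy: "x \<noteq> y" "x \<in> {1..n}" "y \<in> {1..n}"
    and swap: "\<And>x y. x \<noteq> y \<Longrightarrow> R y x \<Longrightarrow> R x y"
    and base: "R 1 2"
    and both: "\<And>l. 3 \<le> l \<Longrightarrow> l \<le> n \<Longrightarrow> R (ii l) (jj l) \<Longrightarrow> R (ii l) l"
    and left: "\<And>k l. 3 \<le> l \<Longrightarrow> l \<le> n \<Longrightarrow> 1 \<le> k \<Longrightarrow> k < l \<Longrightarrow> k \<noteq> ii l \<Longrightarrow> R k (ii l) \<Longrightarrow>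
      (k \<noteq> jj l \<Longrightarrow> R k (jj l)) \<Longrightarrow> R k l"
  shows "R x y"
  using xy
proof (induction "x + y" arbitrary: x y rule: less_induct)
  case less
  have main: "R x y" if "x < y" "x \<in> {1..n}" "y \<in> {1..n}"
    "\<And>x' y'. x' + y' < x + y \<Longrightarrow> x' \<noteq> y' \<Longrightarrow> x' \<in> {1..n} \<Longrightarrow> y' \<in> {1..n} \<Longrightarrow> R x' y'" for x y
  proof (cases "y \<le> 2")
    case True
    then have "x = 1" "y = 2" using that by auto
    then show ?thesis using base by simp
  next
    case False
    then have y: "3 \<le> y" "y \<le> n" using that by auto
    show ?thesis
    proof (cases "x = ii y")
      case True
      then show ?thesis using both[OF y] that(4)[of "ii y" "jj y"] roots[OF y] y by auto
    next
      case False
      then show ?thesis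
        using left[OF y, of x] that(4)[of x "ii y"] that(4)[of x "jj y"] that(1,2) roots[OF y] y
        by auto
    qed
  qed
  show ?case
  proof (cases "x < y")
    case True
    then show ?thesis using main[of x y] less by auto
  next
    case False
    then have "R y x" using main[of y x] less by (auto simp: add.commute)
    then show ?thesis using swap less(2) by blast
  qed
qed

text \<open>A variable of level \<open>m\<close> occurs only if one of the two leaves is at least \<open>m\<close>;
  the numbers of the variables decrease with the level.\<close>

lemma keys_V:
  assumes "x \<noteq> y" "x \<in> {1..n}" "y \<in> {1..n}" "r \<in> Poly_Mapping.keys (V x y)" "x \<le> l" "y \<le> l"
  shows "2 * (n - l) + 1 \<le> r \<and> r \<le> 2 * n"
proof -
  have "\<forall>r l. r \<in> Poly_Mapping.keys (V x y) \<longrightarrow> x \<le> l \<longrightarrow> y \<le> l \<longrightarrow> 2 * (n - l) + 1 \<le> r \<and> r \<le> 2 * n"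
    using assms(1-3)
  proof (induction x y rule: V_induct)
    case (swap x y)
    then show ?case by (simp add: V_commute)
  next
    case base
    then show ?case by (simp add: V_base)
  next
    case (both m)
    show ?case
    proof (intro allI impI)
      fix r l
      assume r: "r \<in> Poly_Mapping.keys (V (ii m) m)" and l: "ii m \<le> l" "m \<le> l"
      from r consider "r = b m" | "r \<in> Poly_Mapping.keys (V (ii m) (jj m))"
        using both by (auto simp: V_b dest!: subsetD[OF keys_add])
      then show "2 * (n - l) + 1 \<le> r \<and> r \<le> 2 * n"
      proof cases
        case 1
        then show ?thesis using both l by (auto simp: b_def)
      next
        case 2
        then show ?thesis using both(3) roots[OF both(1,2)] l by (meson le_trans less_imp_le)
      qed
    qed
  next
    case (left k m)
    show ?case
    proof (intro allI impI)
      fix r l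
      assume r: "r \<in> Poly_Mapping.keys (V k m)" and l: "k \<le> l" "m \<le> l"
      from r consider "r = a m" | "r \<in> Poly_Mapping.keys (V k (ii m))"
        using left by (auto simp: V_a dest!: subsetD[OF keys_add])
      then show "2 * (n - l) + 1 \<le> r \<and> r \<le> 2 * n"
      proof cases
        case 1
        then show ?thesis using left l by (auto simp: a_def)
      next
        case 2
        then show ?thesis using left(6) roots[OF left(1,2)] l by (meson le_trans less_imp_le)
      qed
    qed
  qed
  then show ?thesis using assms by blast
qed

lemma lookup_V_eq_zero:
  assumes "x \<noteq> y" "x \<in> {1..n}" "y \<in> {1..n}" "x < l" "y < l" "l \<le> n" "r \<le> b l"
  shows "Poly_Mapping.lookup (V x y) r = 0"
proof -
  have "r \<notin> Poly_Mapping.keys (V x y)"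
  proof
    assume "r \<in> Poly_Mapping.keys (V x y)"
    then have "2 * (n - (l - 1)) + 1 \<le> r"
      using keys_V[OF assms(1-3), of r "l - 1"] assms(4,5) by simp
    then show False using assms(4,6,7) by (simp add: b_def)
  qed
  then show ?thesis by (simp add: not_in_keys_iff_lookup_eq_zero)
qed

text \<open>The exponents of \<open>s\<^sub>x s\<^sub>y P x y\<close>. The variables \<open>s\<^sub>x\<close>
  record how often each leaf occurs in a monomial; without them \<open>P 1 2 = 1\<close> would put all powers of
  \<open>p\<^sub>1\<^sub>2\<close> into one fibre.\<close>

definition vv :: "nat \<Rightarrow> nat \<Rightarrow> nat \<Rightarrow>\<^sub>0 nat" where
  "vv x y = V x y + (Poly_Mapping.single (s x) 1 + Poly_Mapping.single (s y) 1)"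

definition lv :: "nat \<times> nat \<Rightarrow> nat \<Rightarrow>\<^sub>0 nat" where
  "lv p = vv (fst p) (snd p)"

lemma vv_commute: "vv x y = vv y x"
  by (simp add: vv_def V_commute add.commute)

lemma lv_edge [simp]: "lv (edge x y) = vv x y"
  by (auto simp: lv_def edge_def min_def max_def vv_commute)

lemma vv_eq_iff: "vv x z + vv y w = vv x w + vv y z \<longleftrightarrow> V x z + V y w = V x w + V y z"
proof -
  let ?c = "Poly_Mapping.single (s x) 1 + Poly_Mapping.single (s y) 1 +
    Poly_Mapping.single (s z) 1 + Poly_Mapping.single (s w) 1 :: nat \<Rightarrow>\<^sub>0 nat"
  have "vv x z + vv y w = (V x z + V y w) + ?c" "vv x w + vv y z = (V x w + V y z) + ?c"
    by (simp_all add: vv_def algebra_simps)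
  then show ?thesis by (simp only: add_right_cancel)
qed

definition Q :: "nat \<times> nat \<Rightarrow> nat cpoly" where
  "Q p = P (fst p) (snd p) * (pvar (s (fst p)) * pvar (s (snd p)))"

definition lc :: "nat \<times> nat \<Rightarrow> complex" where
  "lc p = Poly_Mapping.lookup (Q p) (lv p)"

definition toric_ideal :: "(nat \<times> nat) cpoly set" where
  "toric_ideal = {f \<in> carrier (plucker_ring n). eval_poly (monomial_map lv lc) f = 0}"

end

subsection \<open>Orders that select the leading exponents\<close>

text \<open>The assumption compares the candidate leading exponents of the two summands of \<open>P_rec\<close>.
  The excluded cases \<open>k = ii l\<close> and \<open>k = jj l\<close> are those where one summand is
  zero.\<close>

locale iterated_order = iterated n ii jj + exponent_order less
  for n ii jj and less :: "(nat \<Rightarrow>\<^sub>0 nat) \<Rightarrow> (nat \<Rightarrow>\<^sub>0 nat) \<Rightarrow> bool" (infix \<open>\<lhd>\<close> 50) +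
  assumes prefer_a: "\<And>k l. 3 \<le> l \<Longrightarrow> l \<le> n \<Longrightarrow> 1 \<le> k \<Longrightarrow> k < l \<Longrightarrow> k \<noteq> ii l \<Longrightarrow> k \<noteq> jj l \<Longrightarrow>
    Poly_Mapping.single (a l) 1 + V k (ii l) \<lhd> Poly_Mapping.single (b l) 1 + V k (jj l)"
begin

lemma leads_pvar_mult:
  assumes "leads v F"
  shows "leads (Poly_Mapping.single r 1 + v) (pvar r * F)"
    "Poly_Mapping.lookup (pvar r * F) (Poly_Mapping.single r 1 + v) = Poly_Mapping.lookup F v"
proof -
  have "leads (Poly_Mapping.single r 1) (pvar r)"
    by (simp add: leads_def pvar_def monomial_def)
  from leads_mult[OF this assms]
  show "leads (Poly_Mapping.single r 1 + v) (pvar r * F)"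
    "Poly_Mapping.lookup (pvar r * F) (Poly_Mapping.single r 1 + v) = Poly_Mapping.lookup F v"
    by (simp_all add: pvar_def monomial_def)
qed

lemma leads_P:
  assumes "x \<noteq> y" "x \<in> {1..n}" "y \<in> {1..n}"
  shows "leads (V x y) (P x y) \<and> Poly_Mapping.lookup (P x y) (V x y) \<noteq> 0"
  using assms
proof (induction x y rule: V_induct)
  case (swap x y)
  then show ?case using P_swap[of y x] by (simp add: V_commute[of x y] leads_def)
next
  case base
  have "leads 0 1" "Poly_Mapping.lookup 1 (0 :: nat \<Rightarrow>\<^sub>0 nat) = (1 :: complex)" by (simp_all add: leads_def)
  then show ?case by (simp only: P_1_2 V_base) simp
next
  case (both l)
  then show ?case using P_rec[of l "ii l"] leads_pvar_mult[of "V (ii l) (jj l)" "P (ii l) (jj l)" "b l"]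
    by (simp add: V_b)
next
  case (left k l)
  let ?v = "Poly_Mapping.single (a l) 1 + V k (ii l)"
  have A: "leads ?v (pvar (a l) * P k (ii l))"
    "Poly_Mapping.lookup (pvar (a l) * P k (ii l)) ?v \<noteq> 0"
    using left leads_pvar_mult[of "V k (ii l)" "P k (ii l)" "a l"] by auto
  have B: "?v \<lhd> u" if "u \<in> Poly_Mapping.keys (pvar (b l) * P k (jj l))" for u
  proof -
    have ne: "k \<noteq> jj l" using that by auto
    then have "leads (Poly_Mapping.single (b l) 1 + V k (jj l)) (pvar (b l) * P k (jj l))"
      using left leads_pvar_mult(1) by blast
    then have "u = Poly_Mapping.single (b l) 1 + V k (jj l) \<or>
        Poly_Mapping.single (b l) 1 + V k (jj l) \<lhd> u"
      using that by (simp add: leads_def)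
    moreover have "?v \<lhd> Poly_Mapping.single (b l) 1 + V k (jj l)"
      using prefer_a[OF left(1-5) ne] .
    ultimately show ?thesis using less_trans by blast
  qed
  have "leads ?v (P k l)"
    unfolding P_rec[OF left(1,2)] leads_def
  proof
    fix u
    assume "u \<in> Poly_Mapping.keys (pvar (a l) * P k (ii l) + pvar (b l) * P k (jj l))"
    then show "u = ?v \<or> ?v \<lhd> u" using A(1) B unfolding leads_def by (blast dest: subsetD[OF keys_add])
  qed
  moreover have "?v \<notin> Poly_Mapping.keys (pvar (b l) * P k (jj l))"
    using B less_irrefl by blast
  then have "Poly_Mapping.lookup (P k l) ?v \<noteq> 0"
    unfolding P_rec[OF left(1,2)] using A(2) by (simp add: lookup_add not_in_keys_iff_lookup_eq_zero)
  ultimately show ?case using left by (simp add: V_a)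
qed

lemma leads_Q:
  assumes "p \<in> plucker_idx n"
  shows "leads (lv p) (Q p)" "lc p \<noteq> 0"
proof -
  obtain x y where p: "p = (x, y)" "x \<noteq> y" "x \<in> {1..n}" "y \<in> {1..n}"
    using assms by (auto simp: plucker_idx_def)
  have "leads (Poly_Mapping.single (s x) 1 + Poly_Mapping.single (s y) 1) (pvar (s x) * pvar (s y))"
    "Poly_Mapping.lookup (pvar (s x) * pvar (s y))
      (Poly_Mapping.single (s x) 1 + Poly_Mapping.single (s y) 1) = (1 :: complex)"
    by (simp_all add: leads_def pvar_def monomial_def mult_single)
  from leads_mult[OF conjunct1[OF leads_P[OF p(2-4)]] this(1)] this(2) leads_P[OF p(2-4)]
  show "leads (lv p) (Q p)" "lc p \<noteq> 0"
    by (simp_all add: lc_def lv_def vv_def Q_def p(1))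
qed

text \<open>The four-point condition for the tree in which the path from \<open>x\<close> to \<open>y\<close> is
  disjoint from the path from \<open>z\<close> to \<open>w\<close>.\<close>

definition split :: "nat \<Rightarrow> nat \<Rightarrow> nat \<Rightarrow> nat \<Rightarrow> bool" where
  "split x y z w \<longleftrightarrow> V x z + V y w = V x w + V y z \<and> V x z + V y w \<lhd> V x y + V z w"

lemma split_sym:
  "split x y z w \<longleftrightarrow> split y x z w"
  "split x y z w \<longleftrightarrow> split x y w z"
  "split x y z w \<longleftrightarrow> split z w x y"
  by (auto simp: split_def V_commute add.commute)

definition resolved :: "nat \<Rightarrow> nat \<Rightarrow> nat \<Rightarrow> nat \<Rightarrow> bool" where
  "resolved x y z w \<longleftrightarrow> split x y z w \<or> split x z y w \<or> split x w y z"

lemma resolved_sym: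
  "resolved x y z w \<longleftrightarrow> resolved y x z w"
  "resolved x y z w \<longleftrightarrow> resolved x z y w"
  "resolved x y z w \<longleftrightarrow> resolved x y w z"
  unfolding resolved_def using split_sym by blast+

text \<open>The leaves \<open>ii l\<close> and \<open>l\<close> form a cherry, so they are on the same side of
  every split. Expanded at level \<open>l\<close>, the two equal sums contain \<open>a l\<close> and the third one
  contains \<open>b l\<close>. The inequality follows from the preference for \<open>a\<close> at \<open>y\<close>
  or at \<open>z\<close>, depending on how \<open>jj l\<close> sits relative to \<open>ii l\<close>,
  \<open>y\<close> and \<open>z\<close>.\<close>

lemma split_cherry:
  assumes l: "3 \<le> l" "l \<le> n" and y: "1 \<le> y" "y < l" "y \<noteq> ii l" and z: "1 \<le> z" "z < l" "z \<noteq> ii l"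
    and ne: "y \<noteq> z"
    and IH: "jj l \<noteq> y \<Longrightarrow> jj l \<noteq> z \<Longrightarrow> resolved (ii l) (jj l) y z"
  shows "split (ii l) l y z"
proof -
  let ?i = "ii l" and ?j = "jj l"
  let ?a = "Poly_Mapping.single (a l) 1 :: nat \<Rightarrow>\<^sub>0 nat"
  let ?b = "Poly_Mapping.single (b l) 1 :: nat \<Rightarrow>\<^sub>0 nat"
  have ylz: "V l y = ?a + V ?i y" "V l z = ?a + V ?i z" "V ?i l = ?b + V ?i ?j"
    using V_a[OF l y(2,3)] V_a[OF l z(2,3)] V_b[OF l] by (simp_all add: V_commute)
  have star: "?a + V k ?i + V k' ?i \<lhd> ?b + V k ?j + V k' ?i"
    if "1 \<le> k" "k < l" "k \<noteq> ?i" "k \<noteq> ?j" for k k'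
    using less_add[OF prefer_a[OF l that]] .
  have "?a + V ?i y + V ?i z \<lhd> ?b + V ?i ?j + V y z"
  proof -
    consider "?j = z" | "?j = y" | "?j \<noteq> y" "?j \<noteq> z" by blast
    then show ?thesis
    proof cases
      case 1
      then show ?thesis using star[of y z] y ne by (simp add: V_commute ac_simps)
    next
      case 2
      then show ?thesis using star[of z y] z ne by (simp add: V_commute ac_simps)
    next
      case 3
      from star[of y z] star[of z y] y z 3
      have st: "?a + V ?i y + V ?i z \<lhd> ?b + (V ?i z + V ?j y)"
        "?a + V ?i y + V ?i z \<lhd> ?b + (V ?i y + V ?j z)"
        by (simp_all add: V_commute ac_simps)
      from IH[OF 3] consider "split ?i ?j y z" | "split ?i y ?j z" | "split ?i z ?j y"
        using resolved_def by blast
      then show ?thesis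
      proof cases
        case 1
        then have "V ?i z + V ?j y \<lhd> V ?i ?j + V y z" by (metis split_def)
        then have "?b + (V ?i z + V ?j y) \<lhd> ?b + (V ?i ?j + V y z)"
          using less_add[of "V ?i z + V ?j y" "V ?i ?j + V y z" ?b] by (simp add: add.commute)
        then show ?thesis using st(1) less_trans by (simp add: add.assoc)
      next
        case 2
        then have "V ?i ?j + V y z = V ?i z + V ?j y"
          by (simp add: split_def V_commute)
        then show ?thesis using st(1) by (simp add: add.assoc)
      next
        case 3
        then have "V ?i ?j + V y z = V ?i y + V ?j z"
          by (simp add: split_def V_commute)
        then show ?thesis using st(2) by (simp add: add.assoc)
      qed
    qed
  qed
  then show ?thesis
    unfolding split_def ylz by (simp add: ac_simps V_commute)
qed

text \<open>If \<open>ii l\<close> is one of the other three leaves, the cherry decides. Otherwise \<open>l\<close>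
  can be replaced by \<open>ii l\<close>, which changes all three sums by the same
  \<open>a\<close>-variable.\<close>

lemma resolved_max:
  assumes l: "x < l" "y < l" "z < l" "l \<le> n"
    and pos: "1 \<le> x" "1 \<le> y" "1 \<le> z" and dist: "distinct [x, y, z]"
    and IH: "\<And>x' y' z' w'. x' + y' + z' + w' < x + y + z + l \<Longrightarrow> distinct [x', y', z', w'] \<Longrightarrow>
      {x', y', z', w'} \<subseteq> {1..n} \<Longrightarrow> resolved x' y' z' w'"
  shows "resolved x y z l"
proof -
  have l3: "3 \<le> l" using l pos dist by auto
  note R = roots[OF l3 l(4)]
  have cherry: "split (ii l) l p q"
    if "{ii l, p, q} = {x, y, z}" "distinct [ii l, p, q]" for p q
  proof (rule split_cherry)
    have pq: "p \<in> {x, y, z}" "q \<in> {x, y, z}" "ii l \<in> {x, y, z}" using that(1) by blast+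
    have "ii l + p + q = (\<Sum>k\<in>{ii l, p, q}. k)" using that(2) by simp
    also have "\<dots> = x + y + z" unfolding that(1) using dist by simp
    finally have sum: "ii l + p + q = x + y + z" .
    show "resolved (ii l) (jj l) p q" if "jj l \<noteq> p" "jj l \<noteq> q"
      by (rule IH) (use sum R that \<open>distinct [ii l, p, q]\<close> pq l pos in auto)
    show "1 \<le> p" "p < l" "1 \<le> q" "q < l" using pq l pos by auto
  qed (use that l l3 in auto)
  consider "ii l = x" | "ii l = y" | "ii l = z" | "ii l \<notin> {x, y, z}" by blast
  then show ?thesis
  proof cases
    case 1
    then have "split x l y z" using cherry[of y z] dist by auto
    then show ?thesis by (auto simp: resolved_def)
  next
    case 2
    then have "split y l x z" using cherry[of x z] dist by auto
    then show ?thesis unfolding resolved_def using split_sym by blast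
  next
    case 3
    then have "split z l x y" using cherry[of x y] dist by auto
    then show ?thesis unfolding resolved_def using split_sym by blast
  next
    case 4
    let ?a = "Poly_Mapping.single (a l) 1 :: nat \<Rightarrow>\<^sub>0 nat"
    have shift: "V k l = V k (ii l) + ?a" "V l k = V (ii l) k + ?a" if "k \<in> {x, y, z}" for k
      using V_a[OF l3 l(4), of k] that 4 l by (auto simp: V_commute add.commute)
    have lift: "split p q r l" if sp: "split p q r (ii l)" and "{p, q, r} \<subseteq> {x, y, z}" for p q r
    proof -
      have "V p r + V q l = (V p r + V q (ii l)) + ?a" "V p l + V q r = (V p (ii l) + V q r) + ?a"
        "V p q + V r l = (V p q + V r (ii l)) + ?a"
        using shift[of p] shift[of q] shift[of r] that(2) by (simp_all add: ac_simps)
      then show ?thesis using sp less_add[of _ _ ?a] unfolding split_def by metis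
    qed
    have "resolved x y z (ii l)"
      by (rule IH) (use R dist 4 l pos in auto)
    then have "split x y z (ii l) \<or> split x z y (ii l) \<or> split y z x (ii l)"
      unfolding resolved_def using split_sym(3)[of y z x "ii l"] by blast
    then have "split x y z l \<or> split x z y l \<or> split y z x l"
      using lift[of x y z] lift[of x z y] lift[of y z x] by fast
    then show ?thesis unfolding resolved_def using split_sym by blast
  qed
qed

lemma quadruple_resolved:
  assumes "distinct [x, y, z, w]" "{x, y, z, w} \<subseteq> {1..n}"
  shows "resolved x y z w"
  using assms
proof (induction "x + y + z + w" arbitrary: x y z w rule: less_induct)
  case less
  have main: "resolved p q r m"
    if "p < m" "q < m" "r < m" and dist: "distinct [p, q, r, m]" and sub: "{p, q, r, m} \<subseteq> {1..n}"
      and sum: "p + q + r + m = x + y + z + w" for p q r m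
  proof (rule resolved_max[OF that(1-3)])
    show "m \<le> n" "1 \<le> p" "1 \<le> q" "1 \<le> r" "distinct [p, q, r]" using dist sub by auto
    show "resolved x' y' z' w'"
      if "x' + y' + z' + w' < p + q + r + m" "distinct [x', y', z', w']" "{x', y', z', w'} \<subseteq> {1..n}"
      for x' y' z' w'
      using less(1)[OF _ that(2,3)] that(1) sum by simp
  qed
  have d: "x \<noteq> y" "x \<noteq> z" "x \<noteq> w" "y \<noteq> z" "y \<noteq> w" "z \<noteq> w" using less(2) by auto
  then consider "x < w" "y < w" "z < w" | "x < z" "y < z" "w < z" | "x < y" "z < y" "w < y"
    | "y < x" "z < x" "w < x"
    by linarith
  then show ?case
  proof cases
    case 1
    show ?thesis by (rule main[OF 1]) (use less(2,3) in auto)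
  next
    case 2
    have "resolved x y w z" by (rule main[OF 2]) (use less(2,3) in auto)
    then show ?thesis using resolved_sym by blast
  next
    case 3
    have "resolved x w z y" by (rule main[OF 3(1,3,2)]) (use less(2,3) in auto)
    then show ?thesis using resolved_sym by blast
  next
    case 4
    have "resolved w y z x" by (rule main[OF 4(3,1,2)]) (use less(2,3) in auto)
    then show ?thesis using resolved_sym by blast
  qed
qed

text \<open>The other two possible splits of the quadruple would make the two equal sums different.\<close>

lemma balanced_less:
  assumes "distinct [x, y, z, w]" "{x, y, z, w} \<subseteq> {1..n}" "vv x z + vv y w = vv x w + vv y z"
  shows "vv x z + vv y w \<lhd> vv x y + vv z w"
proof -
  have eq: "V x z + V y w = V x w + V y z" using assms(3) by (simp add: vv_eq_iff)
  have "split x y z w"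
    using quadruple_resolved[OF assms(1,2)] eq less_irrefl
    by (auto simp: resolved_def split_def V_commute add.commute)
  then have "V x z + V y w \<lhd> V x y + V z w" unfolding split_def by (rule conjunct2)
  from less_add[OF this, of "Poly_Mapping.single (s x) 1 + Poly_Mapping.single (s y) 1 +
      Poly_Mapping.single (s z) 1 + Poly_Mapping.single (s w) 1"]
  show ?thesis by (simp add: vv_def ac_simps)
qed

end

section \<open>Fibres of the monomial map\<close>

context iterated
begin

text \<open>Exactly the quadruples whose three-term relation has an initial part with the terms \<open>xz,
  yw\<close> and \<open>xw, yz\<close>. The definition does not mention an order, so that the fibres can be studied
  once for all orders.\<close>

definition balanced :: "nat \<Rightarrow> nat \<Rightarrow> nat \<Rightarrow> nat \<Rightarrow> nat \<Rightarrow> bool" where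
  "balanced L x y z w \<longleftrightarrow> distinct [x, y, z, w] \<and> {x, y, z, w} \<subseteq> {1..L} \<and>
    vv x z + vv y w = vv x w + vv y z"

inductive conn :: "nat \<Rightarrow> (nat \<times> nat) multiset \<Rightarrow> (nat \<times> nat) multiset \<Rightarrow> bool" for L A where
  none: "conn L A A"
| swap: "conn L A ({#edge x z, edge y w#} + R) \<Longrightarrow> balanced L x y z w \<Longrightarrow>
    conn L A ({#edge x w, edge y z#} + R)"

lemma conn_trans:
  assumes "conn L B C" "conn L A B"
  shows "conn L A C"
  using assms
proof induction
  case (swap x z y w R)
  show ?case by (rule conn.swap[OF swap.IH[OF swap.prems] swap.hyps(2)])
qed

lemma conn_add:
  assumes "conn L A B"
  shows "conn L (A + R) (B + R)"
  using assms
proof induction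
  case none
  show ?case by (rule conn.none)
next
  case (swap x z y w R')
  then show ?case using conn.swap[of L "A + R" x z y w "R' + R"] by (simp add: ac_simps)
qed

lemma conn_invariants:
  assumes "conn L A B"
  shows "(\<Sum>p\<in>#A. lv p) = (\<Sum>p\<in>#B. lv p)" and "set_mset A \<subseteq> plucker_idx L \<Longrightarrow> set_mset B \<subseteq> plucker_idx L"
proof -
  show "(\<Sum>p\<in>#A. lv p) = (\<Sum>p\<in>#B. lv p)"
    using assms
  proof induction
    case (swap x z y w R)
    then have "vv x z + vv y w = vv x w + vv y z" by (simp add: balanced_def)
    then show ?case using swap.IH by (simp add: add.assoc[symmetric])
  qed simp
  show "set_mset B \<subseteq> plucker_idx L" if "set_mset A \<subseteq> plucker_idx L"
    using assms
  proof induction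
    case (swap x z y w R)
    then show ?case by (auto simp: edge_in_plucker_idx balanced_def)
  qed (use that in simp)
qed

text \<open>Removing leaf \<open>L\<close> turns it into its cherry partner \<open>ii L\<close>. An edge that ended
  in \<open>L\<close> is said to carry a mark; the mark is lost under merging. The edge between \<open>ii L\<close>
  and \<open>L\<close> would become a loop, hence the restriction to reduced multisets.\<close>

definition sub_leaf :: "nat \<Rightarrow> nat \<Rightarrow> nat" where
  "sub_leaf L x = (if x = L then ii L else x)"

definition merge :: "nat \<Rightarrow> nat \<times> nat \<Rightarrow> nat \<times> nat" where
  "merge L p = edge (sub_leaf L (fst p)) (sub_leaf L (snd p))"

lemma merge_edge: "merge L (edge x y) = edge (sub_leaf L x) (sub_leaf L y)"
  by (auto simp: merge_def edge_def min_def max_def)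

lemma plucker_idx_edge:
  assumes "p \<in> plucker_idx L"
  obtains x y where "p = edge x y" "x < y" "1 \<le> x" "y \<le> L"
  using assms by (auto simp: plucker_idx_def)

definition reduced :: "nat \<Rightarrow> (nat \<times> nat) multiset \<Rightarrow> bool" where
  "reduced L A \<longleftrightarrow> set_mset A \<subseteq> plucker_idx L - {(ii L, L)}"

context
  fixes L
  assumes L: "3 \<le> L" "L \<le> n"
begin

lemma vv_L: "1 \<le> k \<Longrightarrow> k < L \<Longrightarrow> k \<noteq> ii L \<Longrightarrow>
    vv k L + Poly_Mapping.single (s (ii L)) 1 =
    vv k (ii L) + (Poly_Mapping.single (a L) 1 + Poly_Mapping.single (s L) 1)"
  using V_a[OF L, of k] by (simp add: vv_def ac_simps)

lemma lookup_s: "r \<le> 2 * n \<Longrightarrow> 1 \<le> x \<Longrightarrow> Poly_Mapping.lookup (Poly_Mapping.single (s x) (1 :: nat)) r = 0"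
  by (simp add: lookup_single s_def when_def)

lemma ab_le: "a L \<le> 2 * n" "b L \<le> 2 * n" "a L \<le> b L" "a L \<noteq> b L"
  using L by (auto simp: a_def b_def)

text \<open>The variables \<open>a L\<close> and \<open>b L\<close> count the marked edges and the edges of the
  cherry, so both numbers are constant on fibres.\<close>

lemma lookup_lv:
  assumes "p \<in> plucker_idx L"
  shows "Poly_Mapping.lookup (lv p) (a L) = (if snd p = L \<and> p \<noteq> (ii L, L) then 1 else 0)"
    "Poly_Mapping.lookup (lv p) (b L) = (if p = (ii L, L) then 1 else 0)"
proof -
  obtain x y where p: "p = (x, y)" "x < y" "1 \<le> x" "y \<le> L"
    using assms by (auto simp: plucker_idx_def)
  note R = roots[OF L]
  have zero: "Poly_Mapping.lookup (V k m) r = 0"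
    if "k \<noteq> m" "1 \<le> k" "1 \<le> m" "k < L" "m < L" "r \<le> b L" for k m r
    using lookup_V_eq_zero[of k m L r] that L by auto
  have V: "Poly_Mapping.lookup (lv p) r = Poly_Mapping.lookup (V x y) r" if "r \<le> 2 * n" for r
    using p lookup_s[OF that, of x, unfolded One_nat_def] lookup_s[OF that, of y, unfolded One_nat_def]
    by (simp add: lv_def vv_def lookup_add)
  have val: "Poly_Mapping.lookup (V x y) r = (if y = L then
      (if x = ii L then Poly_Mapping.lookup (Poly_Mapping.single (b L) 1) r
       else Poly_Mapping.lookup (Poly_Mapping.single (a L) 1) r) else 0)" if "r \<le> b L" for r
  proof -
    consider "y < L" | "y = L" "x = ii L" | "y = L" "x \<noteq> ii L" using p by linarith
    then show ?thesis
    proof cases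
      case 1
      then show ?thesis using zero[of x y r] p that by simp
    next
      case 2
      then show ?thesis using zero[of "ii L" "jj L" r] R that by (simp add: V_b[OF L] lookup_add)
    next
      case 3
      then show ?thesis
        using zero[of x "ii L" r] R p that V_a[OF L, of x] by (simp add: lookup_add)
    qed
  qed
  show "Poly_Mapping.lookup (lv p) (a L) = (if snd p = L \<and> p \<noteq> (ii L, L) then 1 else 0)"
    unfolding V[OF ab_le(1)] val[OF ab_le(3)] using ab_le(4) by (simp add: p(1) lookup_single)
  show "Poly_Mapping.lookup (lv p) (b L) = (if p = (ii L, L) then 1 else 0)"
    unfolding V[OF ab_le(2)] val[OF order_refl] using ab_le(4) by (simp add: p(1) lookup_single)
qed

lemma lookup_sum_lv:
  assumes "set_mset A \<subseteq> plucker_idx L"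
  shows "Poly_Mapping.lookup (\<Sum>p\<in>#A. lv p) (a L) = size {#p \<in># A. snd p = L \<and> p \<noteq> (ii L, L)#}"
    "Poly_Mapping.lookup (\<Sum>p\<in>#A. lv p) (b L) = count A (ii L, L)"
  using assms by (induction A) (auto simp: lookup_add lookup_lv)

lemma lv_merge:
  assumes "p \<in> plucker_idx L" "p \<noteq> (ii L, L)"
  shows "lv p + (if snd p = L then Poly_Mapping.single (s (ii L)) 1 else 0) =
    lv (merge L p) + (if snd p = L then Poly_Mapping.single (a L) 1 + Poly_Mapping.single (s L) 1 else 0)"
    and "merge L p \<in> plucker_idx (L - 1)"
proof -
  obtain x y where p: "p = edge x y" "x < y" "1 \<le> x" "y \<le> L"
    using assms(1) by (rule plucker_idx_edge)
  note R = roots[OF L]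
  show "lv p + (if snd p = L then Poly_Mapping.single (s (ii L)) 1 else 0) =
    lv (merge L p) + (if snd p = L then Poly_Mapping.single (a L) 1 + Poly_Mapping.single (s L) 1 else 0)"
    unfolding p(1) merge_edge lv_edge
    using p assms(2) vv_L[of x] by (auto simp: sub_leaf_def)
  show "merge L p \<in> plucker_idx (L - 1)"
    unfolding p(1) merge_edge edge_in_plucker_idx
    using p assms(2) R L by (auto simp: sub_leaf_def)
qed

text \<open>Merging changes the exponent of an edge only by the variables that come with its mark. So on a fibre,
  where the number of marks is constant, the merged multisets stay in one fibre.\<close>

lemma sum_lv_merge:
  assumes "reduced L A"
  shows "(\<Sum>p\<in>#A. lv p) + (\<Sum>p\<in>#{#p \<in># A. snd p = L#}. Poly_Mapping.single (s (ii L)) 1) =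
    (\<Sum>p\<in>#image_mset (merge L) A. lv p) +
    (\<Sum>p\<in>#{#p \<in># A. snd p = L#}. Poly_Mapping.single (a L) 1 + Poly_Mapping.single (s L) 1)"
proof -
  have indicator: "(\<Sum>p\<in>#{#p \<in># A. snd p = L#}. c) = (\<Sum>p\<in>#A. if snd p = L then c else 0)"
    for c :: "nat \<Rightarrow>\<^sub>0 nat"
    by (induction A) (auto simp del: sum_mset_constant)
  have "image_mset (\<lambda>p. lv p + (if snd p = L then Poly_Mapping.single (s (ii L)) 1 else 0)) A =
      image_mset (\<lambda>p. lv (merge L p) +
        (if snd p = L then Poly_Mapping.single (a L) 1 + Poly_Mapping.single (s L) 1 else 0)) A"
    using assms by (intro image_mset_cong lv_merge(1)) (auto simp: reduced_def)
  then show ?thesis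
    unfolding indicator by (simp add: sum_mset.distrib[symmetric] image_mset.compositionality comp_def)
qed

lemma reduced_marks_eq:
  assumes "reduced L A" "reduced L B" "(\<Sum>p\<in>#A. lv p) = (\<Sum>p\<in>#B. lv p)"
  shows "size {#p \<in># A. snd p = L#} = size {#p \<in># B. snd p = L#}"
    "(\<Sum>p\<in>#image_mset (merge L) A. lv p) = (\<Sum>p\<in>#image_mset (merge L) B. lv p)"
proof -
  have filt: "{#p \<in># C. snd p = L \<and> p \<noteq> (ii L, L)#} = {#p \<in># C. snd p = L#}" if "reduced L C" for C
    using that by (intro filter_mset_cong) (auto simp: reduced_def)
  show *: "size {#p \<in># A. snd p = L#} = size {#p \<in># B. snd p = L#}"
  proof -
    have "set_mset A \<subseteq> plucker_idx L" "set_mset B \<subseteq> plucker_idx L"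
      using assms(1,2) by (auto simp: reduced_def)
    from this[THEN lookup_sum_lv(1)] show ?thesis
      unfolding filt[OF assms(1)] filt[OF assms(2)] assms(3) by (metis of_nat_id)
  qed
  have const: "(\<Sum>p\<in>#C. c) = (\<Sum>p\<in>#D. c)" if "size C = size D"
    for c :: "nat \<Rightarrow>\<^sub>0 nat" and C D :: "(nat \<times> nat) multiset"
    using that by (simp add: image_mset_const_eq)
  show "(\<Sum>p\<in>#image_mset (merge L) A. lv p) = (\<Sum>p\<in>#image_mset (merge L) B. lv p)"
    using sum_lv_merge[OF assms(1)] sum_lv_merge[OF assms(2)] const[OF *] assms(3)
    by (metis add_right_cancel)
qed

lemma merge_eq_cases:
  assumes "p \<in> plucker_idx L - {(ii L, L)}" "merge L p = edge x y" "x < L" "y < L"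
  obtains x' y' where "p = edge x' y'" "sub_leaf L x' = x" "sub_leaf L y' = y"
proof -
  have "p \<in> plucker_idx L" using assms(1) by simp
  then obtain u v where p: "p = edge u v" by (rule plucker_idx_edge)
  then have "edge (sub_leaf L u) (sub_leaf L v) = edge x y" using assms(2) merge_edge by simp
  then show ?thesis using that[of u v] that[of v u] p by (auto simp: edge_eq_iff edge_commute)
qed

text \<open>At most one of the four leaves is \<open>L\<close>, and it contributes the same variables to each of
  the three pairings.\<close>

lemma balanced_merge_iff:
  assumes d: "distinct [sub_leaf L x, sub_leaf L y, sub_leaf L z, sub_leaf L w]"
    and range: "{x, y, z, w} \<subseteq> {1..L}"
  shows "balanced L x y z w \<longleftrightarrow>
    balanced (L - 1) (sub_leaf L x) (sub_leaf L y) (sub_leaf L z) (sub_leaf L w)"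
proof -
  note R = roots[OF L]
  let ?r = "sub_leaf L"
  have d': "distinct [x, y, z, w]" using d by auto
  have "?r u \<in> {1..L - 1}" if "u \<in> {1..L}" for u
    using that R by (auto simp: sub_leaf_def)
  then have range': "{?r x, ?r y, ?r z, ?r w} \<subseteq> {1..L - 1}"
    using range by blast
  define C :: "nat \<Rightarrow> nat \<Rightarrow> nat \<Rightarrow>\<^sub>0 nat" where
    "C u v = (if u = L \<or> v = L then Poly_Mapping.single (s (ii L)) 1 else 0)" for u v
  define D :: "nat \<Rightarrow> nat \<Rightarrow> nat \<Rightarrow>\<^sub>0 nat" where
    "D u v = (if u = L \<or> v = L then Poly_Mapping.single (a L) 1 + Poly_Mapping.single (s L) 1 else 0)" for u v
  have shift: "vv u v + C u v = vv (?r u) (?r v) + D u v"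
    if "u \<noteq> v" "?r u \<noteq> ?r v" "u \<in> {1..L}" "v \<in> {1..L}" for u v
  proof -
    have p: "edge u v \<in> plucker_idx L" using that by (simp add: edge_in_plucker_idx)
    have ne: "edge u v \<noteq> (ii L, L)"
      using that R by (auto simp: sub_leaf_def edge_def min_def max_def split: if_splits)
    have m: "snd (edge u v) = L \<longleftrightarrow> u = L \<or> v = L"
      using that by (auto simp: edge_def max_def)
    show ?thesis using lv_merge(1)[OF p ne] unfolding merge_edge lv_edge m C_def D_def .
  qed
  have pair: "vv u v + vv u' v' + (C u v + C u' v') =
      vv (?r u) (?r v) + vv (?r u') (?r v') + (D u v + D u' v')"
    if "vv u v + C u v = vv (?r u) (?r v) + D u v"
      "vv u' v' + C u' v' = vv (?r u') (?r v') + D u' v'" for u v u' v'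
  proof -
    have "vv u v + vv u' v' + (C u v + C u' v') = (vv u v + C u v) + (vv u' v' + C u' v')"
      by (simp only: ac_simps)
    then show ?thesis unfolding that by (simp only: ac_simps)
  qed
  have "vv x z + vv y w + (C x z + C y w) = vv (?r x) (?r z) + vv (?r y) (?r w) + (D x z + D y w)"
    by (intro pair shift) (use d d' range in auto)
  moreover have "vv x w + vv y z + (C x z + C y w) = vv (?r x) (?r w) + vv (?r y) (?r z) + (D x z + D y w)"
  proof -
    have "C x w + C y z = C x z + C y w" "D x w + D y z = D x z + D y w"
      using d' by (auto simp: C_def D_def)
    moreover have "vv x w + vv y z + (C x w + C y z) =
        vv (?r x) (?r w) + vv (?r y) (?r z) + (D x w + D y z)"
      by (intro pair shift) (use d d' range in auto)
    ultimately show ?thesis by metis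
  qed
  ultimately have "vv x z + vv y w = vv x w + vv y z \<longleftrightarrow>
      vv (?r x) (?r z) + vv (?r y) (?r w) = vv (?r x) (?r w) + vv (?r y) (?r z)"
    by (metis add_right_cancel)
  then show ?thesis
    unfolding balanced_def using d d' range range' by blast
qed

text \<open>Each swap of the merged multiset lifts: choose preimages of its two edges and swap those.\<close>

lemma conn_lift:
  assumes "conn (L - 1) A' B'" "image_mset (merge L) A = A'" "reduced L A"
  shows "\<exists>B. image_mset (merge L) B = B' \<and> reduced L B \<and> conn L A B"
  using assms
proof induction
  case none
  then show ?case using conn.none by blast
next
  case (swap x z y w R')
  then obtain B where B: "image_mset (merge L) B = {#edge x z, edge y w#} + R'" "reduced L B" "conn L A B"
    by blast
  have lt: "x < L" "y < L" "z < L" "w < L" using swap(2) L by (auto simp: balanced_def)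
  have "image_mset (merge L) B = add_mset (edge x z) (add_mset (edge y w) R')" using B(1) by simp
  then obtain p B1 where p: "B = add_mset p B1" "merge L p = edge x z"
      "image_mset (merge L) B1 = add_mset (edge y w) R'"
    by (metis msed_map_invR)
  then obtain q R where q: "B1 = add_mset q R" "merge L q = edge y w" "image_mset (merge L) R = R'"
    by (metis msed_map_invR)
  have pq: "p \<in> plucker_idx L - {(ii L, L)}" "q \<in> plucker_idx L - {(ii L, L)}"
    using B(2) p(1) q(1) by (auto simp: reduced_def)
  obtain x' z' where x': "p = edge x' z'" "sub_leaf L x' = x" "sub_leaf L z' = z"
    using merge_eq_cases[OF pq(1) p(2)] lt by blast
  obtain y' w' where y': "q = edge y' w'" "sub_leaf L y' = y" "sub_leaf L w' = w"
    using merge_eq_cases[OF pq(2) q(2)] lt by blast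
  have range: "{x', y', z', w'} \<subseteq> {1..L}"
    using pq x'(1) y'(1) by (auto simp: edge_in_plucker_idx)
  have bal: "balanced L x' y' z' w'"
  proof -
    have "distinct [sub_leaf L x', sub_leaf L y', sub_leaf L z', sub_leaf L w']"
      using swap(2) x' y' unfolding balanced_def by metis
    from balanced_merge_iff[OF this range] show ?thesis using swap(2) x' y' by metis
  qed
  let ?C = "{#edge x' w', edge y' z'#} + R"
  have "conn L A ?C"
    by (rule conn.swap[OF _ bal]) (use B(3) p(1) q(1) x'(1) y'(1) in simp)
  moreover have "image_mset (merge L) ?C = {#edge x w, edge y z#} + R'"
    using q(3) x' y' by (simp add: merge_edge)
  moreover have "reduced L ?C"
  proof -
    have "edge u v \<noteq> (ii L, L)" if "sub_leaf L u \<noteq> sub_leaf L v" for u v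
      using that roots[OF L] by (auto simp: sub_leaf_def edge_def min_def max_def split: if_splits)
    moreover have "x \<noteq> w" "y \<noteq> z" using swap(2) by (auto simp: balanced_def)
    moreover have "edge x' w' \<in> plucker_idx L" "edge y' z' \<in> plucker_idx L"
      using bal by (auto simp: balanced_def edge_in_plucker_idx)
    ultimately show ?thesis
      using B(2) p(1) q(1) x' y' by (auto simp: reduced_def)
  qed
  ultimately show ?case by blast
qed

text \<open>A mark can be moved from an edge at \<open>k\<close> to an edge at \<open>m\<close> by one swap,
  because \<open>L\<close> and \<open>ii L\<close> form a cherry. After such a swap both multisets contain a common
  edge, which is cancelled.\<close>

lemma conn_marks:
  assumes "image_mset (merge L) A = image_mset (merge L) B"
    "size {#p \<in># A. snd p = L#} = size {#p \<in># B. snd p = L#}" "reduced L A" "reduced L B"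
  shows "conn L A B"
  using assms
proof (induction "size A" arbitrary: A B rule: less_induct)
  case less
  note R = roots[OF L]
  have inA: "p \<in> plucker_idx L - {(ii L, L)}" if "p \<in># A" for p
    using that less(4) unfolding reduced_def by blast
  have inB: "p \<in> plucker_idx L - {(ii L, L)}" if "p \<in># B" for p
    using that less(5) unfolding reduced_def by blast
  have cancel: "conn L A B" if pA: "p \<in># A" and pB: "p \<in># B" for p
  proof -
    obtain A' B' where AB: "A = add_mset p A'" "B = add_mset p B'"
      using multi_member_split[OF pA] multi_member_split[OF pB] by blast
    have "conn L A' B'"
      by (rule less(1)) (use less(2-5) AB in \<open>auto simp: reduced_def split: if_splits\<close>)
    then show ?thesis using conn_add[of L A' B' "{#p#}"] AB by simp
  qed
  have unmarked: "merge L p = p" if "p \<in> plucker_idx L" "snd p \<noteq> L" for p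
    using that by (auto simp: merge_def plucker_idx_def sub_leaf_def)
  have marked: "\<exists>k. p = (k, L) \<and> 1 \<le> k \<and> k < L \<and> k \<noteq> ii L \<and> merge L p = edge k (ii L)"
    if "p \<in> plucker_idx L - {(ii L, L)}" "snd p = L" for p
    using that by (auto simp: merge_def plucker_idx_def sub_leaf_def)
  show ?case
  proof (cases "\<exists>p \<in># A. snd p = L")
    case False
    then have "set_mset {#p \<in># A. snd p = L#} = {}" by auto
    then have "{#p \<in># A. snd p = L#} = {#}" by (simp only: set_mset_eq_empty_iff)
    then have "{#p \<in># B. snd p = L#} = {#}" using less(3) by (metis size_eq_0_iff_empty)
    then have "set_mset {#p \<in># B. snd p = L#} = {}" by (simp only: set_mset_empty)
    then have False': "snd p \<noteq> L" if "p \<in># B" for p using that by (cases p) auto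
    have id: "image_mset (merge L) C = C" if "\<And>p. p \<in># C \<Longrightarrow> p \<in> plucker_idx L \<and> snd p \<noteq> L" for C
      using image_mset_cong[of C "merge L" "\<lambda>p. p"] that unmarked by simp
    have "image_mset (merge L) A = A" by (rule id) (use False less(4) in \<open>unfold reduced_def, blast\<close>)
    moreover have "image_mset (merge L) B = B"
      by (rule id) (use False' less(5) in \<open>unfold reduced_def, blast\<close>)
    ultimately have "A = B" using less(2) by metis
    then show ?thesis using conn.none by metis
  next
    case True
    then obtain p where p: "p \<in># A" "snd p = L" by blast
    then obtain k where k: "p = (k, L)" "1 \<le> k" "k < L" "k \<noteq> ii L" "merge L p = edge k (ii L)"
      using marked[OF inA[OF p(1)] p(2)] by blast
    have "p \<in># {#p \<in># A. snd p = L#}" using p by simp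
    then have "size {#p \<in># B. snd p = L#} \<noteq> 0" using less(3) by (metis size_eq_0_iff_empty empty_iff set_mset_empty)
    then have "set_mset {#p \<in># B. snd p = L#} \<noteq> {}" by simp
    then obtain q where q: "q \<in># B" "snd q = L" by auto
    then obtain m where m: "q = (m, L)" "1 \<le> m" "m < L" "m \<noteq> ii L" "merge L q = edge m (ii L)"
      using marked[OF inB[OF q(1)] q(2)] by blast
    \<comment> \<open>By equality of the merged multisets, \<open>B\<close> has an edge that merges like \<open>p\<close>, and \<open>A\<close> one that merges
      like \<open>q\<close>; each may or may not carry its mark.\<close>
    have preimage: "e \<in> {(c, L), edge c (ii L)}"
      if "merge L e = edge c (ii L)" "e \<in> plucker_idx L - {(ii L, L)}" "1 \<le> c" "c < L" "c \<noteq> ii L" for c e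
      using that marked[of e] unmarked[of e] R by (cases "snd e = L") (auto simp: edge_eq_iff)
    have "edge k (ii L) \<in># image_mset (merge L) B"
      using p(1) k(5) less(2) by (metis image_eqI set_image_mset)
    then obtain p' where "p' \<in># B" and "merge L p' = edge k (ii L)" by auto
    then have p': "(k, L) \<in># B \<or> edge k (ii L) \<in># B"
      using preimage[OF _ inB k(2-4), of p'] \<open>p' \<in># B\<close> by blast
    have "edge m (ii L) \<in># image_mset (merge L) A"
      using q(1) m(5) less(2) by (metis image_eqI set_image_mset)
    then obtain q' where "q' \<in># A" "merge L q' = edge m (ii L)" by auto
    then have q': "(m, L) \<in># A \<or> edge m (ii L) \<in># A"
      using preimage[OF _ inA m(2-4), of q'] \<open>q' \<in># A\<close> by blast
    show ?thesis
    proof (cases "(k, L) \<in># B \<or> (m, L) \<in># A")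
      case True
      then show ?thesis using cancel p(1) k(1) q(1) m(1) by blast
    next
      case False
      then have pB: "edge k (ii L) \<in># B" and qA: "edge m (ii L) \<in># A" and km: "k \<noteq> m"
        using p' q' q(1) m(1) by auto
      have "edge m (ii L) \<noteq> (k, L)" using R m by (auto simp: edge_def)
      obtain A1 where A1: "A = add_mset (k, L) A1"
        using multi_member_split[of "(k, L)" A] p(1) k(1) by blast
      then have "edge m (ii L) \<in># A1" using qA \<open>edge m (ii L) \<noteq> (k, L)\<close> by simp
      then obtain A' where "A1 = add_mset (edge m (ii L)) A'"
        using multi_member_split[of "edge m (ii L)" A1] by blast
      then have A': "A = {#edge L k, edge (ii L) m#} + A'"
        using A1 k(3) by (simp add: edge_commute)
      have bal: "balanced L L (ii L) k m"
      proof -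
        let ?c = "Poly_Mapping.single (s (ii L)) 1 :: nat \<Rightarrow>\<^sub>0 nat"
        let ?d = "Poly_Mapping.single (a L) 1 + Poly_Mapping.single (s L) 1 :: nat \<Rightarrow>\<^sub>0 nat"
        have "vv k L + vv m (ii L) + ?c = (vv k L + ?c) + vv m (ii L)" by (simp only: ac_simps)
        also have "\<dots> = (vv m (ii L) + ?d) + vv k (ii L)"
          unfolding vv_L[OF k(2-4)] by (simp only: ac_simps)
        also have "\<dots> = vv m L + vv k (ii L) + ?c"
          unfolding vv_L[OF m(2-4), symmetric] by (simp only: ac_simps)
        finally have "vv k L + vv m (ii L) = vv m L + vv k (ii L)" by (rule add_right_imp_eq)
        then have "vv L k + vv (ii L) m = vv L m + vv (ii L) k"
          by (simp add: vv_commute)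
        then show ?thesis using k m km R L by (auto simp: balanced_def)
      qed
      let ?C = "{#edge L m, edge (ii L) k#} + A'"
      have "conn L A ({#edge L k, edge (ii L) m#} + A')"
        unfolding A'[symmetric] by (rule conn.none)
      then have AC: "conn L A ?C" by (rule conn.swap[OF _ bal])
      have "set_mset A' \<subseteq> plucker_idx L - {(ii L, L)}"
        using less(4) unfolding reduced_def A' by simp
      moreover have "edge L m \<in> plucker_idx L" "edge (ii L) k \<in> plucker_idx L"
        unfolding edge_in_plucker_idx using k(2-4) m(2-4) R by auto
      moreover have "edge L m \<noteq> (ii L, L)" "edge (ii L) k \<noteq> (ii L, L)"
        using k(2-4) m(2-4) R by (auto simp: edge_def)
      ultimately have C: "reduced L ?C" by (simp add: reduced_def)
      obtain B' where B': "B = add_mset (m, L) B'"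
        using multi_member_split[of "(m, L)" B] q(1) m(1) by blast
      define C' where "C' = add_mset (edge (ii L) k) A'"
      have CB: "?C = add_mset (m, L) C'" "B = add_mset (m, L) B'"
        using m(3) B' by (simp_all add: C'_def)
      have "conn L C' B'"
      proof (rule less(1))
        have "size A = Suc (size C')" unfolding A' C'_def by simp
        then show "size C' < size A" by simp
        have "image_mset (merge L) ?C = image_mset (merge L) A"
          using k(2-4) m(2-4) R unfolding A'
          by (simp add: merge_edge sub_leaf_def add_mset_commute edge_commute del: edge_less edge_greater)
        then have "image_mset (merge L) (add_mset (m, L) C') = image_mset (merge L) (add_mset (m, L) B')"
          using less(2) by (metis CB)
        then show "image_mset (merge L) C' = image_mset (merge L) B'" by simp
        have "size {#p \<in># ?C. snd p = L#} = size {#p \<in># A. snd p = L#}"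
          using k(2-4) m(2-4) R unfolding A' by (simp add: edge_def max_def)
        then have "size {#p \<in># add_mset (m, L) C'. snd p = L#} =
            size {#p \<in># add_mset (m, L) B'. snd p = L#}"
          using less(3) by (metis CB)
        then show "size {#p \<in># C'. snd p = L#} = size {#p \<in># B'. snd p = L#}" by simp
        show "reduced L C'" "reduced L B'"
          using C less(5) unfolding CB by (auto simp: reduced_def)
      qed
      then have "conn L ?C B" using conn_add[of L C' B' "{#(m, L)#}"] CB by simp
      then show ?thesis using AC conn_trans by blast
    qed
  qed
qed

end

text \<open>Induction on the number of leaves: split off the cherry edges, whose number is constant on the fibre,
  merge, apply the induction hypothesis, lift the swaps, and correct the positions of the marks.\<close>

lemma conn_fibre:
  assumes "2 \<le> L" "L \<le> n" "set_mset A \<subseteq> plucker_idx L" "set_mset B \<subseteq> plucker_idx L"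
    "(\<Sum>p\<in>#A. lv p) = (\<Sum>p\<in>#B. lv p)"
  shows "conn L A B"
  using assms
proof (induction L arbitrary: A B rule: dec_induct)
  case base
  have idx: "plucker_idx 2 = {(1, 2)}" by (auto simp: plucker_idx_def)
  have rep: "C = replicate_mset (Poly_Mapping.lookup (\<Sum>p\<in>#C. lv p) (s 1)) (1, 2)"
    if "set_mset C \<subseteq> plucker_idx 2" for C
    using that unfolding idx
    by (induction C) (auto simp: lookup_add lv_def vv_def V_base lookup_single when_def s_def)
  have "A = B" using rep[OF base(2)] rep[OF base(3)] base(4) by metis
  then show ?case using conn.none by simp
next
  case (step L)
  let ?L = "Suc L"
  have L: "3 \<le> ?L" "?L \<le> n" using step by auto
  let ?e = "(ii ?L, ?L)"
  define h where "h = count A ?e"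
  have hB: "h = count B ?e"
    using lookup_sum_lv(2)[OF L step(5)] lookup_sum_lv(2)[OF L step(6)] step(7) by (simp add: h_def)
  define A0 where "A0 = filter_mset (\<lambda>p. p \<noteq> ?e) A"
  define B0 where "B0 = filter_mset (\<lambda>p. p \<noteq> ?e) B"
  have A: "A = A0 + replicate_mset h ?e"
    by (rule multiset_eqI) (simp add: A0_def h_def)
  have B: "B = B0 + replicate_mset h ?e"
    by (rule multiset_eqI) (simp add: B0_def hB)
  have red: "reduced ?L A0" "reduced ?L B0"
    using step(5,6) by (auto simp: reduced_def A0_def B0_def)
  have sums: "(\<Sum>p\<in>#A0. lv p) = (\<Sum>p\<in>#B0. lv p)"
    using step(7) unfolding A B by simp
  have "conn L (image_mset (merge ?L) A0) (image_mset (merge ?L) B0)"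
  proof (rule step(3))
    show "set_mset (image_mset (merge ?L) A0) \<subseteq> plucker_idx L"
      "set_mset (image_mset (merge ?L) B0) \<subseteq> plucker_idx L"
      using red lv_merge(2)[OF L] unfolding reduced_def by fastforce+
    show "(\<Sum>p\<in>#image_mset (merge ?L) A0. lv p) = (\<Sum>p\<in>#image_mset (merge ?L) B0. lv p)"
      by (rule reduced_marks_eq[OF L red sums])
  qed (use L in simp)
  then obtain B1 where B1: "image_mset (merge ?L) B1 = image_mset (merge ?L) B0" "reduced ?L B1"
      "conn ?L A0 B1"
    using conn_lift[OF L, of "image_mset (merge ?L) A0" "image_mset (merge ?L) B0" A0] red by auto
  have "(\<Sum>p\<in>#B1. lv p) = (\<Sum>p\<in>#B0. lv p)" using conn_invariants(1)[OF B1(3)] sums by simp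
  then have "conn ?L B1 B0"
    using conn_marks[OF L B1(1) _ B1(2) red(2)] reduced_marks_eq(1)[OF L B1(2) red(2)] by blast
  then have "conn ?L A0 B0" using B1(3) conn_trans by blast
  then show ?case unfolding A B by (rule conn_add)
qed

end

section \<open>The initial ideal is the kernel of the monomial map\<close>

lemma pvar_mult_pvar: "pvar p * pvar q = Poly_Mapping.single (mexp {#p, q#}) 1"
  by (simp add: pvar_def monomial_def mult_single)

lemma plucker_generators_in_ring:
  "{pvar (i, j) * pvar (k, l) - pvar (i, k) * pvar (j, l) + pvar (i, l) * pvar (j, k)
      | i j k l. 1 \<le> i \<and> i < j \<and> j < k \<and> k < l \<and> l \<le> n} \<subseteq> carrier (plucker_ring n)"
proof clarify
  fix i j k l assume *: "1 \<le> i" "i < j" "j < k" "k < l" "l \<le> n"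
  have "pvar (i, j) * pvar (k, l) - pvar (i, k) * pvar (j, l) + pvar (i, l) * pvar (j, k) =
      Poly_Mapping.single (mexp {#(i, j), (k, l)#}) 1 + Poly_Mapping.single (mexp {#(i, k), (j, l)#}) (- 1)
      + Poly_Mapping.single (mexp {#(i, l), (j, k)#}) 1"
    by (simp add: pvar_mult_pvar single_uminus del: mexp_add_mset)
  also have "\<dots> \<in> carrier (plucker_ring n)"
    unfolding plucker_ring_def
    by (intro poly_ring_add_closed single_in_poly_ring)
      (use * in \<open>auto simp del: mexp_add_mset simp: plucker_idx_def\<close>)
  finally show "pvar (i, j) * pvar (k, l) - pvar (i, k) * pvar (j, l) + pvar (i, l) * pvar (j, k) \<in>
    carrier (plucker_ring n)" .
qed

lemma ideal_plucker_ideal: "ideal (plucker_ideal n) (plucker_ring n)"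
  unfolding plucker_ideal_def
  by (rule ring.genideal_ideal[OF _ plucker_generators_in_ring])
    (simp add: plucker_ring_def ring_poly_ring)

lemma plucker_ideal_subset: "plucker_ideal n \<subseteq> carrier (plucker_ring n)"
  using ideal_plucker_ideal ideal_poly_ringD(1) unfolding plucker_ring_def by blast

text \<open>Signs of the coefficients are left open. This makes the form of the relation invariant under all
  permutations of the four leaves.\<close>

definition three_term :: "nat \<Rightarrow> nat \<Rightarrow> nat \<Rightarrow> nat \<Rightarrow> complex \<Rightarrow> complex \<Rightarrow> complex \<Rightarrow> (nat \<times> nat) cpoly" where
  "three_term x y z w k1 k2 k3 = Poly_Mapping.single (mexp {#edge x y, edge z w#}) k1 +
     Poly_Mapping.single (mexp {#edge x z, edge y w#}) k2 +
     Poly_Mapping.single (mexp {#edge x w, edge y z#}) k3"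

lemma three_term_perm:
  "three_term x y z w k1 k2 k3 = three_term y x z w k1 k3 k2"
  "three_term x y z w k1 k2 k3 = three_term x z y w k2 k1 k3"
  "three_term x y z w k1 k2 k3 = three_term x y w z k1 k3 k2"
  by (simp_all add: three_term_def edge_commute ac_simps add_mset_commute
      del: mexp_add_mset)

lemma quadruple_wlog:
  fixes R :: "nat \<Rightarrow> nat \<Rightarrow> nat \<Rightarrow> nat \<Rightarrow> bool"
  assumes s1: "\<And>x y z w. R x y z w \<Longrightarrow> R y x z w"
    and s2: "\<And>x y z w. R x y z w \<Longrightarrow> R x z y w"
    and s3: "\<And>x y z w. R x y z w \<Longrightarrow> R x y w z"
    and sorted: "\<And>x y z w. x < y \<Longrightarrow> y < z \<Longrightarrow> z < w \<Longrightarrow> R x y z w"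
    and "distinct [x, y, z, w]"
  shows "R x y z w"
proof -
  have A: "R x y z w" if "y < z" "z < w" "x \<notin> {y, z, w}" for x y z w
  proof -
    have "x \<noteq> y" "x \<noteq> z" "x \<noteq> w" using that by auto
    then consider "x < y" | "y < x" "x < z" | "z < x" "x < w" | "w < x" by linarith
    then show ?thesis
    proof cases
      case 1
      then show ?thesis using sorted that by blast
    next
      case 2
      then show ?thesis using s1 sorted that by blast
    next
      case 3
      then have "R y z x w" using sorted that by blast
      then show ?thesis using s1 s2 by blast
    next
      case 4
      then have "R y z w x" using sorted that by blast
      then show ?thesis using s1 s2 s3 by blast
    qed
  qed
  have B: "R x y z w" if "z < w" "distinct [x, y, z, w]" for x y z w
  proof -
    have "y \<noteq> z" "y \<noteq> w" using that by auto
    then consider "y < z" | "z < y" "y < w" | "w < y" by linarith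
    then show ?thesis
    proof cases
      case 1
      then show ?thesis using A[of y z w x] that by auto
    next
      case 2
      then show ?thesis using A[of z y w x] that s2 by auto
    next
      case 3
      then have "R x z w y" using A[of z w y x] that by auto
      then show ?thesis using s2 s3 by blast
    qed
  qed
  show ?thesis
  proof (cases "z < w")
    case True
    then show ?thesis using B assms(5) by blast
  next
    case False
    then show ?thesis using B[of w z x y] s3 assms(5) by auto
  qed
qed

text \<open>The generators are these relations for sorted quadruples, and a permutation of the leaves only permutes
  the three pairings.\<close>

lemma plucker_relation:
  assumes "distinct [x, y, z, w]" "{x, y, z, w} \<subseteq> {1..n}"
  shows "\<exists>k1 k2 k3. k1 \<noteq> 0 \<and> k2 \<noteq> 0 \<and> k3 \<noteq> 0 \<and> three_term x y z w k1 k2 k3 \<in> plucker_ideal n"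
proof -
  define R where "R x y z w \<longleftrightarrow> ({x, y, z, w} \<subseteq> {1..n} \<longrightarrow>
    (\<exists>k1 k2 k3. k1 \<noteq> 0 \<and> k2 \<noteq> 0 \<and> k3 \<noteq> 0 \<and> three_term x y z w k1 k2 k3 \<in> plucker_ideal n))"
    for x y z w
  have "R x y z w"
  proof (rule quadruple_wlog[OF _ _ _ _ assms(1)])
    fix x y z w :: nat
    have set_eq: "{y, x, z, w} = {x, y, z, w}" "{x, z, y, w} = {x, y, z, w}" "{x, y, w, z} = {x, y, z, w}"
      by auto
    show "R y x z w" if "R x y z w"
      using that unfolding R_def set_eq three_term_perm(1)[of x y z w] by blast
    show "R x z y w" if "R x y z w"
      using that unfolding R_def set_eq three_term_perm(2)[of x y z w] by blast
    show "R x y w z" if "R x y z w"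
      using that unfolding R_def set_eq three_term_perm(3)[of x y z w] by blast
    show "R x y z w" if lt: "x < y" "y < z" "z < w"
      unfolding R_def
    proof
      assume range: "{x, y, z, w} \<subseteq> {1..n}"
      have "three_term x y z w 1 (- 1) 1 =
          pvar (x, y) * pvar (z, w) - pvar (x, z) * pvar (y, w) + pvar (x, w) * pvar (y, z)"
        using lt by (simp add: three_term_def pvar_mult_pvar single_uminus del: mexp_add_mset)
      also have "\<dots> \<in> plucker_ideal n"
        unfolding plucker_ideal_def
        by (rule subsetD[OF ring.genideal_self[OF _ plucker_generators_in_ring]])
          (use lt range in \<open>auto simp: plucker_ring_def ring_poly_ring\<close>)
      finally show "\<exists>k1 k2 k3. k1 \<noteq> 0 \<and> k2 \<noteq> 0 \<and> k3 \<noteq> 0 \<and> three_term x y z w k1 k2 k3 \<in> plucker_ideal n"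
        by (intro exI[of _ 1] exI[of _ "- 1"]) auto
    qed
  qed
  then show ?thesis using assms(2) by (simp add: R_def)
qed

lemma pairings_distinct:
  assumes "distinct [x, y, z, w]"
  shows "mexp {#edge x y, edge z w#} \<noteq> mexp {#edge x z, edge y w#}"
    "mexp {#edge x y, edge z w#} \<noteq> mexp {#edge x w, edge y z#}"
    "mexp {#edge x z, edge y w#} \<noteq> mexp {#edge x w, edge y z#}"
proof -
  have "edge x y \<notin># {#edge x z, edge y w#}" "edge x y \<notin># {#edge x w, edge y z#}"
    "edge x z \<notin># {#edge x w, edge y z#}"
    using assms by (auto simp: edge_eq_iff)
  then show "mexp {#edge x y, edge z w#} \<noteq> mexp {#edge x z, edge y w#}"
    "mexp {#edge x y, edge z w#} \<noteq> mexp {#edge x w, edge y z#}"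
    "mexp {#edge x z, edge y w#} \<noteq> mexp {#edge x w, edge y z#}"
    unfolding mexp_eq_iff by (metis union_single_eq_member add_mset_add_single union_iff)+
qed

lemma keys_three:
  assumes "m1 \<noteq> m2" "m1 \<noteq> m3" "m2 \<noteq> m3" "k1 \<noteq> 0" "k2 \<noteq> 0" "k3 \<noteq> (0 :: complex)"
  shows "Poly_Mapping.keys (Poly_Mapping.single m1 k1 + Poly_Mapping.single m2 k2 +
    Poly_Mapping.single m3 k3) = {m1, m2, m3}"
  using assms by (auto simp: in_keys_iff lookup_add lookup_single when_def split: if_splits)

lemma initial_part_three:
  assumes "m1 \<noteq> m2" "m1 \<noteq> m3" "m2 \<noteq> m3" "k1 \<noteq> 0" "k2 \<noteq> 0" "k3 \<noteq> (0 :: complex)"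
  shows "initial_part lt (Poly_Mapping.single m1 k1 + Poly_Mapping.single m2 k2 + Poly_Mapping.single m3 k3) =
    (if lt m1 m1 \<or> lt m2 m1 \<or> lt m3 m1 then 0 else Poly_Mapping.single m1 k1) +
    (if lt m1 m2 \<or> lt m2 m2 \<or> lt m3 m2 then 0 else Poly_Mapping.single m2 k2) +
    (if lt m1 m3 \<or> lt m2 m3 \<or> lt m3 m3 then 0 else Poly_Mapping.single m3 k3)"
proof (rule poly_mapping_eqI)
  fix m
  let ?f = "Poly_Mapping.single m1 k1 + Poly_Mapping.single m2 k2 + Poly_Mapping.single m3 k3"
  have coeff: "Poly_Mapping.lookup (initial_part lt ?f) m =
      (if lt m1 m \<or> lt m2 m \<or> lt m3 m then 0 else Poly_Mapping.lookup ?f m)" for m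
    by (simp add: lookup_initial_part keys_three[OF assms])
  note ne = assms(1-3) assms(1-3)[symmetric]
  consider "m = m1" | "m = m2" | "m = m3" | "m1 \<noteq> m" "m2 \<noteq> m" "m3 \<noteq> m" by blast
  then show "Poly_Mapping.lookup (initial_part lt ?f) m = Poly_Mapping.lookup (
    (if lt m1 m1 \<or> lt m2 m1 \<or> lt m3 m1 then 0 else Poly_Mapping.single m1 k1) +
    (if lt m1 m2 \<or> lt m2 m2 \<or> lt m3 m2 then 0 else Poly_Mapping.single m2 k2) +
    (if lt m1 m3 \<or> lt m2 m3 \<or> lt m3 m3 then 0 else Poly_Mapping.single m3 k3)) m"
    unfolding coeff by cases (simp_all add: ne lookup_add lookup_single)
qed

context iterated
begin

lemma eval_generator: "Q (i, j) * Q (k, l) - Q (i, k) * Q (j, l) + Q (i, l) * Q (j, k) = 0"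
  by (simp add: Q_def P_eq algebra_simps)

lemma plucker_ideal_eval: "f \<in> plucker_ideal n \<Longrightarrow> eval_poly Q f = 0"
proof -
  have diff: "eval_poly Q (f - g) = eval_poly Q f - eval_poly Q g" for f g
    using eval_poly_add[of Q "f - g" g] by (simp add: algebra_simps)
  let ?G = "{pvar (i, j) * pvar (k, l) - pvar (i, k) * pvar (j, l) + pvar (i, l) * pvar (j, k)
      | i j k l. 1 \<le> i \<and> i < j \<and> j < k \<and> k < l \<and> l \<le> n} :: (nat \<times> nat) cpoly set"
  have "eval_poly Q g = 0" if "g \<in> ?G" for g
    using that by (auto simp: eval_poly_add diff eval_poly_mult eval_generator)
  then have "?G \<subseteq> {f \<in> carrier (poly_ring (plucker_idx n)). eval_poly Q f = 0}"
    using plucker_generators_in_ring[of n] unfolding plucker_ring_def by blast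
  then have "plucker_ideal n \<subseteq> {f \<in> carrier (poly_ring (plucker_idx n)). eval_poly Q f = 0}"
    unfolding plucker_ideal_def plucker_ring_def
    by (rule ring.genideal_minimal[OF ring_poly_ring ideal_kernel_eval_poly])
  then show "eval_poly Q f = 0" if "f \<in> plucker_ideal n" using that by blast
qed

lemma ideal_toric_ideal: "ideal toric_ideal (plucker_ring n)"
  unfolding toric_ideal_def plucker_ring_def by (rule ideal_kernel_eval_poly)

end

context iterated_order
begin

definition initial_ideal :: "(nat \<times> nat) cpoly set" where
  "initial_ideal = Idl\<^bsub>plucker_ring n\<^esub> (initial_part (\<lambda>m m'. wt lv m \<lhd> wt lv m') ` plucker_ideal n)"

lemma initial_parts_in_toric_ideal:
  assumes "f \<in> plucker_ideal n"
  shows "initial_part (\<lambda>m m'. wt lv m \<lhd> wt lv m') f \<in> toric_ideal"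
proof -
  have f: "f \<in> carrier (poly_ring (plucker_idx n))"
    using assms plucker_ideal_subset unfolding plucker_ring_def by blast
  have "leads (lv p) (Q p)" if "m \<in> Poly_Mapping.keys f" "p \<in> Poly_Mapping.keys m" for m p
    using that f leads_Q(1) unfolding carrier_poly_ring by blast
  from initial_part_in_kernel[OF this plucker_ideal_eval[OF assms]] initial_part_closed[OF f]
  show ?thesis by (simp add: toric_ideal_def plucker_ring_def lc_def[abs_def])
qed

lemma initial_parts_in_ring:
  "initial_part (\<lambda>m m'. wt lv m \<lhd> wt lv m') ` plucker_ideal n \<subseteq> carrier (plucker_ring n)"
  using initial_parts_in_toric_ideal by (auto simp: toric_ideal_def)

lemma ideal_initial_ideal: "ideal initial_ideal (poly_ring (plucker_idx n))"
  using ring.genideal_ideal[OF _ initial_parts_in_ring]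
  by (simp add: initial_ideal_def plucker_ring_def ring_poly_ring)

lemma initial_part_in_initial_ideal:
  "f \<in> plucker_ideal n \<Longrightarrow> initial_part (\<lambda>m m'. wt lv m \<lhd> wt lv m') f \<in> initial_ideal"
  using ring.genideal_self[OF _ initial_parts_in_ring]
  by (auto simp: initial_ideal_def plucker_ring_def ring_poly_ring)

lemma initial_ideal_subset: "initial_ideal \<subseteq> toric_ideal"
  unfolding initial_ideal_def
  by (rule ring.genideal_minimal[OF _ ideal_toric_ideal])
    (use initial_parts_in_toric_ideal in \<open>auto simp: plucker_ring_def ring_poly_ring\<close>)

text \<open>Monomials scaled so that the monomial map sends them to monomials with coefficient 1. This removes the
  signs from the swaps.\<close>

definition normalised :: "(nat \<times> nat) multiset \<Rightarrow> (nat \<times> nat) cpoly" where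
  "normalised A = Poly_Mapping.single (mexp A) (1 / eval_mon lc (mexp A))"

lemma normalised_add: "normalised (A + B) = normalised A * normalised B"
  by (simp add: normalised_def mexp_add eval_mon_add mult_single)

lemma eval_mon_lc_nonzero: "set_mset A \<subseteq> plucker_idx n \<Longrightarrow> eval_mon lc (mexp A) \<noteq> 0"
  using leads_Q(2) by (auto simp: eval_mon_def)

text \<open>The order puts the pairing \<open>xy, zw\<close> above the two balanced pairings, so the initial part
  of the three-term relation consists of the balanced terms. Their coefficients are those of a difference of
  normalised monomials, up to a factor, since the initial part lies in the toric ideal.\<close>

lemma swap_in_initial_ideal:
  assumes "balanced n x y z w"
  shows "normalised {#edge x z, edge y w#} - normalised {#edge x w, edge y z#} \<in> initial_ideal"
proof -
  let ?m1 = "mexp {#edge x y, edge z w#}"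
  let ?m2 = "mexp {#edge x z, edge y w#}"
  let ?m3 = "mexp {#edge x w, edge y z#}"
  let ?g = "\<lambda>k2 k3. Poly_Mapping.single ?m2 k2 + Poly_Mapping.single ?m3 k3"
  have dist: "distinct [x, y, z, w]" and sub: "{x, y, z, w} \<subseteq> {1..n}"
    and eq: "vv x z + vv y w = vv x w + vv y z"
    using assms by (auto simp: balanced_def)
  obtain k1 k2 k3 where k: "k1 \<noteq> 0" "k2 \<noteq> 0" "k3 \<noteq> 0" and I: "three_term x y z w k1 k2 k3 \<in> plucker_ideal n"
    using plucker_relation[OF dist sub] by blast
  have wts: "wt lv ?m1 = vv x y + vv z w" "wt lv ?m2 = vv x z + vv y w" "wt lv ?m3 = vv x z + vv y w"
    using eq by (simp_all add: wt_mexp del: mexp_add_mset)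
  have less: "vv x z + vv y w \<lhd> vv x y + vv z w" by (rule balanced_less[OF dist sub eq])
  have "initial_part (\<lambda>m m'. wt lv m \<lhd> wt lv m') (three_term x y z w k1 k2 k3) = ?g k2 k3"
    unfolding three_term_def initial_part_three[OF pairings_distinct[OF dist] k] wts
    using less less_irrefl less_trans[OF less] by auto
  then have g: "?g k2 k3 \<in> initial_ideal" using initial_part_in_initial_ideal[OF I] by simp
  then have "eval_poly (monomial_map lv lc) (?g k2 k3) = 0"
    using initial_ideal_subset by (auto simp: toric_ideal_def)
  then have "Poly_Mapping.single (vv x z + vv y w) (k2 * eval_mon lc ?m2 + k3 * eval_mon lc ?m3) = 0"
    by (simp add: eval_poly_add eval_poly_single eval_mon_monomial_map wts mult_single single_add
        del: mexp_add_mset wt_mexp)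
  then have rel: "k2 * eval_mon lc ?m2 + k3 * eval_mon lc ?m3 = 0"
    by (metis lookup_single_eq lookup_zero)
  have ne: "eval_mon lc ?m2 \<noteq> 0" "eval_mon lc ?m3 \<noteq> 0"
    using dist sub by (auto intro!: eval_mon_lc_nonzero simp: edge_in_plucker_idx simp del: mexp_add_mset)
  have "normalised {#edge x z, edge y w#} - normalised {#edge x w, edge y z#} =
      Poly_Mapping.single 0 (1 / (k2 * eval_mon lc ?m2)) * ?g k2 k3"
  proof -
    have "k3 / (k2 * eval_mon lc ?m2) = - (1 / eval_mon lc ?m3)"
      using rel ne k by (simp add: field_simps eq_neg_iff_add_eq_0)
    then show ?thesis
      using k by (simp add: normalised_def distrib_left mult_single single_uminus del: mexp_add_mset)
  qed
  then show ?thesis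
    using ideal_poly_ringD(4)[OF ideal_initial_ideal g] by (simp add: single_in_poly_ring)
qed

lemma conn_in_initial_ideal:
  assumes "conn n A B" "set_mset A \<subseteq> plucker_idx n"
  shows "normalised A - normalised B \<in> initial_ideal"
  using assms(1)
proof induction
  case none
  show ?case using ideal_poly_ringD(2)[OF ideal_initial_ideal] by simp
next
  case (swap x z y w R)
  have "set_mset R \<subseteq> plucker_idx n" using conn_invariants(2)[OF swap(1) assms(2)] by simp
  then have R: "normalised R \<in> carrier (poly_ring (plucker_idx n))"
    by (simp add: normalised_def single_in_poly_ring)
  have "normalised A - normalised ({#edge x w, edge y z#} + R) =
      (normalised A - normalised ({#edge x z, edge y w#} + R)) +
      normalised R * (normalised {#edge x z, edge y w#} - normalised {#edge x w, edge y z#})"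
    unfolding normalised_add by (simp only: algebra_simps)
  also have "\<dots> \<in> initial_ideal"
    by (rule ideal_poly_ringD(3)[OF ideal_initial_ideal swap(3)
        ideal_poly_ringD(4)[OF ideal_initial_ideal swap_in_initial_ideal[OF swap(2)] R]])
  finally show ?case .
qed

text \<open>The right-hand side does not depend on the order. This is what identifies the initial ideals of
  different orders with each other.\<close>

theorem initial_ideal_eq_toric_ideal: "initial_ideal = toric_ideal"
proof
  show "initial_ideal \<subseteq> toric_ideal" by (rule initial_ideal_subset)
  show "toric_ideal \<subseteq> initial_ideal"
  proof
    fix f assume "f \<in> toric_ideal"
    then have f: "f \<in> carrier (poly_ring (plucker_idx n))" "eval_poly (monomial_map lv lc) f = 0"
      by (auto simp: toric_ideal_def plucker_ring_def)
    show "f \<in> initial_ideal"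
    proof (rule kernel_monomial_map_subset_ideal[OF ideal_initial_ideal leads_Q(2) _ f])
      fix m m' :: "nat \<times> nat \<Rightarrow>\<^sub>0 nat"
      assume *: "Poly_Mapping.keys m \<subseteq> plucker_idx n" "Poly_Mapping.keys m' \<subseteq> plucker_idx n"
        "wt lv m = wt lv m'"
      have "conn n (mset_of m) (mset_of m')"
        by (rule conn_fibre) (use n_ge * in \<open>auto simp: wt_def\<close>)
      from conn_in_initial_ideal[OF this] *(1)
      show "Poly_Mapping.single m (1 / eval_mon lc m) - Poly_Mapping.single m' (1 / eval_mon lc m')
          \<in> initial_ideal"
        by (simp add: normalised_def)
    qed
  qed
qed

end

section \<open>Tree metrics\<close>

definition sym_weight :: "weight \<Rightarrow> nat \<Rightarrow> nat \<Rightarrow> real" where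
  "sym_weight u x y = u (edge x y)"

lemma sym_weight_commute: "sym_weight u x y = sym_weight u y x"
  by (simp add: sym_weight_def edge_commute)

lemma sum_weight_mset:
  fixes g :: "'v \<Rightarrow> 'a::comm_semiring_1"
  assumes "finite V" "set_mset A \<subseteq> V"
  shows "(\<Sum>p\<in>V. g p * of_nat (count A p)) = (\<Sum>p\<in>#A. g p)"
  using assms(2)
proof (induction A)
  case (add q A)
  have "(\<Sum>p\<in>V. g p * of_nat (count (add_mset q A) p)) =
      (\<Sum>p\<in>V. (if p = q then g q else 0) + g p * of_nat (count A p))"
    by (rule sum.cong) (auto simp: algebra_simps)
  also have "\<dots> = g q + (\<Sum>p\<in>V. g p * of_nat (count A p))"
    using assms(1) add(2) by (simp add: sum.distrib)
  finally show ?case using add by simp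
qed simp

lemma w_mult_eq_wt:
  assumes "Poly_Mapping.keys m \<subseteq> plucker_idx n"
  shows "w_mult n u m = wt u m"
  using sum_weight_mset[of "plucker_idx n" "mset_of m" u] assms by (simp add: w_mult_def wt_def)

lemma init_form_w_eq: "init_form_w n u f = initial_part (\<lambda>m m'. w_mult n u m < w_mult n u m') f"
proof -
  have "w_mult n u m = Min (w_mult n u ` Poly_Mapping.keys f) \<longleftrightarrow>
      (\<forall>m'\<in>Poly_Mapping.keys f. \<not> w_mult n u m' < w_mult n u m)" if "m \<in> Poly_Mapping.keys f" for m
    using that by (subst eq_commute, subst Min_eq_iff) (auto simp: not_less)
  then show ?thesis
    unfolding init_form_w_def initial_part_def by (intro sum.cong) auto
qed

lemma initial_part_cong:
  assumes "\<And>m m'. m \<in> Poly_Mapping.keys f \<Longrightarrow> m' \<in> Poly_Mapping.keys f \<Longrightarrow> lt m m' \<longleftrightarrow> lt' m m'"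
  shows "initial_part lt f = initial_part lt' f"
  unfolding initial_part_def using assms by (intro sum.cong) auto

lemma wt_single [simp]: "wt v (Poly_Mapping.single p (Suc 0)) = v p"
  by (simp add: wt_def)

lemma wt_wt: "wt g (wt v m) = wt (\<lambda>p. wt g (v p)) m"
proof -
  have "wt g (\<Sum>p\<in>#A. v p) = (\<Sum>p\<in>#A. wt g (v p))" for A
    by (induction A) (auto simp: wt_add)
  then show ?thesis by (simp add: wt_def[of v] wt_def[of "\<lambda>p. wt g (v p)"])
qed

context iterated
begin

text \<open>The four-point condition for all splits of the tree at once. By definition it holds for
  \<open>u\<close> if \<open>u\<close> ranks the pairings of each quadruple as any order of the kind above
  does.\<close>

definition tree_metric :: "weight \<Rightarrow> bool" where
  "tree_metric u \<longleftrightarrow> (\<forall>x y z w. balanced n x y z w \<longrightarrow>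
    sym_weight u x z + sym_weight u y w = sym_weight u x w + sym_weight u y z \<and>
    sym_weight u x z + sym_weight u y w < sym_weight u x y + sym_weight u z w)"

lemma tree_metricD:
  assumes "tree_metric u" "balanced n x y z w"
  shows "sym_weight u x z + sym_weight u y w = sym_weight u x w + sym_weight u y z"
    "sym_weight u x z + sym_weight u y w < sym_weight u x y + sym_weight u z w"
  using assms unfolding tree_metric_def by blast+

text \<open>The one quadruple that decides between the two summands of \<open>P_rec\<close>.\<close>

lemma balanced_cherry:
  assumes l: "3 \<le> l" "l \<le> n" and k: "1 \<le> k" "k < l" "k \<noteq> ii l" "k \<noteq> jj l"
  shows "balanced n (ii l) l k (jj l)"
proof -
  have "V (ii l) k + V l (jj l) = V (ii l) (jj l) + V l k"
    using V_a[OF l k(2,3)] V_a[OF l, of "jj l"] roots[OF l] by (simp add: V_commute ac_simps)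
  then show ?thesis
    using vv_eq_iff[of "ii l" k l "jj l"] roots[OF l] l k by (auto simp: balanced_def)
qed

text \<open>The linear form on exponents is determined by \<open>u\<close> only up to weights of the leaves. This
  choice puts the weight of the pair of the leaves 1 and 2, whose minor is 1, on leaf 1.\<close>

definition coeff_s :: "weight \<Rightarrow> nat \<Rightarrow> real" where
  "coeff_s u l = (if l = 1 then sym_weight u 1 2 else 0)"

text \<open>The coefficients are forced level by level by the condition that \<open>vv x y\<close> has weight
  \<open>u x y\<close>: the coefficient of \<open>b l\<close> by the pair of \<open>ii l\<close> and
  \<open>l\<close>, that of \<open>a l\<close> by the pair of \<open>jj l\<close> and \<open>l\<close>. The
  arithmetic recovers \<open>l\<close> from the number of the variable.\<close>

definition exponent_weight :: "weight \<Rightarrow> nat \<Rightarrow> real" where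
  "exponent_weight u r =
    (if r > 2 * n then coeff_s u (r - 2 * n)
     else if odd r then let l = n - (r - 1) div 2 in
       sym_weight u (jj l) l - sym_weight u (jj l) (ii l) + coeff_s u (ii l)
     else let l = n - (r - 2) div 2 in
       sym_weight u (ii l) l - sym_weight u (ii l) (jj l) + coeff_s u (jj l))"

lemma exponent_weight:
  "1 \<le> l \<Longrightarrow> exponent_weight u (s l) = coeff_s u l"
  "3 \<le> l \<Longrightarrow> l \<le> n \<Longrightarrow> exponent_weight u (a l) =
    sym_weight u (jj l) l - sym_weight u (jj l) (ii l) + coeff_s u (ii l)"
  "3 \<le> l \<Longrightarrow> l \<le> n \<Longrightarrow> exponent_weight u (b l) =
    sym_weight u (ii l) l - sym_weight u (ii l) (jj l) + coeff_s u (jj l)"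
proof -
  show "exponent_weight u (s l) = coeff_s u l" if "1 \<le> l"
    using that by (simp add: exponent_weight_def s_def)
  show "exponent_weight u (a l) =
    sym_weight u (jj l) l - sym_weight u (jj l) (ii l) + coeff_s u (ii l)" if "3 \<le> l" "l \<le> n"
  proof -
    have "\<not> a l > 2 * n" "odd (a l)" "n - (a l - 1) div 2 = l" using that by (auto simp: a_def)
    then show ?thesis by (simp add: exponent_weight_def Let_def)
  qed
  show "exponent_weight u (b l) =
    sym_weight u (ii l) l - sym_weight u (ii l) (jj l) + coeff_s u (jj l)" if "3 \<le> l" "l \<le> n"
  proof -
    have "\<not> b l > 2 * n" "even (b l)" "n - (b l - 2) div 2 = l" using that by (auto simp: b_def)
    then show ?thesis by (simp add: exponent_weight_def Let_def)
  qed
qed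

text \<open>For the pairs of \<open>l\<close> with leaves other than \<open>ii l\<close> and \<open>jj l\<close>
  the coefficient of \<open>a l\<close> is right as well, by the equation of the four-point condition.\<close>

lemma wt_V:
  assumes "tree_metric u" "x \<noteq> y" "x \<in> {1..n}" "y \<in> {1..n}"
  shows "wt (exponent_weight u) (V x y) = sym_weight u x y - coeff_s u x - coeff_s u y"
  using assms(2-4)
proof (induction x y rule: V_induct)
  case (swap x y)
  then show ?case by (simp add: V_commute[of x y] sym_weight_commute[of u x y])
next
  case base
  show ?case by (simp add: V_base coeff_s_def)
next
  case (both l)
  then show ?case by (simp add: V_b wt_add exponent_weight coeff_s_def)
next
  case (left k l)
  have "wt (exponent_weight u) (V k l) = sym_weight u (jj l) l - sym_weight u (jj l) (ii l) +
      sym_weight u k (ii l) - coeff_s u k"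
    using left by (simp add: V_a wt_add exponent_weight)
  also have "\<dots> = sym_weight u k l - coeff_s u k"
  proof (cases "k = jj l")
    case True
    then show ?thesis by simp
  next
    case False
    from tree_metricD(1)[OF assms(1) balanced_cherry[OF left(1-5) False]]
    show ?thesis using sym_weight_commute by (simp add: algebra_simps)
  qed
  finally show ?case using left(1) by (simp add: coeff_s_def)
qed

text \<open>Written in terms of \<open>u\<close>, the preference for the \<open>a\<close>-term is the inequality of
  the four-point condition for the cherry.\<close>

lemma iterated_order_weight:
  assumes "tree_metric u"
  shows "iterated_order n ii jj (\<lambda>e e'. wt (exponent_weight u) e < wt (exponent_weight u) e')"
proof unfold_locales
  fix k l assume l: "3 \<le> l" "l \<le> n" and k: "1 \<le> k" "k < l" "k \<noteq> ii l" "k \<noteq> jj l"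
  note R = roots[OF l]
  note bal = tree_metricD[OF assms balanced_cherry[OF l k]]
  have "wt (exponent_weight u) (Poly_Mapping.single (a l) 1 + V k (ii l)) =
      wt (exponent_weight u) (V k l)"
    using V_a[OF l k(2,3)] by simp
  also have "\<dots> = sym_weight u k l - coeff_s u k"
    using wt_V[OF assms, of k l] k l by (simp add: coeff_s_def)
  also have "\<dots> < sym_weight u (ii l) l - sym_weight u (ii l) (jj l) + sym_weight u k (jj l) - coeff_s u k"
    using bal sym_weight_commute[of u] by (simp add: sym_weight_commute[of u l k])
  also have "\<dots> = wt (exponent_weight u) (Poly_Mapping.single (b l) 1 + V k (jj l))"
    using wt_V[OF assms, of k "jj l"] k l R by (simp add: wt_add exponent_weight)
  finally show "wt (exponent_weight u) (Poly_Mapping.single (a l) 1 + V k (ii l)) <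
    wt (exponent_weight u) (Poly_Mapping.single (b l) 1 + V k (jj l))" .
qed (auto simp: wt_add)

lemma wt_lv:
  assumes "tree_metric u" "p \<in> plucker_idx n"
  shows "wt (exponent_weight u) (lv p) = u p"
proof -
  obtain x y where p: "p = (x, y)" "x < y" "1 \<le> x" "y \<le> n" using assms(2) by (auto simp: plucker_idx_def)
  then show ?thesis
    using wt_V[OF assms(1), of x y] exponent_weight(1)
    by (simp add: lv_def vv_def wt_add sym_weight_def)
qed

theorem init_ideal_w_eq_toric_ideal:
  assumes "tree_metric u"
  shows "init_ideal_w n u (plucker_ideal n) = toric_ideal"
proof -
  interpret O: iterated_order n ii jj "\<lambda>e e'. wt (exponent_weight u) e < wt (exponent_weight u) e'"
    by (rule iterated_order_weight[OF assms])
  have "init_form_w n u f =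
      initial_part (\<lambda>m m'. wt (exponent_weight u) (wt lv m) < wt (exponent_weight u) (wt lv m')) f"
    if "f \<in> plucker_ideal n" for f
  proof -
    have w: "w_mult n u m = wt (exponent_weight u) (wt lv m)" if "m \<in> Poly_Mapping.keys f" for m
    proof -
      have m: "Poly_Mapping.keys m \<subseteq> plucker_idx n"
        using that subsetD[OF plucker_ideal_subset \<open>f \<in> plucker_ideal n\<close>]
        unfolding plucker_ring_def carrier_poly_ring by blast
      then have "image_mset u (mset_of m) = image_mset (\<lambda>p. wt (exponent_weight u) (lv p)) (mset_of m)"
        using wt_lv[OF assms] by (intro image_mset_cong) auto
      then show ?thesis unfolding w_mult_eq_wt[OF m] wt_wt by (simp add: wt_def)
    qed
    show ?thesis unfolding init_form_w_eq by (rule initial_part_cong) (simp add: w)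
  qed
  then have "init_ideal_w n u (plucker_ideal n) = O.initial_ideal"
    unfolding init_ideal_w_def O.initial_ideal_def by (metis (no_types, lifting) image_cong)
  then show ?thesis using O.initial_ideal_eq_toric_ideal by simp
qed

end

section \<open>The weighting matrix\<close>

lemma Psi_add: "Psi S (\<lambda>r. m r + m' r) = Psi S m + Psi S m'"
  by (simp add: Psi_def sum.distrib algebra_simps)

lemma prec_Psi_irrefl: "\<not> prec_Psi S m m"
  by (simp add: prec_Psi_def less_fun_irrefl)

lemma prec_Psi_trans: "prec_Psi S m m' \<Longrightarrow> prec_Psi S m' m'' \<Longrightarrow> prec_Psi S m m''"
  unfolding prec_Psi_def using less_fun_trans[of m'' m' m] by auto

lemma prec_Psi_add: "prec_Psi S m m' \<Longrightarrow> prec_Psi S (\<lambda>r. m r + c r) (\<lambda>r. m' r + c r)"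
  unfolding prec_Psi_def Psi_add less_fun_def by auto

lemma prec_Psi_total:
  assumes "finite {r. m r \<noteq> m' r}" "m \<noteq> m'"
  shows "prec_Psi S m m' \<or> prec_Psi S m' m"
  using less_fun_trichotomy[OF assms(1)] assms(2) unfolding prec_Psi_def by (meson linorder_neqE)

lemma min_Psi_eqI:
  assumes "m \<in> A" "\<And>m'. m' \<in> A \<Longrightarrow> m' \<noteq> m \<Longrightarrow> prec_Psi S m m'"
  shows "min_Psi S A = m"
  unfolding min_Psi_def
proof (rule the_equality)
  fix m' assume *: "m' \<in> A \<and> (\<forall>b\<in>A. b \<noteq> m' \<longrightarrow> prec_Psi S m' b)"
  show "m' = m"
  proof (rule ccontr)
    assume "m' \<noteq> m"
    then have "prec_Psi S m m'" "prec_Psi S m' m" using * assms by auto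
    then show False using prec_Psi_trans prec_Psi_irrefl by blast
  qed
qed (use assms in auto)

text \<open>On a finite set of integer vectors that agree almost everywhere the order is total, so its minimum
  exists and \<open>min_Psi\<close> is not a default value.\<close>

lemma min_Psi_iff:
  assumes "finite A" "m \<in> A" "\<And>m m'. m \<in> A \<Longrightarrow> m' \<in> A \<Longrightarrow> finite {r. m r \<noteq> m' r}"
  shows "m = min_Psi S A \<longleftrightarrow> (\<forall>m'\<in>A. \<not> prec_Psi S m' m)"
proof -
  have total: "prec_Psi S x y \<or> prec_Psi S y x" if "x \<in> A" "y \<in> A" "x \<noteq> y" for x y
    using prec_Psi_total[OF assms(3)[OF that(1,2)] that(3)] .
  have "\<exists>x\<in>B. \<forall>y\<in>B. y \<noteq> x \<longrightarrow> prec_Psi S x y" if "finite B" "B \<noteq> {}" "B \<subseteq> A" for B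
    using that
  proof (induction B rule: finite_ne_induct)
    case (insert z B)
    then obtain x where x: "x \<in> B" "\<forall>y\<in>B. y \<noteq> x \<longrightarrow> prec_Psi S x y" by auto
    consider "prec_Psi S x z" | "prec_Psi S z x"
      using total[of x z] x insert by auto
    then show ?case
    proof cases
      case 1
      then show ?thesis using x by auto
    next
      case 2
      then have "\<forall>y\<in>B. prec_Psi S z y" using x prec_Psi_trans by metis
      then show ?thesis by auto
    qed
  qed auto
  from this[of A] obtain x where x: "x \<in> A" "\<And>y. y \<in> A \<Longrightarrow> y \<noteq> x \<Longrightarrow> prec_Psi S x y"
    using assms(1,2) by blast
  have min: "min_Psi S A = x" using x by (rule min_Psi_eqI)
  show ?thesis
    unfolding min using x assms(2) prec_Psi_irrefl prec_Psi_trans by metis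
qed

context iterated
begin

text \<open>The vector \<open>M\<^sub>S m\<close> is the exponent of the leading monomial without the variables \<open>s k\<close>; the order
  \<open>\<prec>\<^sub>\<Psi>\<close> is applied to this part.\<close>

definition root_part :: "(nat \<Rightarrow>\<^sub>0 nat) \<Rightarrow> nat \<Rightarrow> int" where
  "root_part e r = (if r \<le> 2 * n then int (Poly_Mapping.lookup e r) else 0)"

lemma root_part_add: "root_part (e + e') = (\<lambda>r. root_part e r + root_part e' r)"
  by (auto simp: root_part_def lookup_add)

lemma Psi_root_part_add: "Psi S (root_part (e + e')) = Psi S (root_part e) + Psi S (root_part e')"
  unfolding root_part_add by (rule Psi_add)

lemma Psi_single:
  assumes "1 \<le> r" "r \<le> length S"
  shows "Psi S (root_part (Poly_Mapping.single r 1)) = int (height (S ! (r - 1)))"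
proof -
  have "Psi S (root_part (Poly_Mapping.single r 1)) =
      (\<Sum>r'=1..length S. if r' = r then int (height (S ! (r - 1))) else 0)"
    unfolding Psi_def
    by (rule sum.cong) (use length_S in \<open>auto simp: root_part_def lookup_single when_def\<close>)
  then show ?thesis using assms by simp
qed

lemma Psi_a_b:
  assumes "3 \<le> l" "l \<le> n"
  shows "Psi S (root_part (Poly_Mapping.single (a l) 1)) = int l - int (ii l)"
    "Psi S (root_part (Poly_Mapping.single (b l) 1)) = int l - int (jj l)"
  using Psi_single[of "a l"] Psi_single[of "b l"] nth_S[OF assms] roots[OF assms] assms length_S
  by (auto simp: a_def b_def height_def)

text \<open>All \<open>\<Psi>\<close>-values in \<open>P x y\<close> agree, because a root vector raises the sum of the indices by its
  height. The lexicographic order decides.\<close>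

lemma Psi_V:
  assumes "x \<noteq> y" "x \<in> {1..n}" "y \<in> {1..n}"
  shows "Psi S (root_part (V x y)) = int x + int y - 3"
  using assms
proof (induction x y rule: V_induct)
  case (swap x y)
  then show ?case by (simp add: V_commute[of x y])
next
  case base
  have "root_part 0 = (\<lambda>r. 0)" by (simp add: root_part_def fun_eq_iff)
  then show ?case by (simp add: V_base Psi_def)
next
  case (both l)
  then show ?case using Psi_a_b[OF both(1,2)] by (simp add: V_b Psi_root_part_add)
next
  case (left k l)
  then show ?case using Psi_a_b[OF left(1,2)] by (simp add: V_a Psi_root_part_add)
qed

text \<open>The two exponents have equal \<open>\<Psi>\<close>-values. Every variable before \<open>a l\<close> has
  exponent 0 in both, and only the first exponent contains \<open>a l\<close>, which makes it the smaller
  one.\<close>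

lemma iterated_order_Psi: "iterated_order n ii jj (\<lambda>e e'. prec_Psi S (root_part e) (root_part e'))"
proof unfold_locales
  fix k l assume l: "3 \<le> l" "l \<le> n" and k: "1 \<le> k" "k < l" "k \<noteq> ii l" "k \<noteq> jj l"
  let ?e = "Poly_Mapping.single (a l) 1 + V k (ii l)"
  let ?e' = "Poly_Mapping.single (b l) 1 + V k (jj l)"
  note R = roots[OF l]
  have "Psi S (root_part ?e) = Psi S (root_part ?e')"
    unfolding Psi_root_part_add Psi_a_b[OF l]
    using Psi_V[of k "ii l"] Psi_V[of k "jj l"] k R l by simp
  moreover have "less_fun (root_part ?e') (root_part ?e)"
  proof (rule less_funI, intro exI conjI allI impI)
    have zero: "Poly_Mapping.lookup (V k c) r = 0" if "c \<in> {ii l, jj l}" "r \<le> a l" for c r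
      using that k R l by (intro lookup_V_eq_zero[of k c l r]) (auto simp: a_def b_def)
    have "a l < b l" "a l \<le> 2 * n" using l by (auto simp: a_def b_def)
    then show "root_part ?e' (a l) < root_part ?e (a l)"
      using zero by (simp add: root_part_def lookup_add lookup_single)
    show "root_part ?e' r = root_part ?e r" if "r < a l" for r
      using zero[of _ r] that \<open>a l < b l\<close> by (simp add: root_part_def lookup_add lookup_single)
  qed
  ultimately show "prec_Psi S (root_part ?e) (root_part ?e')" by (simp add: prec_Psi_def)
next
  show "prec_Psi S (root_part (u + z)) (root_part (v + z))"
    if "prec_Psi S (root_part u) (root_part v)" for u v z
    using prec_Psi_add[OF that] by (simp add: root_part_add)
qed (use prec_Psi_irrefl prec_Psi_trans in blast)+

lemma val_S_eq:
  assumes "x \<noteq> y" "x \<in> {1..n}" "y \<in> {1..n}"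
  shows "val_S S (x, y) = (\<lambda>r. int (Poly_Mapping.lookup (V x y) r))"
proof -
  interpret O: iterated_order n ii jj "\<lambda>e e'. prec_Psi S (root_part e) (root_part e')"
    by (rule iterated_order_Psi)
  let ?g = "\<lambda>m r. int (Poly_Mapping.lookup m r)"
  have prec: "prec_Psi S (?g e) (?g e')" if "prec_Psi S (root_part e) (root_part e')" for e e'
  proof -
    have "Psi S (?g e) = Psi S (root_part e)" for e
      unfolding Psi_def using length_S by (intro sum.cong) (auto simp: root_part_def)
    moreover have "less_fun (?g e') (?g e)" if lex: "less_fun (root_part e') (root_part e)"
    proof -
      obtain k where k: "root_part e' k < root_part e k" "\<And>r. r < k \<Longrightarrow> root_part e' r = root_part e r"
        using lex by (rule less_funE) blast
      have "k \<le> 2 * n" using k(1) by (simp add: root_part_def split: if_splits)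
      then have "?g e' k < ?g e k" "?g e' r = ?g e r" if "r < k" for r
        using k(1) k(2)[OF that] that by (simp_all add: root_part_def)
      moreover have "?g e' k < ?g e k" using k(1) \<open>k \<le> 2 * n\<close> by (simp add: root_part_def)
      ultimately show ?thesis unfolding less_fun_def by blast
    qed
    ultimately show ?thesis using that by (auto simp: prec_Psi_def)
  qed
  note P = O.leads_P[OF assms]
  have "V x y \<in> Poly_Mapping.keys (P x y)" using P by (simp add: in_keys_iff)
  moreover have "prec_Psi S (?g (V x y)) (?g e)" if "e \<in> Poly_Mapping.keys (P x y)" "e \<noteq> V x y" for e
    using P that prec by (auto simp: O.leads_def)
  ultimately show ?thesis
    unfolding val_S_def P_def[symmetric] by (intro min_Psi_eqI) auto
qed

lemma M_mult_eq:
  assumes "Poly_Mapping.keys m \<subseteq> plucker_idx n"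
  shows "M_mult n S m = root_part (wt lv m)"
proof
  fix r
  have root_part_wt: "root_part (\<Sum>p\<in>#A. lv p) r = (\<Sum>p\<in>#A. root_part (lv p) r)" for A
    by (induction A) (auto simp: root_part_add, simp add: root_part_def)
  have val: "val_S S p r = root_part (lv p) r" if idx: "p \<in> plucker_idx n" for p
  proof -
    obtain x y where p: "p = (x, y)" "x \<noteq> y" "x \<in> {1..n}" "y \<in> {1..n}"
      using idx by (auto simp: plucker_idx_def)
    have V: "Poly_Mapping.lookup (V x y) r = 0" if "\<not> r \<le> 2 * n"
      using keys_V[OF p(2-4), of r n] that p(3,4) by (auto simp: not_in_keys_iff_lookup_eq_zero[symmetric])
    have "Poly_Mapping.lookup (lv p) r = Poly_Mapping.lookup (V x y) r" if "r \<le> 2 * n"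
      using that p by (simp add: lv_def vv_def lookup_add lookup_single s_def when_def)
    then show ?thesis
      using val_S_eq[OF p(2-4)] V p(1) by (simp add: root_part_def)
  qed
  have "M_mult n S m r = (\<Sum>p\<in>plucker_idx n. val_S S p r * of_nat (count (mset_of m) p))"
    by (simp add: M_mult_def M_mat_def)
  also have "\<dots> = (\<Sum>p\<in>#mset_of m. val_S S p r)"
    by (rule sum_weight_mset) (use assms in simp_all)
  also have "image_mset (\<lambda>p. val_S S p r) (mset_of m) = image_mset (\<lambda>p. root_part (lv p) r) (mset_of m)"
    by (rule image_mset_cong) (use assms val in auto)
  finally show "M_mult n S m r = root_part (wt lv m) r"
    by (simp add: root_part_wt wt_def)
qed

theorem init_ideal_M_eq_toric_ideal: "init_ideal_M n S (plucker_ideal n) = toric_ideal"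
proof -
  interpret O: iterated_order n ii jj "\<lambda>e e'. prec_Psi S (root_part e) (root_part e')"
    by (rule iterated_order_Psi)
  have "init_form_M n S f =
      initial_part (\<lambda>m m'. prec_Psi S (root_part (wt lv m)) (root_part (wt lv m'))) f"
    if "f \<in> plucker_ideal n" for f
  proof -
    have M: "M_mult n S m = root_part (wt lv m)" if "m \<in> Poly_Mapping.keys f" for m
      using that subsetD[OF plucker_ideal_subset \<open>f \<in> plucker_ideal n\<close>]
      unfolding plucker_ring_def carrier_poly_ring by (intro M_mult_eq) blast
    have "M_mult n S m = min_Psi S (M_mult n S ` Poly_Mapping.keys f) \<longleftrightarrow>
        (\<forall>m'\<in>Poly_Mapping.keys f. \<not> prec_Psi S (M_mult n S m') (M_mult n S m))"
      if "m \<in> Poly_Mapping.keys f" for m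
    proof (subst min_Psi_iff)
      show "finite {r. m r \<noteq> m' r}" if "m \<in> M_mult n S ` Poly_Mapping.keys f"
        "m' \<in> M_mult n S ` Poly_Mapping.keys f" for m m'
        by (rule finite_subset[of _ "{..2 * n}"]) (use that M in \<open>auto simp: root_part_def split: if_splits\<close>)
    qed (use that in auto)
    then have "init_form_M n S f = initial_part (\<lambda>m m'. prec_Psi S (M_mult n S m) (M_mult n S m')) f"
      unfolding init_form_M_def initial_part_def by (intro sum.cong) auto
    also have "\<dots> = initial_part (\<lambda>m m'. prec_Psi S (root_part (wt lv m)) (root_part (wt lv m'))) f"
      by (rule initial_part_cong) (simp add: M)
    finally show ?thesis .
  qed
  then have "init_ideal_M n S (plucker_ideal n) = O.initial_ideal"
    unfolding init_ideal_M_def O.initial_ideal_def by (metis (no_types, lifting) image_cong)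
  then show ?thesis using O.initial_ideal_eq_toric_ideal by simp
qed

end

section \<open>The tree of an iterated sequence\<close>

abbreviation walk :: "vertex set set \<Rightarrow> vertex list \<Rightarrow> bool" where
  "walk E \<equiv> successively (\<lambda>u v. {u, v} \<in> E)"

definition inner_path :: "vertex set set \<Rightarrow> nat \<Rightarrow> nat \<Rightarrow> nat list \<Rightarrow> bool" where
  "inner_path E x y qs \<longleftrightarrow> distinct qs \<and> walk E (Leaf x # map Inner qs @ [Leaf y])"

definition leaf_tree :: "nat \<Rightarrow> vertex set set \<Rightarrow> bool" where
  "leaf_tree L E \<longleftrightarrow> (\<forall>e\<in>E. e \<subseteq> Leaf ` {1..L} \<union> Inner ` {3..L}) \<and>
    (\<forall>x v. {v, Leaf x} \<in> E \<longrightarrow> v \<in> range Inner) \<and>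
    (\<forall>x u v. {u, Leaf x} \<in> E \<longrightarrow> {v, Leaf x} \<in> E \<longrightarrow> u = v)"

lemma leaf_treeD:
  assumes "leaf_tree L E"
  shows "e \<in> E \<Longrightarrow> Leaf x \<in> e \<Longrightarrow> x \<in> {1..L}" "e \<in> E \<Longrightarrow> Inner x \<in> e \<Longrightarrow> x \<in> {3..L}"
    "{v, Leaf x} \<in> E \<Longrightarrow> v \<in> range Inner" "{u, Leaf x} \<in> E \<Longrightarrow> {v, Leaf x} \<in> E \<Longrightarrow> u = v"
  using assms unfolding leaf_tree_def by blast+

lemma inner_path_rev: "inner_path E x y qs \<longleftrightarrow> inner_path E y x (rev qs)"
proof -
  have "Leaf y # map Inner (rev qs) @ [Leaf x] = rev (Leaf x # map Inner qs @ [Leaf y])"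
    by (simp add: rev_map)
  then show ?thesis
    unfolding inner_path_def by (simp only: successively_rev distinct_rev insert_commute)
qed

text \<open>Leaves are pendant, so a path between two leaves has no leaf in its interior.\<close>

lemma is_path_iff_inner_path:
  assumes E: "leaf_tree L E" and "x \<noteq> y"
  shows "is_path E (Leaf x) (Leaf y) ps \<longleftrightarrow>
    (\<exists>qs. ps = Leaf x # map Inner qs @ [Leaf y] \<and> inner_path E x y qs)"
proof
  assume path: "is_path E (Leaf x) (Leaf y) ps"
  then have hd: "ps \<noteq> []" "hd ps = Leaf x" "last ps = Leaf y" "distinct ps" and walk: "walk E ps"
    by (auto simp: is_path_def successively_conv_nth)
  obtain ps' where ps': "ps = Leaf x # ps'" using hd by (cases ps) auto
  then have "ps' \<noteq> []" "last ps' = Leaf y" using hd assms(2) by (auto split: if_splits)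
  then obtain ms where ps: "ps = Leaf x # ms @ [Leaf y]"
    using ps' by (metis append_butlast_last_id)
  have "m \<in> range Inner" if m: "m \<in> set ms" for m
  proof (cases m)
    case (Leaf z)
    obtain as bs where ms: "ms = as @ Leaf z # bs" using split_list[of "Leaf z" ms] m Leaf by blast
    let ?u = "last (Leaf x # as)" and ?v = "hd (bs @ [Leaf y])"
    have "walk E ((Leaf x # as) @ Leaf z # (bs @ [Leaf y]))" using walk ps ms by simp
    then have "{?u, Leaf z} \<in> E" "{Leaf z, ?v} \<in> E"
      unfolding successively_append_iff successively_Cons[of _ "Leaf z"] by auto
    then have "?u = ?v" using leaf_treeD(4)[OF E] by (metis insert_commute)
    moreover have "?u \<in> set (Leaf x # as)" "?v \<in> set (bs @ [Leaf y])"
      using last_in_set[of "Leaf x # as"] hd_in_set[of "bs @ [Leaf y]"] by auto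
    moreover have "distinct ((Leaf x # as) @ Leaf z # (bs @ [Leaf y]))" using hd(4) ps ms by simp
    then have "set (Leaf x # as) \<inter> set (bs @ [Leaf y]) = {}"
      unfolding distinct_append by simp
    ultimately have False by (metis disjoint_iff)
    then show ?thesis ..
  qed auto
  then obtain qs where "ms = map Inner qs" using ex_map_conv[of ms Inner] by blast
  then show "\<exists>qs. ps = Leaf x # map Inner qs @ [Leaf y] \<and> inner_path E x y qs"
    using ps walk hd(4) by (auto simp: inner_path_def distinct_map)
next
  assume "\<exists>qs. ps = Leaf x # map Inner qs @ [Leaf y] \<and> inner_path E x y qs"
  then obtain qs where ps: "ps = Leaf x # map Inner qs @ [Leaf y]" "inner_path E x y qs" by blast
  then have "distinct ps" using assms(2) by (auto simp: inner_path_def distinct_map inj_on_def)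
  moreover have "walk E ps" using ps by (simp add: inner_path_def)
  ultimately show "is_path E (Leaf x) (Leaf y) ps"
    using ps(1) by (simp add: is_path_def successively_conv_nth)
qed

text \<open>The edges at the two end leaves are not internal, and the remaining edges join consecutive inner
  vertices.\<close>

lemma card_internal_edges_on:
  assumes "distinct qs"
  shows "card (internal_edges_on (Leaf x # map Inner qs @ [Leaf y])) = length qs - 1"
proof -
  let ?ps = "Leaf x # map Inner qs @ [Leaf y]"
  let ?f = "\<lambda>r. {Inner (qs ! r), Inner (qs ! Suc r)}"
  have nth: "?ps ! Suc r = (if r < length qs then Inner (qs ! r) else Leaf y)" if "Suc r < length ?ps" for r
    using that by (auto simp: nth_append less_Suc_eq)
  have "internal_edges_on ?ps = ?f ` {r. Suc r < length qs}"
  proof (intro equalityI subsetI)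
    fix e assume "e \<in> internal_edges_on ?ps"
    then obtain r where r: "e = {?ps ! r, ?ps ! Suc r}" "Suc r < length ?ps"
      "?ps ! r \<in> range Inner" "?ps ! Suc r \<in> range Inner"
      by (auto simp: internal_edges_on_def)
    then obtain r' where r': "r = Suc r'" by (cases r) auto
    then show "e \<in> ?f ` {r. Suc r < length qs}"
      using r nth[of r] nth[of r'] by (auto split: if_splits)
  next
    fix e assume "e \<in> ?f ` {r. Suc r < length qs}"
    then obtain r where r: "Suc r < length qs" "e = ?f r" by auto
    then have "e = {?ps ! Suc r, ?ps ! Suc (Suc r)} \<and> Suc (Suc r) < length ?ps \<and>
        ?ps ! Suc r \<in> range Inner \<and> ?ps ! Suc (Suc r) \<in> range Inner"
      using nth[of r] nth[of "Suc r"] by simp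
    then show "e \<in> internal_edges_on ?ps" unfolding internal_edges_on_def by blast
  qed
  moreover have "inj_on ?f {r. Suc r < length qs}"
    using assms by (auto simp: inj_on_def doubleton_eq_iff nth_eq_iff_index_eq)
  moreover have "{r. Suc r < length qs} = {..<length qs - 1}" by auto
  ultimately show ?thesis by (simp add: card_image)
qed

lemma leaf_tree_tripod: "leaf_tree 3 tripod"
  unfolding leaf_tree_def tripod_def by (auto simp: doubleton_eq_iff)

lemma inner_path_tripod:
  assumes "x \<in> {1..3}" "y \<in> {1..3}" "x \<noteq> y"
  shows "inner_path tripod x y qs \<longleftrightarrow> qs = [3]"
proof -
  have edge: "{u, v} \<in> tripod \<longleftrightarrow> (u = Inner 3 \<and> v \<in> Leaf ` {1..3}) \<or> (v = Inner 3 \<and> u \<in> Leaf ` {1..3})"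
    for u v
    by (auto simp: tripod_def doubleton_eq_iff)
  show ?thesis
  proof
    assume path: "inner_path tripod x y qs"
    show "qs = [3]"
    proof (cases qs rule: remdups_adj.cases)
      case 1
      then show ?thesis using path by (auto simp: inner_path_def edge)
    next
      case (2 q)
      then show ?thesis using path by (auto simp: inner_path_def edge)
    next
      case (3 q q' qs')
      then show ?thesis using path by (auto simp: inner_path_def edge)
    qed
  next
    assume "qs = [3]"
    then show "inner_path tripod x y qs" using assms by (auto simp: inner_path_def edge)
  qed
qed

context
  fixes L i k E E'
  assumes E: "leaf_tree L E" and i: "i \<in> {1..L}" and k: "k = Suc L" "3 \<le> L"
    and E': "E' = attach_cherry i k E"
begin

lemma edge_attach_cherry:
  "{u, v} \<in> E' \<longleftrightarrow> {u, v} \<in> E \<and> u \<noteq> Leaf i \<and> v \<noteq> Leaf i \<or> v = Inner k \<and> {u, Leaf i} \<in> E \<or>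
    u = Inner k \<and> {v, Leaf i} \<in> E \<or> {u, v} = {Inner k, Leaf i} \<or> {u, v} = {Inner k, Leaf k}"
  unfolding E' attach_cherry_def by (auto simp: doubleton_eq_iff)

lemma new_vertices: "{u, Inner k} \<notin> E" "{Inner k, u} \<notin> E" "{u, Leaf k} \<notin> E" "{Leaf k, u} \<notin> E"
  using leaf_treeD(1,2)[OF E] k by fastforce+

lemma leaf_tree_attach_cherry: "leaf_tree k E'"
  unfolding leaf_tree_def
proof (intro conjI ballI allI impI)
  fix e assume "e \<in> E'"
  then consider "e \<in> E" | v where "e = {v, Inner k}" "{v, Leaf i} \<in> E" | "e = {Inner k, Leaf i}"
    | "e = {Inner k, Leaf k}"
    unfolding E' attach_cherry_def by blast
  then show "e \<subseteq> Leaf ` {1..k} \<union> Inner ` {3..k}"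
  proof cases
    case 1
    then have "e \<subseteq> Leaf ` {1..L} \<union> Inner ` {3..L}" using E by (simp add: leaf_tree_def)
    moreover have "Leaf ` {1..L} \<subseteq> Leaf ` {1..k}" "Inner ` {3..L} \<subseteq> Inner ` {3..k}"
      using k by (auto intro!: image_mono)
    ultimately show ?thesis by blast
  next
    case 2
    then obtain q where "v = Inner q" using leaf_treeD(3)[OF E] by blast
    then show ?thesis using 2 leaf_treeD(2)[OF E 2(2), of q] k by auto
  qed (use i k in auto)
next
  fix x v assume "{v, Leaf x} \<in> E'"
  then show "v \<in> range Inner"
    unfolding edge_attach_cherry using leaf_treeD(3)[OF E] by (auto simp: doubleton_eq_iff)
next
  fix x u v assume "{u, Leaf x} \<in> E'" "{v, Leaf x} \<in> E'"
  then show "u = v"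
    unfolding edge_attach_cherry
    using leaf_treeD(4)[OF E] leaf_treeD(3)[OF E, of "Leaf x" i] new_vertices
    by (auto simp: doubleton_eq_iff)
qed

lemma old_edge:
  "u \<notin> {Leaf i, Leaf k, Inner k} \<Longrightarrow> v \<notin> {Leaf i, Leaf k, Inner k} \<Longrightarrow> {u, v} \<in> E' \<longleftrightarrow> {u, v} \<in> E"
  unfolding edge_attach_cherry by (auto simp: doubleton_eq_iff)

lemma new_edge: "u \<notin> {Leaf i, Leaf k, Inner k} \<Longrightarrow> {u, Inner k} \<in> E' \<longleftrightarrow> {u, Leaf i} \<in> E"
  unfolding edge_attach_cherry using new_vertices by (auto simp: doubleton_eq_iff)

lemma cherry_edge: "y \<in> {i, k} \<Longrightarrow> {Inner q, Leaf y} \<in> E' \<longleftrightarrow> q = k"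
  unfolding edge_attach_cherry
  using new_vertices leaf_treeD(3)[OF E, of "Leaf y" i] by (auto simp: doubleton_eq_iff)

lemma inner_path_avoids:
  assumes "inner_path E x y qs"
  shows "k \<notin> set qs"
proof
  assume "k \<in> set qs"
  then obtain as bs where qs: "qs = as @ k # bs" using split_list[of k qs] by blast
  then have "walk E ((Leaf x # map Inner as) @ Inner k # (map Inner bs @ [Leaf y]))"
    using assms by (simp add: inner_path_def)
  then have "{Inner k, hd (map Inner bs @ [Leaf y])} \<in> E"
    unfolding successively_append_iff successively_Cons[of _ "Inner k"] by auto
  then show False using new_vertices by blast
qed

text \<open>A path between old leaves cannot visit the new vertex \<open>Inner k\<close>: the only neighbour it
  could use there, for entering and for leaving, is the former neighbour of leaf \<open>i\<close>.\<close>

lemma inner_path_old: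
  assumes x: "x \<in> {1..L} - {i}" and y: "y \<in> {1..L} - {i}"
  shows "inner_path E' x y qs \<longleftrightarrow> inner_path E x y qs"
proof -
  have iff: "inner_path E' x y qs \<longleftrightarrow> inner_path E x y qs" if "k \<notin> set qs"
  proof -
    have "walk E' (Leaf x # map Inner qs @ [Leaf y]) \<longleftrightarrow> walk E (Leaf x # map Inner qs @ [Leaf y])"
      by (intro successively_cong HOL.refl old_edge) (use that x y k in auto)
    then show ?thesis by (simp add: inner_path_def)
  qed
  have "k \<notin> set qs" if path: "inner_path E' x y qs"
  proof
    assume "k \<in> set qs"
    then obtain as bs where qs: "qs = as @ k # bs" using split_list[of k qs] by blast
    let ?u = "last (Leaf x # map Inner as)" and ?v = "hd (map Inner bs @ [Leaf y])"
    have "walk E' ((Leaf x # map Inner as) @ Inner k # (map Inner bs @ [Leaf y]))"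
      using path qs by (simp add: inner_path_def)
    then have "{?u, Inner k} \<in> E'" "{Inner k, ?v} \<in> E'"
      unfolding successively_append_iff successively_Cons[of _ "Inner k"] by auto
    moreover have u: "?u \<in> set (Leaf x # map Inner as)" and v: "?v \<in> set (map Inner bs @ [Leaf y])"
      using last_in_set[of "Leaf x # map Inner as"] hd_in_set[of "map Inner bs @ [Leaf y]"] by auto
    moreover have "k \<notin> set as" "k \<notin> set bs" "set as \<inter> set bs = {}"
      using path qs by (auto simp: inner_path_def)
    moreover have "?u \<notin> {Leaf i, Leaf k, Inner k}" "?v \<notin> {Leaf i, Leaf k, Inner k}"
      using u v x y k \<open>k \<notin> set as\<close> \<open>k \<notin> set bs\<close> by fastforce+
    ultimately have uv: "{?u, Leaf i} \<in> E" "{?v, Leaf i} \<in> E"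
      using new_edge[of ?u] new_edge[of ?v] by (simp_all add: insert_commute)
    then have "?u = ?v" "?u \<in> range Inner" using leaf_treeD(3,4)[OF E] by blast+
    then show False using u v \<open>set as \<inter> set bs = {}\<close> by auto
  qed
  then show ?thesis using iff inner_path_avoids by blast
qed

text \<open>A path into the cherry ends with \<open>Inner k\<close>. Without this vertex it is a path to leaf
  \<open>i\<close> in the old tree.\<close>

lemma inner_path_to_cherry:
  assumes x: "x \<in> {1..L} - {i}" and y: "y \<in> {i, k}"
  shows "inner_path E' x y qs \<longleftrightarrow> (\<exists>qs'. qs = qs' @ [k] \<and> inner_path E x i qs')"
proof -
  have iff: "inner_path E' x y (qs' @ [k]) \<longleftrightarrow> inner_path E x i qs'" if "k \<notin> set qs'" for qs'
  proof -
    have avoid: "u \<notin> {Leaf i, Leaf k, Inner k}" if "u \<in> set (Leaf x # map Inner qs')" for u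
      using that x k \<open>k \<notin> set qs'\<close> by auto
    have "walk E' (Leaf x # map Inner qs') \<longleftrightarrow> walk E (Leaf x # map Inner qs')"
      by (intro successively_cong HOL.refl old_edge avoid)
    moreover have "{last (Leaf x # map Inner qs'), Inner k} \<in> E' \<longleftrightarrow>
        {last (Leaf x # map Inner qs'), Leaf i} \<in> E"
      by (intro new_edge avoid last_in_set) simp
    moreover have "{Inner k, Leaf y} \<in> E'" using cherry_edge[OF y] by simp
    moreover have eq: "Leaf x # map Inner (qs' @ [k]) @ [Leaf y] = (Leaf x # map Inner qs') @ [Inner k, Leaf y]"
      "Leaf x # map Inner qs' @ [Leaf i] = (Leaf x # map Inner qs') @ [Leaf i]"
      by simp_all
    ultimately show ?thesis
      unfolding inner_path_def eq successively_append_iff using that by simp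
  qed
  have "\<exists>qs'. qs = qs' @ [k] \<and> k \<notin> set qs'" if path: "inner_path E' x y qs"
  proof (cases qs rule: rev_cases)
    case Nil
    then have "{Leaf x, Leaf y} \<in> E'" using path by (simp add: inner_path_def)
    then show ?thesis using leaf_treeD(3)[OF leaf_tree_attach_cherry] by blast
  next
    case (snoc qs' q)
    then have "walk E' ((Leaf x # map Inner qs') @ [Inner q, Leaf y])"
      using path by (simp add: inner_path_def)
    then have "{Inner q, Leaf y} \<in> E'" unfolding successively_append_iff by simp
    then have "q = k" using cherry_edge[OF y] by simp
    then show ?thesis using snoc path by (auto simp: inner_path_def)
  qed
  then show ?thesis using iff inner_path_avoids by blast
qed

lemma inner_path_cherry: "inner_path E' i k qs \<longleftrightarrow> qs = [k]"
proof
  assume path: "inner_path E' i k qs"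
  have "qs \<noteq> []"
  proof
    assume "qs = []"
    then have "{Leaf i, Leaf k} \<in> E'" using path by (simp add: inner_path_def)
    then show False using leaf_treeD(3)[OF leaf_tree_attach_cherry] by blast
  qed
  then obtain q qs' where qs: "qs = q # qs'" by (cases qs) auto
  then have "{Inner q, Leaf i} \<in> E'" using path by (simp add: inner_path_def insert_commute)
  then have "q = k" using cherry_edge[of i q] by simp
  show "qs = [k]"
  proof (cases qs' rule: rev_cases)
    case Nil
    then show ?thesis using qs \<open>q = k\<close> by simp
  next
    case (snoc rs r)
    have "walk E' ((Leaf i # map Inner (q # rs)) @ [Inner r, Leaf k])"
      using path qs snoc by (simp add: inner_path_def)
    then have "{Inner r, Leaf k} \<in> E'" unfolding successively_append_iff by simp
    then have "r = k" using cherry_edge[of k r] by simp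
    then show ?thesis using path qs snoc \<open>q = k\<close> by (simp add: inner_path_def)
  qed
next
  assume "qs = [k]"
  then show "inner_path E' i k qs"
    using cherry_edge[of i k] cherry_edge[of k k] by (simp add: inner_path_def insert_commute)
qed

end

context iterated
begin

text \<open>The number of internal edges between two distinct leaves of the tree with leaves \<open>1, \<dots>,
  L\<close>. Attaching a cherry turns the edge at the old leaf into an internal edge, which lengthens every path
  into the cherry by one.\<close>

primrec tdist :: "nat \<Rightarrow> nat \<Rightarrow> nat \<Rightarrow> nat" where
  "tdist 0 x y = 0"
| "tdist (Suc L) x y = (if Suc L \<le> 3 \<or> {x, y} = {ii (Suc L), Suc L} then 0
     else tdist L (sub_leaf (Suc L) x) (sub_leaf (Suc L) y) +
       (of_bool (x \<in> {ii (Suc L), Suc L}) + of_bool (y \<in> {ii (Suc L), Suc L})))"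

lemma tdist_commute: "tdist L x y = tdist L y x"
  by (induction L arbitrary: x y) (auto simp: insert_commute)

definition tree_at :: "nat \<Rightarrow> vertex set set" where
  "tree_at L = fold (\<lambda>k. attach_cherry (ii k) k) [4..<Suc L] tripod"

lemma tree_of_eq: "tree_of n S = tree_at n"
  unfolding tree_of_def tree_at_def
proof (rule fold_cong)
  fix k assume "k \<in> set [4..<Suc n]"
  then have k: "3 \<le> k" "k \<le> n" by auto
  show "attach_cherry (fst (S ! (2 * (n - k)))) k = attach_cherry (ii k) k"
    using nth_S(1)[OF k] by (simp add: a_def)
qed auto

text \<open>Uniqueness of the paths has to be part of the induction, since \<open>tree_weight\<close> refers to the
  path by a definite description.\<close>

lemma tree_at_paths:
  assumes "3 \<le> L" "L \<le> n"
  shows "leaf_tree L (tree_at L) \<and> (\<forall>x\<in>{1..L}. \<forall>y\<in>{1..L}. x \<noteq> y \<longrightarrow>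
    (\<exists>qs. (\<forall>qs'. inner_path (tree_at L) x y qs' \<longleftrightarrow> qs' = qs) \<and> length qs = Suc (tdist L x y)))"
  using assms
proof (induction L rule: dec_induct)
  case base
  have "tree_at 3 = tripod" by (simp add: tree_at_def)
  moreover have "tdist 3 x y = 0" for x y by (simp add: numeral_3_eq_3)
  ultimately show ?case using leaf_tree_tripod inner_path_tripod by (intro conjI ballI impI exI[of _ "[3]"]) auto
next
  case (step L)
  let ?k = "Suc L" let ?i = "ii ?k"
  have k: "3 \<le> ?k" "?k \<le> n" using step by auto
  note R = roots[OF k]
  have IH: "leaf_tree L (tree_at L)"
    "\<And>x y. x \<in> {1..L} \<Longrightarrow> y \<in> {1..L} \<Longrightarrow> x \<noteq> y \<Longrightarrow> \<exists>qs. (\<forall>qs'. inner_path (tree_at L) x y qs' \<longleftrightarrow> qs' = qs) \<and>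
      length qs = Suc (tdist L x y)"
    using step by auto
  have tree: "tree_at ?k = attach_cherry ?i ?k (tree_at L)"
    using step by (simp add: tree_at_def)
  have i: "?i \<in> {1..L}" using R by auto
  note ctx = IH(1) i HOL.refl step(1) tree
  define good where "good x y \<longleftrightarrow> (\<exists>qs. (\<forall>qs'. inner_path (tree_at ?k) x y qs' \<longleftrightarrow> qs' = qs) \<and>
    length qs = Suc (tdist ?k x y))" for x y
  have old: "good x y" if xy: "x \<in> {1..L} - {?i}" "y \<in> {1..L} - {?i}" "x \<noteq> y" for x y
  proof -
    have "tdist ?k x y = tdist L x y" using xy step(1) by (auto simp: sub_leaf_def doubleton_eq_iff)
    then show ?thesis
      using IH(2)[of x y] inner_path_old[OF ctx xy(1,2)] xy by (auto simp: good_def)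
  qed
  have cherry: "good x y" if xy: "x \<in> {1..L} - {?i}" "y \<in> {?i, ?k}" for x y
  proof -
    obtain qs where qs: "\<And>qs'. inner_path (tree_at L) x ?i qs' \<longleftrightarrow> qs' = qs" "length qs = Suc (tdist L x ?i)"
      using IH(2)[of x ?i] xy i by auto
    have "tdist ?k x y = Suc (tdist L x ?i)" using xy step(1) by (auto simp: sub_leaf_def doubleton_eq_iff)
    then show ?thesis
      unfolding good_def inner_path_to_cherry[OF ctx xy] using qs by (intro exI[of _ "qs @ [?k]"]) auto
  qed
  have both: "good ?i ?k"
    unfolding good_def inner_path_cherry[OF ctx] by (intro exI[of _ "[?k]"]) simp
  have swap: "good y x" if good: "good x y" for x y
  proof -
    obtain qs where qs: "\<And>qs'. inner_path (tree_at ?k) x y qs' \<longleftrightarrow> qs' = qs" "length qs = Suc (tdist ?k x y)"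
      using good unfolding good_def by blast
    have "inner_path (tree_at ?k) y x qs' \<longleftrightarrow> qs' = rev qs" for qs'
      unfolding inner_path_rev[of _ y x] qs(1) by (rule rev_swap)
    moreover have "length (rev qs) = Suc (tdist ?k y x)"
      using qs(2) by (simp only: length_rev tdist_commute[of ?k y x])
    ultimately show ?thesis unfolding good_def by blast
  qed
  have all: "good x y" if xy: "x \<in> {1..?k}" "y \<in> {1..?k}" "x \<noteq> y" for x y
  proof -
    have split: "v \<in> {1..L} - {?i} \<or> v = ?i \<or> v = ?k" if "v \<in> {1..?k}" for v
      using that by auto
    from split[OF xy(1)] split[OF xy(2)] xy(3)
    consider "x \<in> {1..L} - {?i}" "y \<in> {1..L} - {?i}" | "x \<in> {1..L} - {?i}" "y \<in> {?i, ?k}"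
      | "x \<in> {?i, ?k}" "y \<in> {1..L} - {?i}" | "x = ?i" "y = ?k" | "x = ?k" "y = ?i"
      by blast
    then show ?thesis
    proof cases
      case 1
      then show ?thesis using old xy(3) by blast
    next
      case 2
      then show ?thesis by (rule cherry)
    next
      case 3
      then show ?thesis using swap[OF cherry] by blast
    next
      case 4
      then show ?thesis using both by simp
    next
      case 5
      then show ?thesis using swap[OF both] by simp
    qed
  qed
  have "leaf_tree ?k (tree_at ?k)" by (rule leaf_tree_attach_cherry[OF ctx])
  with all show ?case unfolding good_def by blast
qed

lemma tree_weight_eq:
  assumes "x \<noteq> y" "x \<in> {1..n}" "y \<in> {1..n}"
  shows "sym_weight (tree_weight n S) x y = - real (tdist n x y)"
proof -
  have main: "tree_weight n S (x, y) = - real (tdist n x y)"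
    if xy: "x < y" and range: "x \<in> {1..n}" "y \<in> {1..n}" for x y
  proof -
    note T = tree_at_paths[OF n_ge order_refl]
    have ne: "x \<noteq> y" using xy by simp
    obtain qs where qs: "\<And>qs'. inner_path (tree_at n) x y qs' \<longleftrightarrow> qs' = qs" "length qs = Suc (tdist n x y)"
      using conjunct2[OF T, rule_format, OF range ne] by blast
    have path: "is_path (tree_of n S) (Leaf x) (Leaf y) ps \<longleftrightarrow> ps = Leaf x # map Inner qs @ [Leaf y]" for ps
      unfolding tree_of_eq is_path_iff_inner_path[OF conjunct1[OF T] ne] qs(1) by simp
    have "(THE ps. is_path (tree_of n S) (Leaf x) (Leaf y) ps) = Leaf x # map Inner qs @ [Leaf y]"
      unfolding path by simp
    moreover have "distinct qs" using qs(1)[of qs] by (simp add: inner_path_def)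
    ultimately show ?thesis
      using xy range qs(2) card_internal_edges_on[of qs x y] by (simp add: tree_weight_def plucker_idx_def)
  qed
  then show ?thesis
    using assms main[of x y] main[of y x] tdist_commute[of n x y]
    by (cases x y rule: linorder_cases) (auto simp: sym_weight_def)
qed

subsection \<open>The four-point condition\<close>

lemma tdist_step:
  assumes "4 \<le> L" "{x, y} \<noteq> {ii L, L}"
  shows "tdist L x y = tdist (L - 1) (sub_leaf L x) (sub_leaf L y) +
    (of_bool (x \<in> {ii L, L}) + of_bool (y \<in> {ii L, L}))"
  using assms by (cases L) auto

lemma tdist_cherry: "4 \<le> L \<Longrightarrow> tdist L (ii L) L = 0"
  by (cases L) auto

lemma tdist_triangle:
  assumes "3 \<le> L" "L \<le> n" "distinct [x, y, z]" "{x, y, z} \<subseteq> {1..L}"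
  shows "tdist L x y \<le> tdist L x z + tdist L z y"
  using assms
proof (induction L arbitrary: x y z rule: dec_induct)
  case base
  show ?case by (simp add: numeral_3_eq_3)
next
  case (step L)
  let ?k = "Suc L" let ?i = "ii ?k"
  have k: "3 \<le> ?k" "?k \<le> n" "4 \<le> ?k" using step by auto
  note R = roots[OF k(1,2)]
  note cherry = tdist_cherry[OF k(3)]
  consider "{x, y} = {?i, ?k}" | "{x, z} = {?i, ?k}" | "{z, y} = {?i, ?k}"
    | "{x, y} \<noteq> {?i, ?k}" "{x, z} \<noteq> {?i, ?k}" "{z, y} \<noteq> {?i, ?k}" by blast
  then show ?case
  proof cases
    case 1
    then show ?thesis using cherry tdist_commute[of ?k x y] by (auto simp: doubleton_eq_iff simp del: tdist.simps)
  next
    case 2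
    then have "tdist ?k x y = tdist ?k z y"
      using tdist_step[OF k(3), of x y] tdist_step[OF k(3), of z y] step(5) R
      by (auto simp: doubleton_eq_iff sub_leaf_def simp del: tdist.simps)
    then show ?thesis by simp
  next
    case 3
    then have "tdist ?k x y = tdist ?k x z"
      using tdist_step[OF k(3), of x y] tdist_step[OF k(3), of x z] step(5) R
      by (auto simp: doubleton_eq_iff sub_leaf_def simp del: tdist.simps)
    then show ?thesis by simp
  next
    case 4
    let ?r = "sub_leaf ?k"
    have "distinct [?r x, ?r y, ?r z]" "{?r x, ?r y, ?r z} \<subseteq> {1..L}"
      using 4 step(5,6) R by (auto simp: sub_leaf_def doubleton_eq_iff)
    then have "tdist L (?r x) (?r y) \<le> tdist L (?r x) (?r z) + tdist L (?r z) (?r y)"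
      using step(3) k by simp
    then show ?thesis
      using tdist_step[OF k(3) 4(1)] tdist_step[OF k(3) 4(2)] tdist_step[OF k(3) 4(3)]
      by (simp del: tdist.simps)
  qed
qed

lemma balanced_sym:
  "balanced L x y z w \<longleftrightarrow> balanced L y x z w" "balanced L x y z w \<longleftrightarrow> balanced L z w x y"
  by (auto simp: balanced_def vv_commute add.commute)

text \<open>The variable \<open>b L\<close> occurs only in the exponent of the cherry edge, and it could not occur
  on one side of the balance only.\<close>

lemma balanced_not_cherry:
  assumes L: "3 \<le> L" "L \<le> n" and bal: "balanced L x y z w"
  shows "{x, z} \<noteq> {ii L, L}"
proof
  assume xz: "{x, z} = {ii L, L}"
  have coeff: "Poly_Mapping.lookup (vv u v) (b L) = (if {u, v} = {ii L, L} then 1 else 0)"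
    if "u \<noteq> v" "u \<in> {1..L}" "v \<in> {1..L}" for u v
  proof -
    have "edge u v = (ii L, L) \<longleftrightarrow> {u, v} = {ii L, L}"
      using roots[OF L] edge_eq_iff[of u v "ii L" L] by (auto simp: doubleton_eq_iff)
    then show ?thesis
      using lookup_lv(2)[OF L, of "edge u v"] that by (simp add: edge_in_plucker_idx)
  qed
  have d: "distinct [x, y, z, w]" "{x, y, z, w} \<subseteq> {1..L}"
    and eq: "vv x z + vv y w = vv x w + vv y z"
    using bal by (auto simp: balanced_def)
  have "Poly_Mapping.lookup (vv x z + vv y w) (b L) = Poly_Mapping.lookup (vv x w + vv y z) (b L)"
    using eq by simp
  moreover have "{x, w} \<noteq> {ii L, L}" "{y, z} \<noteq> {ii L, L}"
    using xz d by (auto simp: doubleton_eq_iff)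
  ultimately show False
    using coeff[of x z] coeff[of x w] coeff[of y z] xz d by (simp add: lookup_add)
qed

text \<open>If the cherry is part of the quadruple it is one side of the split, and the inequality is the triangle
  inequality with two edges to spare. Otherwise the quadruple is merged to a smaller one, all pairings being
  shortened by the same amount.\<close>

lemma tdist_four_point:
  assumes "3 \<le> L" "L \<le> n" "balanced L x y z w"
  shows "tdist L x z + tdist L y w = tdist L x w + tdist L y z \<and>
    tdist L x y + tdist L z w < tdist L x z + tdist L y w"
  using assms
proof (induction L arbitrary: x y z w rule: dec_induct)
  case base
  then have "card {x, y, z, w} \<le> card {1..3::nat}" "card {x, y, z, w} = 4"
    by (auto simp: balanced_def intro!: card_mono)
  then show ?case by simp
next
  case (step L)
  let ?k = "Suc L" let ?i = "ii ?k"
  have k: "3 \<le> ?k" "?k \<le> n" "4 \<le> ?k" using step by auto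
  note R = roots[OF k(1,2)]
  let ?r = "sub_leaf ?k"
  have cherry: "tdist ?k x z + tdist ?k y w = tdist ?k x w + tdist ?k y z \<and>
      tdist ?k x y + tdist ?k z w < tdist ?k x z + tdist ?k y w"
    if xy: "{x, y} = {?i, ?k}" and bal: "balanced ?k x y z w" for x y z w
  proof -
    have d: "distinct [x, y, z, w]" "{x, y, z, w} \<subseteq> {1..?k}" using bal by (auto simp: balanced_def)
    have zw: "z \<notin> {?i, ?k}" "w \<notin> {?i, ?k}" using d xy by (auto simp: doubleton_eq_iff)
    have D: "tdist ?k u v = Suc (tdist L ?i v)" if "u \<in> {x, y}" "v \<in> {z, w}" for u v
      using tdist_step[OF k(3), of u v] that zw xy
      by (auto simp: doubleton_eq_iff sub_leaf_def simp del: tdist.simps)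
    have "tdist ?k z w = tdist L z w"
      using tdist_step[OF k(3), of z w] zw by (auto simp: sub_leaf_def simp del: tdist.simps)
    moreover have "tdist L z w \<le> tdist L z ?i + tdist L ?i w"
      by (rule tdist_triangle) (use d zw R step(1) k in \<open>auto simp: le_Suc_eq\<close>)
    moreover have "tdist ?k x y = 0"
      using xy tdist_cherry[OF k(3)] tdist_commute[of ?k x y] by (auto simp: doubleton_eq_iff simp del: tdist.simps)
    ultimately show ?thesis using D tdist_commute[of L z ?i] by (simp del: tdist.simps)
  qed
  show ?case
  proof (cases "{x, y} = {?i, ?k} \<or> {z, w} = {?i, ?k}")
    case True
    then show ?thesis
    proof
      assume "{x, y} = {?i, ?k}"
      then show ?thesis using cherry step(5) by blast
    next
      assume "{z, w} = {?i, ?k}"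
      from cherry[OF this, of x y] step(5) balanced_sym(2) show ?thesis
        using tdist_commute[of ?k] by (simp add: add.commute del: tdist.simps)
    qed
  next
    case False
    have bal: "balanced ?k x y z w" "balanced ?k y x z w" "balanced ?k x y w z" "balanced ?k y x w z"
      using step(5) by (auto simp: balanced_def vv_commute add.commute)
    have ne: "{x, y} \<noteq> {?i, ?k}" "{z, w} \<noteq> {?i, ?k}" "{x, z} \<noteq> {?i, ?k}" "{y, w} \<noteq> {?i, ?k}"
      "{x, w} \<noteq> {?i, ?k}" "{y, z} \<noteq> {?i, ?k}"
      using False bal[THEN balanced_not_cherry[OF k(1,2)]] by auto
    have d: "distinct [x, y, z, w]" "{x, y, z, w} \<subseteq> {1..?k}" using step(5) by (auto simp: balanced_def)
    have "?r u \<noteq> ?r v" if "u \<noteq> v" "{u, v} \<noteq> {?i, ?k}" for u v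
      using that by (auto simp: sub_leaf_def doubleton_eq_iff)
    then have "distinct [?r x, ?r y, ?r z, ?r w]"
      using d(1) ne by simp
    then have "balanced L (?r x) (?r y) (?r z) (?r w)"
      using balanced_merge_iff[OF k(1,2) _ d(2)] step(5) by simp
    from step(3)[OF _ this] k show ?thesis
      unfolding tdist_step[OF k(3) ne(1)] tdist_step[OF k(3) ne(2)] tdist_step[OF k(3) ne(3)]
        tdist_step[OF k(3) ne(4)] tdist_step[OF k(3) ne(5)] tdist_step[OF k(3) ne(6)]
      by simp
  qed
qed

lemma tree_metric_tree_weight: "tree_metric (tree_weight n S)"
  unfolding tree_metric_def
proof (intro allI impI)
  fix x y z w assume bal: "balanced n x y z w"
  then have "distinct [x, y, z, w]" "{x, y, z, w} \<subseteq> {1..n}" by (auto simp: balanced_def)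
  then show "sym_weight (tree_weight n S) x z + sym_weight (tree_weight n S) y w =
      sym_weight (tree_weight n S) x w + sym_weight (tree_weight n S) y z \<and>
    sym_weight (tree_weight n S) x z + sym_weight (tree_weight n S) y w <
      sym_weight (tree_weight n S) x y + sym_weight (tree_weight n S) z w"
    using tdist_four_point[OF n_ge order_refl bal] by (simp add: tree_weight_eq)
qed

end

section \<open>The cone of the tree\<close>

lemma continuous_on_sym_weight: "continuous_on UNIV (\<lambda>u. sym_weight u x y)"
  unfolding sym_weight_def by (rule continuous_on_product_coordinates)

context iterated
begin

lemma wt_sym_weight: "wt u (mexp {#edge x y, edge z w#}) = sym_weight u x y + sym_weight u z w"
  by (simp add: sym_weight_def del: mexp_add_mset)

lemma w_mult_pairing:
  assumes "x \<noteq> y" "z \<noteq> w" "{x, y, z, w} \<subseteq> {1..n}"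
  shows "w_mult n u (mexp {#edge x y, edge z w#}) = sym_weight u x y + sym_weight u z w"
proof -
  have "Poly_Mapping.keys (mexp {#edge x y, edge z w#}) \<subseteq> plucker_idx n"
    using assms by (simp add: edge_in_plucker_idx del: mexp_add_mset)
  then show ?thesis by (simp only: w_mult_eq_wt wt_sym_weight)
qed

lemma init_form_w_in_init_ideal_w:
  assumes "f \<in> plucker_ideal n"
  shows "init_form_w n u f \<in> init_ideal_w n u (plucker_ideal n)"
proof -
  have "init_form_w n u ` plucker_ideal n \<subseteq> carrier (plucker_ring n)"
    using plucker_ideal_subset initial_part_closed unfolding init_form_w_eq plucker_ring_def by blast
  from ring.genideal_self[OF _ this] show ?thesis
    using assms by (auto simp: init_ideal_w_def plucker_ring_def ring_poly_ring)
qed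

lemma ideal_init_ideal_w: "ideal (init_ideal_w n u (plucker_ideal n)) (poly_ring (plucker_idx n))"
proof -
  have "init_form_w n u ` plucker_ideal n \<subseteq> carrier (plucker_ring n)"
    using plucker_ideal_subset initial_part_closed unfolding init_form_w_eq plucker_ring_def by blast
  from ring.genideal_ideal[OF _ this] show ?thesis
    by (auto simp: init_ideal_w_def plucker_ring_def ring_poly_ring)
qed

text \<open>Otherwise the initial part of the relation of the four leaves would be a single term.\<close>

lemma min_attained_twice:
  assumes mf: "monomial_free (init_ideal_w n u (plucker_ideal n))"
    and quad: "distinct [x, y, z, w]" "{x, y, z, w} \<subseteq> {1..n}"
    and big: "sym_weight u x z + sym_weight u y w < sym_weight u x y + sym_weight u z w"
      "sym_weight u x w + sym_weight u y z < sym_weight u x y + sym_weight u z w"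
  shows "sym_weight u x z + sym_weight u y w = sym_weight u x w + sym_weight u y z"
proof (rule ccontr)
  assume ne: "sym_weight u x z + sym_weight u y w \<noteq> sym_weight u x w + sym_weight u y z"
  let ?m1 = "mexp {#edge x y, edge z w#}"
  let ?m2 = "mexp {#edge x z, edge y w#}"
  let ?m3 = "mexp {#edge x w, edge y z#}"
  obtain k1 k2 k3 where k: "k1 \<noteq> 0" "k2 \<noteq> 0" "k3 \<noteq> 0" and I: "three_term x y z w k1 k2 k3 \<in> plucker_ideal n"
    using plucker_relation[OF quad] by blast
  have W: "w_mult n u ?m1 = sym_weight u x y + sym_weight u z w"
    "w_mult n u ?m2 = sym_weight u x z + sym_weight u y w"
    "w_mult n u ?m3 = sym_weight u x w + sym_weight u y z"
    using quad by (auto intro!: w_mult_pairing simp del: mexp_add_mset)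
  have init: "init_form_w n u (three_term x y z w k1 k2 k3) = Poly_Mapping.single ?m2 k2 \<or>
      init_form_w n u (three_term x y z w k1 k2 k3) = Poly_Mapping.single ?m3 k3"
    unfolding init_form_w_eq three_term_def initial_part_three[OF pairings_distinct[OF quad(1)] k] W
    using big ne by (auto simp: not_less)
  have mono: "monomial m \<in> init_ideal_w n u (plucker_ideal n)"
    if "Poly_Mapping.single m k \<in> init_ideal_w n u (plucker_ideal n)" "k \<noteq> 0" for m k
  proof -
    have "monomial m = Poly_Mapping.single 0 (1 / k) * Poly_Mapping.single m k"
      using that(2) by (simp add: monomial_def mult_single)
    then show ?thesis
      using ideal_poly_ringD(4)[OF ideal_init_ideal_w that(1)] by (simp add: single_in_poly_ring)
  qed
  have "monomial ?m2 \<in> init_ideal_w n u (plucker_ideal n) \<or>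
      monomial ?m3 \<in> init_ideal_w n u (plucker_ideal n)"
    using init init_form_w_in_init_ideal_w[OF I, of u] mono k by metis
  then show False using mf unfolding monomial_free_def by blast
qed

text \<open>The pairing \<open>xy, zw\<close> is alone in its fibre of the monomial map, so it cannot occur in the
  initial part of the relation. The other two pairings share a fibre and cancel, so either both occur or neither
  does.\<close>

lemma tree_metricI:
  assumes "init_ideal_w n u (plucker_ideal n) = toric_ideal"
  shows "tree_metric u"
  unfolding tree_metric_def
proof (intro allI impI)
  fix x y z w assume bal: "balanced n x y z w"
  then have quad: "distinct [x, y, z, w]" "{x, y, z, w} \<subseteq> {1..n}"
    and eq: "vv x z + vv y w = vv x w + vv y z"
    by (auto simp: balanced_def)
  interpret O: iterated_order n ii jj "\<lambda>e e'. prec_Psi S (root_part e) (root_part e')"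
    by (rule iterated_order_Psi)
  let ?m1 = "mexp {#edge x y, edge z w#}"
  let ?m2 = "mexp {#edge x z, edge y w#}"
  let ?m3 = "mexp {#edge x w, edge y z#}"
  obtain k1 k2 k3 where k: "k1 \<noteq> 0" "k2 \<noteq> 0" "k3 \<noteq> 0" and I: "three_term x y z w k1 k2 k3 \<in> plucker_ideal n"
    using plucker_relation[OF quad] by blast
  let ?W = "w_mult n u"
  let ?c = "\<lambda>m m' m'' k. if ?W m' < ?W m \<or> ?W m'' < ?W m then 0 else k"
  have W: "?W ?m1 = sym_weight u x y + sym_weight u z w"
    "?W ?m2 = sym_weight u x z + sym_weight u y w"
    "?W ?m3 = sym_weight u x w + sym_weight u y z"
    using quad by (auto intro!: w_mult_pairing simp del: mexp_add_mset)
  have init: "init_form_w n u (three_term x y z w k1 k2 k3) =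
      Poly_Mapping.single ?m1 (?c ?m1 ?m2 ?m3 k1) + Poly_Mapping.single ?m2 (?c ?m2 ?m1 ?m3 k2) +
      Poly_Mapping.single ?m3 (?c ?m3 ?m1 ?m2 k3)"
    unfolding init_form_w_eq three_term_def initial_part_three[OF pairings_distinct[OF quad(1)] k]
    by (auto simp del: mexp_add_mset)
  have wts: "wt lv ?m1 = vv x y + vv z w" "wt lv ?m2 = vv x z + vv y w" "wt lv ?m3 = vv x z + vv y w"
    using eq by (simp_all add: wt_mexp del: mexp_add_mset)
  have nz: "eval_mon lc ?m1 \<noteq> 0" "eval_mon lc ?m2 \<noteq> 0" "eval_mon lc ?m3 \<noteq> 0"
    using quad by (auto intro!: O.eval_mon_lc_nonzero simp: edge_in_plucker_idx simp del: mexp_add_mset)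
  have "eval_poly (monomial_map lv lc) (init_form_w n u (three_term x y z w k1 k2 k3)) = 0"
    using init_form_w_in_init_ideal_w[OF I, of u] assms by (simp add: toric_ideal_def)
  then have zero: "Poly_Mapping.single (vv x y + vv z w) (?c ?m1 ?m2 ?m3 k1 * eval_mon lc ?m1) +
      Poly_Mapping.single (vv x z + vv y w) (?c ?m2 ?m1 ?m3 k2 * eval_mon lc ?m2 +
        ?c ?m3 ?m1 ?m2 k3 * eval_mon lc ?m3) = 0"
    unfolding init eval_poly_add eval_poly_single eval_mon_monomial_map wts mult_single single_add
    by (simp only: add_0 add.assoc)
  have ne: "vv x y + vv z w \<noteq> vv x z + vv y w"
    using O.balanced_less[OF quad eq] O.less_irrefl by metis
  from arg_cong[OF zero, of "\<lambda>f. Poly_Mapping.lookup f (vv x y + vv z w)"]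
    arg_cong[OF zero, of "\<lambda>f. Poly_Mapping.lookup f (vv x z + vv y w)"] ne
  have "?c ?m1 ?m2 ?m3 k1 * eval_mon lc ?m1 = 0"
    "?c ?m2 ?m1 ?m3 k2 * eval_mon lc ?m2 + ?c ?m3 ?m1 ?m2 k3 * eval_mon lc ?m3 = 0"
    by (simp_all only: lookup_add lookup_single when_def lookup_zero if_False if_True simp_thms add_0 add_0_right
        refl ne[symmetric])
  then have "?W ?m2 < ?W ?m1 \<or> ?W ?m3 < ?W ?m1"
    "(?W ?m1 < ?W ?m2 \<or> ?W ?m3 < ?W ?m2) \<longleftrightarrow> (?W ?m1 < ?W ?m3 \<or> ?W ?m2 < ?W ?m3)"
    using nz k by (auto simp del: mexp_add_mset split: if_splits)
  then show "sym_weight u x z + sym_weight u y w = sym_weight u x w + sym_weight u y z \<and>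
      sym_weight u x z + sym_weight u y w < sym_weight u x y + sym_weight u z w"
    unfolding W by linarith
qed

text \<open>Weights near a tree metric satisfy its strict inequalities, and in the tropical Grassmannian
  also its equations.\<close>

lemma tree_cone_class:
  assumes t: "tree_metric t" "t \<in> closure A"
    and A: "\<And>u. u \<in> A \<Longrightarrow> monomial_free (init_ideal_w n u (plucker_ideal n))"
  shows "\<exists>u\<in>A. tree_metric u"
proof -
  define B where "B = {(x, y, z, w). balanced n x y z w}"
  have "finite B"
    by (rule finite_subset[of _ "{1..n} \<times> {1..n} \<times> {1..n} \<times> {1..n}"]) (auto simp: B_def balanced_def)
  define G where "G = (\<Inter>(x, y, z, w)\<in>B.
    {u. sym_weight u x z + sym_weight u y w < sym_weight u x y + sym_weight u z w} \<inter>
    {u. sym_weight u x w + sym_weight u y z < sym_weight u x y + sym_weight u z w})"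
  have "open G"
    unfolding G_def
    by (intro open_INT \<open>finite B\<close> ballI)
      (auto intro!: open_Int open_Collect_less continuous_on_add continuous_on_sym_weight split: prod.splits)
  moreover have "t \<in> G"
  proof -
    have "sym_weight t x z + sym_weight t y w < sym_weight t x y + sym_weight t z w \<and>
        sym_weight t x w + sym_weight t y z < sym_weight t x y + sym_weight t z w"
      if "balanced n x y z w" for x y z w
      using tree_metricD[OF t(1) that] by simp
    then show ?thesis by (auto simp: G_def B_def)
  qed
  ultimately obtain u where u: "u \<in> A" "u \<in> G"
    using t(2) by (meson closure_iff_nhds_not_empty disjoint_iff open_Int subset_refl)
  have "tree_metric u"
    unfolding tree_metric_def
  proof (intro allI impI)
    fix x y z w assume bal: "balanced n x y z w"
    then have "(x, y, z, w) \<in> B" by (simp add: B_def)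
    then have *: "sym_weight u x z + sym_weight u y w < sym_weight u x y + sym_weight u z w"
      "sym_weight u x w + sym_weight u y z < sym_weight u x y + sym_weight u z w"
      using u(2) by (auto simp: G_def)
    have "distinct [x, y, z, w]" "{x, y, z, w} \<subseteq> {1..n}" using bal by (auto simp: balanced_def)
    from min_attained_twice[OF A[OF u(1)] this *] *
    show "sym_weight u x z + sym_weight u y w = sym_weight u x w + sym_weight u y z \<and>
      sym_weight u x z + sym_weight u y w < sym_weight u x y + sym_weight u z w" by simp
  qed
  then show ?thesis using u(1) by blast
qed

lemma closure_weak_tree_metric:
  assumes "u \<in> closure {u \<in> A. tree_metric u}" "balanced n x y z w"
  shows "sym_weight u x z + sym_weight u y w = sym_weight u x w + sym_weight u y z"
    "sym_weight u x z + sym_weight u y w \<le> sym_weight u x y + sym_weight u z w"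
proof -
  let ?F = "{u. sym_weight u x z + sym_weight u y w = sym_weight u x w + sym_weight u y z} \<inter>
    {u. sym_weight u x z + sym_weight u y w \<le> sym_weight u x y + sym_weight u z w}"
  have "closed ?F"
    by (intro closed_Int closed_Collect_eq closed_Collect_le continuous_on_add continuous_on_sym_weight)
  moreover have "{u \<in> A. tree_metric u} \<subseteq> ?F"
    using tree_metricD[OF _ assms(2)] by fastforce
  ultimately have "closure {u \<in> A. tree_metric u} \<subseteq> ?F" by (rule closure_minimal[rotated])
  then show "sym_weight u x z + sym_weight u y w = sym_weight u x w + sym_weight u y z"
    "sym_weight u x z + sym_weight u y w \<le> sym_weight u x y + sym_weight u z w"
    using assms(1) by auto
qed

text \<open>The whole line through \<open>t\<close> and \<open>u\<close> lies in the affine hull, and its points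
  near \<open>u\<close> lie in a relatively open subset of \<open>C\<close>.\<close>

lemma rel_interior_extend:
  assumes "u \<in> weight_rel_interior C" "u \<in> C" "t \<in> C"
  shows "\<exists>\<epsilon>>0. (\<lambda>p. u p + \<epsilon> * (u p - t p)) \<in> C"
proof -
  let ?g = "\<lambda>\<epsilon>::real. \<lambda>p. u p + \<epsilon> * (u p - t p)"
  obtain U where U: "openin (top_of_set (weight_affine_hull C)) U" "u \<in> U" "U \<subseteq> C"
    using assms(1) by (auto simp: weight_rel_interior_def)
  then obtain T where T: "open T" "U = weight_affine_hull C \<inter> T" by (auto simp: openin_open)
  have hull: "?g \<epsilon> \<in> weight_affine_hull C" for \<epsilon>
  proof (cases "u = t")
    case True
    then have "?g \<epsilon> = (\<lambda>p. \<Sum>c\<in>{u}. 1 * c p)" by simp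
    then show ?thesis
      unfolding weight_affine_hull_def using assms(2)
      by (intro CollectI exI[of _ "{u}"] exI[of _ "\<lambda>_. 1"]) auto
  next
    case False
    then have "?g \<epsilon> = (\<lambda>p. \<Sum>c\<in>{u, t}. (if c = u then 1 + \<epsilon> else - \<epsilon>) * c p)"
      by (auto simp: algebra_simps)
    then show ?thesis
      unfolding weight_affine_hull_def using assms(2,3) False
      by (intro CollectI exI[of _ "{u, t}"] exI[of _ "\<lambda>c. if c = u then 1 + \<epsilon> else - \<epsilon>"]) auto
  qed
  have "continuous_on UNIV ?g"
    by (intro continuous_on_coordinatewise_then_product continuous_intros)
  then have "open (?g -` T)" using T(1) by (simp add: open_vimage)
  moreover have "0 \<in> ?g -` T" using U(2) T(2) by simp
  ultimately obtain e where e: "e > 0" "\<And>\<epsilon>. dist \<epsilon> 0 < e \<Longrightarrow> \<epsilon> \<in> ?g -` T"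
    unfolding open_dist by blast
  then have "?g (e / 2) \<in> T" using e(2)[of "e / 2"] by simp
  then have "?g (e / 2) \<in> U" using T(2) hull by blast
  then show ?thesis using U(3) e(1) by (intro exI[of _ "e / 2"]) auto
qed

text \<open>The class of weights that defines \<open>C\<close> is the set of weights satisfying the four-point
  condition, and this condition is inherited by the relative interior of its closure.\<close>

theorem init_ideal_cone_eq_toric_ideal:
  assumes "is_tree_cone n S C"
  shows "init_ideal_cone n C (plucker_ideal n) = toric_ideal"
proof -
  let ?t = "tree_weight n S" and ?in = "\<lambda>u. init_ideal_w n u (plucker_ideal n)"
  have C: "C \<in> groebner_cones n" "C \<subseteq> trop_Gr n" and t: "?t \<in> weight_rel_interior C"
    using assms by (auto simp: is_tree_cone_def maximal_trop_cone_def trop_cones_def)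
  have sub: "weight_rel_interior C \<subseteq> C" by (auto simp: weight_rel_interior_def)
  obtain u0 where u0: "C = closure {u \<in> weight_space n. ?in u = ?in u0}"
    using C(1) by (auto simp: groebner_cones_def)
  let ?A = "{u \<in> weight_space n. ?in u = ?in u0}"
  have mf: "monomial_free (?in u)" if "u \<in> ?A" for u
    using that C(2) u0 closure_subset[of ?A] by (auto simp: trop_Gr_def)
  obtain u1 where "u1 \<in> ?A" "tree_metric u1"
    using tree_cone_class[OF tree_metric_tree_weight, of ?A] mf t sub u0 by blast
  then have in0: "?in u0 = toric_ideal" using init_ideal_w_eq_toric_ideal[of u1] by simp
  have "?A = {u \<in> weight_space n. tree_metric u}"
    unfolding in0 using tree_metricI init_ideal_w_eq_toric_ideal by blast
  then have C_eq: "C = closure {u \<in> weight_space n. tree_metric u}" using u0 by simp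
  have "tree_metric u" if u: "u \<in> weight_rel_interior C" for u
    unfolding tree_metric_def
  proof (intro allI impI)
    fix x y z w assume bal: "balanced n x y z w"
    have uC: "u \<in> C" using u sub by blast
    note weak = closure_weak_tree_metric[OF _ bal]
    obtain \<epsilon> where \<epsilon>: "\<epsilon> > 0" "(\<lambda>p. u p + \<epsilon> * (u p - ?t p)) \<in> C"
      using rel_interior_extend[OF u uC] t sub by blast
    let ?s = "\<lambda>v. sym_weight v x y + sym_weight v z w - (sym_weight v x z + sym_weight v y w)"
    \<comment> \<open>Beyond \<open>u\<close>, on the line from the tree metric through \<open>u\<close>, a tight inequality would fail.\<close>
    have "0 \<le> ?s (\<lambda>p. u p + \<epsilon> * (u p - ?t p))" using weak(2) \<epsilon>(2) C_eq by simp
    also have "\<dots> = ?s u + \<epsilon> * (?s u - ?s ?t)" by (simp add: sym_weight_def algebra_simps)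
    finally have "\<epsilon> * ?s ?t \<le> (1 + \<epsilon>) * ?s u" by (simp add: algebra_simps)
    moreover have "0 < \<epsilon> * ?s ?t"
      using \<epsilon>(1) tree_metricD(2)[OF tree_metric_tree_weight bal] by simp
    ultimately have "0 < (1 + \<epsilon>) * ?s u" by linarith
    then have "0 < ?s u" using \<epsilon>(1) by (simp add: zero_less_mult_iff)
    then show "sym_weight u x z + sym_weight u y w = sym_weight u x w + sym_weight u y z \<and>
        sym_weight u x z + sym_weight u y w < sym_weight u x y + sym_weight u z w"
      using weak(1)[of u] uC C_eq by simp
  qed
  then have all: "?in u = toric_ideal" if "u \<in> weight_rel_interior C" for u
    using that init_ideal_w_eq_toric_ideal by blast
  show ?thesis
    unfolding init_ideal_cone_def
  proof (rule the_equality)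
    fix J assume "\<forall>u\<in>weight_rel_interior C. ?in u = J"
    then show "J = toric_ideal" using all[OF t] t by blast
  qed (use all in blast)
qed

end

theorem proposition2:
  fixes n :: nat and S :: root_seq
  assumes "4 \<le> n" and "iterated_sequence n S"
  shows "init_ideal_M n S (plucker_ideal n) = init_ideal_w n (tree_weight n S) (plucker_ideal n) \<and>
    (\<forall>C. is_tree_cone n S C \<longrightarrow>
      init_ideal_M n S (plucker_ideal n) = init_ideal_cone n C (plucker_ideal n))"
proof -
  obtain i j where ij: "\<forall>k\<in>{3..n}. i k \<in> {1..k - 1} \<and> j k \<in> {1..k - 1} \<and> i k \<noteq> j k"
    and S: "S = concat (map (\<lambda>k. [(i k, k), (j k, k)]) (rev [3..<Suc n]))"
    using assms(2) unfolding iterated_sequence_def by blast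
  interpret I: iterated n i j
    by unfold_locales (use assms(1) ij in force)+
  have "S = I.S" using S by (simp only: I.S_def)
  then show ?thesis
    using I.init_ideal_M_eq_toric_ideal I.init_ideal_cone_eq_toric_ideal
      I.init_ideal_w_eq_toric_ideal[OF I.tree_metric_tree_weight] by simp
qed

end
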